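(* Let $(G,J,g)$ be a Lie-Hermitian manifold, namely, $G$ is a (connected) Lie group, $J$ a left invariant complex structure on $G$, and $g$ a left invariant metric on $G$ compatible with $J$. If $J$ is a nilpotent complex structure in the sense of Cordero, Fernández, Gray and Ugarte, then $(G,J,g)$ is Riemannian Kähler-like if and only if $G$ is abelian.
   Context: For a metric connection $D$ (that is, $Dg=0$) on a Hermitian manifold $(M,g)$ with complex structure $J$, write $R^D(X,Y,Z,W)=\langle D_XD_YZ-D_YD_XZ-D_{[X,Y]}Z,\,W\rangle$, where $\langle\,,\rangle=g$. $D$ is called Kähler-like if $R^D$ has all the symmetries of the curvature tensor of a Kähler metric, i.e. for all tangent vectors $X,Y,Z,W$: $R^D(X,Y,Z,W)+R^D(Y,Z,X,W)+R^D(Z,X,Y,W)=0$ and $R^D(X,Y,JZ,JW)=R^D(X,Y,Z,W)$. The manifold is Riemannian Kähler-like if the Riemannian (Levi-Civita) connection $\nabla$ of $g$ is Kähler-like (for $\nabla$ the first identity is automatic). A left invariant complex structure $J$ on $G$ with Lie algebra $\mathfrak{g}$ is nilpotent (in the sense of Cordero, Fernández, Gray and Ugarte) if the ascending series of ideals $\mathfrak{a}_0=0$, $\mathfrak{a}_k=\{X\in\mathfrak{g}: [X,\mathfrak{g}]\subseteq\mathfrak{a}_{k-1},\ [JX,\mathfrak{g}]\subseteq\mathfrak{a}_{k-1}\}$ for $k\ge1$ satisfies $\mathfrak{a}_k=\mathfrak{g}$ for some $k$. *)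

theory Defs
  imports "HOL-Analysis.Analysis" "HOL-Library.Function_Algebras"
begin

text \<open>
  Real-valued functions, vector fields and operators on vector fields are added and multiplied
  pointwise. Manifolds are whole types, Hausdorff and second countable by their type class, and
  modelled on an arbitrary Euclidean space \<open>'e\<close>.
\<close>

section \<open>Smooth manifolds\<close>

fun Ck_on :: "nat \<Rightarrow> ('a::euclidean_space \<Rightarrow> 'b::real_normed_vector) \<Rightarrow> 'a set \<Rightarrow> bool" where
  "Ck_on 0 f S \<longleftrightarrow> continuous_on S f"
| "Ck_on (Suc k) f S \<longleftrightarrow>
     (\<forall>x\<in>S. f differentiable (at x)) \<and> (\<forall>v. Ck_on k (\<lambda>x. frechet_derivative f (at x) v) S)"

text \<open>Meaningful only for open \<open>S\<close>, which is the only case used below.\<close>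

definition smooth_on :: "('a::euclidean_space \<Rightarrow> 'b::real_normed_vector) \<Rightarrow> 'a set \<Rightarrow> bool" where
  "smooth_on f S \<longleftrightarrow> (\<forall>k. Ck_on k f S)"

text \<open>A chart is a pair of its domain and its coordinate map.\<close>

type_synonym ('m, 'e) atlas = "('m set \<times> ('m \<Rightarrow> 'e)) set"

definition smooth_atlas ::
    "('m::{t2_space, second_countable_topology}, 'e::euclidean_space) atlas \<Rightarrow> bool" where
  "smooth_atlas A \<longleftrightarrow>
     (\<forall>(U, \<phi>)\<in>A. open U \<and> open (\<phi> ` U) \<and> homeomorphism U (\<phi> ` U) \<phi> (inv_into U \<phi>)) \<and>
     (\<Union>(U, \<phi>)\<in>A. U) = UNIV \<and>
     (\<forall>(U, \<phi>)\<in>A. \<forall>(V, \<psi>)\<in>A. smooth_on (\<psi> \<circ> inv_into U \<phi>) (\<phi> ` (U \<inter> V)))"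

definition smooth_map ::
    "('m::topological_space, 'd::euclidean_space) atlas \<Rightarrow>
     ('n::topological_space, 'e::euclidean_space) atlas \<Rightarrow> ('m \<Rightarrow> 'n) \<Rightarrow> bool" where
  "smooth_map A B F \<longleftrightarrow> continuous_on UNIV F \<and>
     (\<forall>(U, \<phi>)\<in>A. \<forall>(V, \<psi>)\<in>B. smooth_on (\<psi> \<circ> F \<circ> inv_into U \<phi>) (\<phi> ` (U \<inter> F -` V)))"

definition prod_atlas :: "('m, 'd) atlas \<Rightarrow> ('n, 'e) atlas \<Rightarrow> ('m \<times> 'n, 'd \<times> 'e) atlas" where
  "prod_atlas A B = {(U \<times> V, map_prod \<phi> \<psi>) | U \<phi> V \<psi>. (U, \<phi>) \<in> A \<and> (V, \<psi>) \<in> B}"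

definition smooth_fun :: "('m, 'e::euclidean_space) atlas \<Rightarrow> ('m \<Rightarrow> real) \<Rightarrow> bool" where
  "smooth_fun A f \<longleftrightarrow> (\<forall>(U, \<phi>)\<in>A. smooth_on (f \<circ> inv_into U \<phi>) (\<phi> ` U))"

section \<open>Vector fields and tensor fields\<close>

text \<open>
  A smooth vector field is a derivation of the algebra of smooth functions. Since HOL functions are
  total, a vector field is required to send every non-smooth function to \<open>0\<close>, so that equality
  of derivations is equality in HOL.
\<close>

type_synonym 'm vfield = "('m \<Rightarrow> real) \<Rightarrow> ('m \<Rightarrow> real)"

definition vector_fields :: "('m, 'e::euclidean_space) atlas \<Rightarrow> 'm vfield set" where
  "vector_fields A = {X.
     (\<forall>f. smooth_fun A f \<longrightarrow> smooth_fun A (X f)) \<and>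
     (\<forall>f. \<not> smooth_fun A f \<longrightarrow> X f = 0) \<and>
     (\<forall>f h. smooth_fun A f \<longrightarrow> smooth_fun A h \<longrightarrow> X (f + h) = X f + X h) \<and>
     (\<forall>c f. smooth_fun A f \<longrightarrow> X (\<lambda>p. c * f p) = (\<lambda>p. c * X f p)) \<and>
     (\<forall>f h. smooth_fun A f \<longrightarrow> smooth_fun A h \<longrightarrow> X (f * h) = f * X h + h * X f)}"

definition fscale :: "('m \<Rightarrow> real) \<Rightarrow> 'm vfield \<Rightarrow> 'm vfield" where
  "fscale h X = (\<lambda>f. h * X f)"

definition lie_bracket :: "'m vfield \<Rightarrow> 'm vfield \<Rightarrow> 'm vfield" where
  "lie_bracket X Y = (\<lambda>f. X (Y f) - Y (X f))"

text \<open>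
  Tensor fields are maps on vector fields that are linear over the smooth functions.
  Their values on arguments that are not vector fields are irrelevant.
\<close>

definition endomorphism_field ::
    "('m, 'e::euclidean_space) atlas \<Rightarrow> ('m vfield \<Rightarrow> 'm vfield) \<Rightarrow> bool" where
  "endomorphism_field A J \<longleftrightarrow>
     (\<forall>X\<in>vector_fields A. J X \<in> vector_fields A) \<and>
     (\<forall>X\<in>vector_fields A. \<forall>Y\<in>vector_fields A. J (X + Y) = J X + J Y) \<and>
     (\<forall>f. smooth_fun A f \<longrightarrow> (\<forall>X\<in>vector_fields A. J (fscale f X) = fscale f (J X)))"

definition nijenhuis :: "('m vfield \<Rightarrow> 'm vfield) \<Rightarrow> 'm vfield \<Rightarrow> 'm vfield \<Rightarrow> 'm vfield" where
  "nijenhuis J X Y =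
     lie_bracket (J X) (J Y) - J (lie_bracket (J X) Y) - J (lie_bracket X (J Y)) - lie_bracket X Y"

definition complex_structure ::
    "('m, 'e::euclidean_space) atlas \<Rightarrow> ('m vfield \<Rightarrow> 'm vfield) \<Rightarrow> bool" where
  "complex_structure A J \<longleftrightarrow> endomorphism_field A J \<and>
     (\<forall>X\<in>vector_fields A. J (J X) = - X) \<and>
     (\<forall>X\<in>vector_fields A. \<forall>Y\<in>vector_fields A. nijenhuis J X Y = 0)"

text \<open>In the last clause, \<open>X f p \<noteq> 0\<close> for some \<open>f\<close> says that \<open>X\<close> does not vanish at \<open>p\<close>.\<close>

definition riemannian_metric ::
    "('m, 'e::euclidean_space) atlas \<Rightarrow> ('m vfield \<Rightarrow> 'm vfield \<Rightarrow> 'm \<Rightarrow> real) \<Rightarrow> bool" where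
  "riemannian_metric A g \<longleftrightarrow>
     (\<forall>X\<in>vector_fields A. \<forall>Y\<in>vector_fields A. smooth_fun A (g X Y) \<and> g X Y = g Y X) \<and>
     (\<forall>X\<in>vector_fields A. \<forall>Y\<in>vector_fields A. \<forall>Z\<in>vector_fields A.
        g (X + Y) Z = g X Z + g Y Z) \<and>
     (\<forall>f. smooth_fun A f \<longrightarrow>
        (\<forall>X\<in>vector_fields A. \<forall>Y\<in>vector_fields A. g (fscale f X) Y = f * g X Y)) \<and>
     (\<forall>X\<in>vector_fields A. \<forall>p. (\<exists>f. X f p \<noteq> 0) \<longrightarrow> g X X p > 0)"

definition hermitian ::
    "('m, 'e::euclidean_space) atlas \<Rightarrow> ('m vfield \<Rightarrow> 'm vfield) \<Rightarrow>
     ('m vfield \<Rightarrow> 'm vfield \<Rightarrow> 'm \<Rightarrow> real) \<Rightarrow> bool" where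
  "hermitian A J g \<longleftrightarrow> complex_structure A J \<and> riemannian_metric A g \<and>
     (\<forall>X\<in>vector_fields A. \<forall>Y\<in>vector_fields A. g (J X) (J Y) = g X Y)"

section \<open>Connections and curvature\<close>

type_synonym 'm connection = "'m vfield \<Rightarrow> 'm vfield \<Rightarrow> 'm vfield"

definition affine_connection :: "('m, 'e::euclidean_space) atlas \<Rightarrow> 'm connection \<Rightarrow> bool" where
  "affine_connection A D \<longleftrightarrow>
     (\<forall>X\<in>vector_fields A. \<forall>Y\<in>vector_fields A. D X Y \<in> vector_fields A) \<and>
     (\<forall>X\<in>vector_fields A. \<forall>Y\<in>vector_fields A. \<forall>Z\<in>vector_fields A.
        D (X + Y) Z = D X Z + D Y Z \<and> D X (Y + Z) = D X Y + D X Z) \<and>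
     (\<forall>f. smooth_fun A f \<longrightarrow> (\<forall>X\<in>vector_fields A. \<forall>Y\<in>vector_fields A.
        D (fscale f X) Y = fscale f (D X Y) \<and>
        D X (fscale f Y) = fscale (X f) Y + fscale f (D X Y)))"

definition metric_connection ::
    "('m, 'e::euclidean_space) atlas \<Rightarrow> ('m vfield \<Rightarrow> 'm vfield \<Rightarrow> 'm \<Rightarrow> real) \<Rightarrow>
     'm connection \<Rightarrow> bool" where
  "metric_connection A g D \<longleftrightarrow> affine_connection A D \<and>
     (\<forall>X\<in>vector_fields A. \<forall>Y\<in>vector_fields A. \<forall>Z\<in>vector_fields A.
        X (g Y Z) = g (D X Y) Z + g Y (D X Z))"

definition levi_civita ::
    "('m, 'e::euclidean_space) atlas \<Rightarrow> ('m vfield \<Rightarrow> 'm vfield \<Rightarrow> 'm \<Rightarrow> real) \<Rightarrow>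
     'm connection \<Rightarrow> bool" where
  "levi_civita A g D \<longleftrightarrow> metric_connection A g D \<and>
     (\<forall>X\<in>vector_fields A. \<forall>Y\<in>vector_fields A. D X Y - D Y X = lie_bracket X Y)"

definition curvature ::
    "('m vfield \<Rightarrow> 'm vfield \<Rightarrow> 'm \<Rightarrow> real) \<Rightarrow> 'm connection \<Rightarrow>
     'm vfield \<Rightarrow> 'm vfield \<Rightarrow> 'm vfield \<Rightarrow> 'm vfield \<Rightarrow> 'm \<Rightarrow> real" where
  "curvature g D X Y Z W = g (D X (D Y Z) - D Y (D X Z) - D (lie_bracket X Y) Z) W"

definition kahler_like ::
    "('m, 'e::euclidean_space) atlas \<Rightarrow> ('m vfield \<Rightarrow> 'm vfield) \<Rightarrow>
     ('m vfield \<Rightarrow> 'm vfield \<Rightarrow> 'm \<Rightarrow> real) \<Rightarrow> 'm connection \<Rightarrow> bool" where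
  "kahler_like A J g D \<longleftrightarrow> metric_connection A g D \<and>
     (\<forall>X\<in>vector_fields A. \<forall>Y\<in>vector_fields A. \<forall>Z\<in>vector_fields A. \<forall>W\<in>vector_fields A.
        curvature g D X Y Z W + curvature g D Y Z X W + curvature g D Z X Y W = 0 \<and>
        curvature g D X Y (J Z) (J W) = curvature g D X Y Z W)"

text \<open>
  On vector fields the Levi-Civita connection exists and is unique; as a HOL function it is not
  unique, because its values on other arguments are arbitrary, but \<^const>\<open>kahler_like\<close>
  does not depend on them.
\<close>

definition riemannian_kahler_like ::
    "('m, 'e::euclidean_space) atlas \<Rightarrow> ('m vfield \<Rightarrow> 'm vfield) \<Rightarrow>
     ('m vfield \<Rightarrow> 'm vfield \<Rightarrow> 'm \<Rightarrow> real) \<Rightarrow> bool" where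
  "riemannian_kahler_like A J g \<longleftrightarrow> (\<exists>D. levi_civita A g D \<and> kahler_like A J g D)"

section \<open>Lie groups and left invariance\<close>

text \<open>
  Groups are written additively, as in the class \<^class>\<open>topological_group_add\<close>, which does not
  include commutativity.
\<close>

definition lie_group ::
    "('g::{topological_group_add, t2_space, second_countable_topology}, 'e::euclidean_space) atlas
     \<Rightarrow> bool" where
  "lie_group A \<longleftrightarrow> smooth_atlas A \<and>
     smooth_map (prod_atlas A A) A (\<lambda>(x, y). x + y) \<and> smooth_map A A uminus"

text \<open>The differential of the left translation by \<open>a\<close>, acting on vector fields.\<close>

definition left_translate :: "'g::group_add \<Rightarrow> 'g vfield \<Rightarrow> 'g vfield" where
  "left_translate a X = (\<lambda>f x. X (\<lambda>y. f (a + y)) (- a + x))"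

definition left_invariant_fields ::
    "('g::group_add, 'e::euclidean_space) atlas \<Rightarrow> 'g vfield set" where
  "left_invariant_fields A = {X \<in> vector_fields A. \<forall>a. left_translate a X = X}"

definition left_invariant_endomorphism ::
    "('g::group_add, 'e::euclidean_space) atlas \<Rightarrow> ('g vfield \<Rightarrow> 'g vfield) \<Rightarrow> bool" where
  "left_invariant_endomorphism A J \<longleftrightarrow>
     (\<forall>a. \<forall>X\<in>vector_fields A. J (left_translate a X) = left_translate a (J X))"

definition left_invariant_metric ::
    "('g::group_add, 'e::euclidean_space) atlas \<Rightarrow>
     ('g vfield \<Rightarrow> 'g vfield \<Rightarrow> 'g \<Rightarrow> real) \<Rightarrow> bool" where
  "left_invariant_metric A g \<longleftrightarrow>
     (\<forall>a. \<forall>X\<in>vector_fields A. \<forall>Y\<in>vector_fields A. \<forall>x.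
        g (left_translate a X) (left_translate a Y) (a + x) = g X Y x)"

definition lie_hermitian ::
    "('g::{topological_group_add, t2_space, second_countable_topology}, 'e::euclidean_space) atlas
     \<Rightarrow> ('g vfield \<Rightarrow> 'g vfield) \<Rightarrow> ('g vfield \<Rightarrow> 'g vfield \<Rightarrow> 'g \<Rightarrow> real) \<Rightarrow> bool" where
  "lie_hermitian A J g \<longleftrightarrow> lie_group A \<and> connected (UNIV :: 'g set) \<and> hermitian A J g \<and>
     left_invariant_endomorphism A J \<and> left_invariant_metric A g"

text \<open>The Lie algebra of the group is the space of left invariant vector fields.\<close>

fun ascending_series ::
    "('g::group_add, 'e::euclidean_space) atlas \<Rightarrow> ('g vfield \<Rightarrow> 'g vfield) \<Rightarrow> nat \<Rightarrow>
     'g vfield set" where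
  "ascending_series A J 0 = {0}"
| "ascending_series A J (Suc k) = {X \<in> left_invariant_fields A.
     \<forall>Y\<in>left_invariant_fields A.
       lie_bracket X Y \<in> ascending_series A J k \<and> lie_bracket (J X) Y \<in> ascending_series A J k}"

definition nilpotent_complex_structure ::
    "('g::group_add, 'e::euclidean_space) atlas \<Rightarrow> ('g vfield \<Rightarrow> 'g vfield) \<Rightarrow> bool" where
  "nilpotent_complex_structure A J \<longleftrightarrow> (\<exists>k. ascending_series A J k = left_invariant_fields A)"

end

theory Submission
  imports Defs
begin

text \<open>
  Both directions rest on one tool: the left invariant fields form a global frame of the group. For
  a basis vector \<open>b\<close> of the model space, \<open>left_frame b\<close> differentiates \<open>y \<mapsto> f (x + y)\<close> at the neutral
  element in the direction of \<open>b\<close> in a fixed chart, and every vector field is a combination of these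
  fields with smooth coefficients (\<open>frame_expansion\<close>, \<open>frame_coeff_smooth\<close>). Since vector fields are
  derivations of the global smooth functions, this needs the classical argument that a point
  derivation is a directional derivative (\<open>point_derivation_coordinates\<close>), hence bump functions and
  Hadamard's lemma.

  Lie algebra versus group. The right invariant fields \<open>right_frame b\<close> commute with the left invariant
  ones because mixed partial derivatives of \<open>f (y + x + z)\<close> in \<open>y\<close> and \<open>z\<close> commute. If the group is
  commutative the two frames coincide, so the Lie algebra is abelian. Conversely, if the Lie algebra
  is abelian, the coefficients of \<open>right_frame b\<close> in the left frame are annihilated by all left
  invariant fields, hence constant on the connected group, and comparison at the neutral element
  gives \<open>right_frame b = left_frame b\<close>. Then \<open>x \<mapsto> f (x + a - x)\<close> has derivative zero, so it is constant,
  and as smooth functions separate points, \<open>x + a - x = a\<close>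
  (\<open>commutative_if_frames_agree\<close>).

  A commutative group is Kaehler-like. The connection for which the commuting frame is parallel is
  metric, torsion-free and flat, because left invariant fields have constant inner products.

  A Kaehler-like group with nilpotent \<open>J\<close> is abelian. Let \<open>Z\<close> and \<open>J Z\<close> both be central, and write
  \<open>a X = D X Z\<close> and \<open>b X = D X (J Z)\<close>. By Koszul's formula \<open>a\<close> and \<open>b\<close> are skew and preserve left
  invariance, and the curvature in the directions \<open>Z\<close>, \<open>J Z\<close> is an expression in \<open>a\<close> and \<open>b\<close> alone. The
  Bianchi identity combined with the \<open>J\<close>-invariance of the curvature reads
  \<open>|a X|\<^sup>2 + |b X|\<^sup>2 = \<langle>b X, a (J X)\<rangle> - \<langle>a X, b (J X)\<rangle>\<close>. Adding the same identity for \<open>J X\<close> turns it into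
  \<open>|b X - a (J X)|\<^sup>2 + |a X + b (J X)|\<^sup>2 = 0\<close>. So \<open>b X = a (J X)\<close>, while integrability of \<open>J\<close> gives
  \<open>b X = J (a X)\<close>. Then \<open>b\<close> is both skew and symmetric, so \<open>a = b = 0\<close>, which says that \<open>Z\<close> is
  orthogonal to all brackets (\<open>central_pair_orthogonal_to_brackets\<close>). The first ideal of the ascending
  series consists of exactly such \<open>Z\<close>. A field of the second ideal has its brackets in the first
  ideal, where they are orthogonal to themselves and vanish. The series is therefore stationary from
  the first step (\<open>ascending_series_stationary\<close>), and if it reaches the whole Lie algebra, the Lie
  algebra is abelian.
\<close>

section \<open>The calculus of smooth functions on open sets\<close>

lemma Ck_on_SucD: "Ck_on (Suc k) f S \<Longrightarrow> Ck_on k f S"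
proof (induction k arbitrary: f)
  case 0
  then have "\<And>x. x \<in> S \<Longrightarrow> f differentiable (at x)"
    by (subst (asm) Ck_on.simps) blast
  then show ?case
    using differentiable_imp_continuous_within by (auto intro!: continuous_at_imp_continuous_on)
next
  case (Suc k)
  from Suc.prems have d: "\<forall>x\<in>S. f differentiable (at x)"
    and D: "\<And>v. Ck_on (Suc k) (\<lambda>x. frechet_derivative f (at x) v) S"
    by (subst (asm) Ck_on.simps, blast)+
  from Suc.IH[OF D] d show ?case by simp
qed

lemma Ck_on_le: "Ck_on k f S \<Longrightarrow> j \<le> k \<Longrightarrow> Ck_on j f S"
  by (induction k) (auto simp: le_Suc_eq simp del: Ck_on.simps dest: Ck_on_SucD)

lemma Ck_on_continuous: "Ck_on k f S \<Longrightarrow> continuous_on S f"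
  using Ck_on_le[of k f S 0] by simp

lemma frechet_derivative_cong_open:
  assumes "open S" "x \<in> S" "\<And>y. y \<in> S \<Longrightarrow> f y = g y"
  shows "frechet_derivative f (at x) = frechet_derivative g (at x)"
proof -
  have "(f has_derivative D) (at x) \<longleftrightarrow> (g has_derivative D) (at x)" for D
    using has_derivative_transform_within_open[of f D x UNIV S g]
      has_derivative_transform_within_open[of g D x UNIV S f] assms by auto
  then show ?thesis unfolding frechet_derivative_def by presburger
qed

lemma differentiable_cong_open:
  assumes "open S" "x \<in> S" "\<And>y. y \<in> S \<Longrightarrow> f y = g y" "f differentiable (at x)"
  shows "g differentiable (at x)"
  using assms unfolding differentiable_def
  by (meson has_derivative_transform_within_open)

lemma Ck_on_cong:
  assumes "open S" "\<And>y. y \<in> S \<Longrightarrow> f y = g y" "Ck_on k f S"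
  shows "Ck_on k g S"
  using assms(2,3)
proof (induction k arbitrary: f g)
  case 0
  then show ?case by (metis Ck_on.simps(1) continuous_on_cong)
next
  case (Suc k)
  have "Ck_on k (\<lambda>x. frechet_derivative g (at x) v) S" for v
  proof (rule Suc.IH)
    show "frechet_derivative f (at y) v = frechet_derivative g (at y) v" if "y \<in> S" for y
      using frechet_derivative_cong_open[OF assms(1) that Suc.prems(1)] by simp
    show "Ck_on k (\<lambda>x. frechet_derivative f (at x) v) S" using Suc.prems(2) by simp
  qed
  moreover have "g differentiable (at x)" if "x \<in> S" for x
    using differentiable_cong_open[OF assms(1) that Suc.prems(1)] Suc.prems(2) that by simp
  ultimately show ?case by simp
qed

lemma Ck_on_local:
  assumes "\<And>x. x \<in> S \<Longrightarrow> \<exists>T. open T \<and> x \<in> T \<and> Ck_on k f T"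
  shows "Ck_on k f S"
  using assms
proof (induction k arbitrary: f)
  case 0
  show ?case
  proof (simp, rule continuous_at_imp_continuous_on, rule ballI)
    fix x assume "x \<in> S"
    with 0 obtain T where "open T" "x \<in> T" "continuous_on T f" by force
    then show "isCont f x" by (simp add: continuous_on_eq_continuous_at)
  qed
next
  case (Suc k)
  have "Ck_on k (\<lambda>x. frechet_derivative f (at x) v) S" for v
  proof (rule Suc.IH)
    fix x assume "x \<in> S"
    then obtain T where "open T" "x \<in> T" "Ck_on (Suc k) f T" using Suc.prems by blast
    then show "\<exists>T. open T \<and> x \<in> T \<and> Ck_on k (\<lambda>x. frechet_derivative f (at x) v) T" by auto
  qed
  moreover have "\<forall>x\<in>S. f differentiable (at x)"
  proof
    fix x assume "x \<in> S"
    then obtain T where "open T" "x \<in> T" "Ck_on (Suc k) f T" using Suc.prems by blast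
    then show "f differentiable (at x)" by simp
  qed
  ultimately show ?case by simp
qed

lemma Ck_on_subset: "Ck_on k f S \<Longrightarrow> T \<subseteq> S \<Longrightarrow> Ck_on k f T"
  by (induction k arbitrary: f) (auto intro: continuous_on_subset)

lemma Ck_on_const: "Ck_on k (\<lambda>x. c) S"
  by (induction k arbitrary: c) (auto simp: frechet_derivative_const)

lemma Ck_on_frechet: "Ck_on (Suc k) f S \<Longrightarrow> Ck_on k (\<lambda>x. frechet_derivative f (at x) v) S"
  by simp

lemma Ck_on_has_derivative:
  "Ck_on (Suc k) f S \<Longrightarrow> x \<in> S \<Longrightarrow> (f has_derivative frechet_derivative f (at x)) (at x)"
  by (simp add: frechet_derivative_works)

text \<open>
  A formula for the derivative on an open set is enough to raise the order of smoothness. The closure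
  properties under algebraic operations and composition are inductions on the order that apply this
  rule to the usual differentiation formulas.
\<close>

lemma Ck_on_SucI:
  assumes "open S" "\<And>x. x \<in> S \<Longrightarrow> (f has_derivative D x) (at x)" "\<And>v. Ck_on k (\<lambda>x. D x v) S"
  shows "Ck_on (Suc k) f S"
proof -
  have "Ck_on k (\<lambda>x. frechet_derivative f (at x) v) S" for v
    by (rule Ck_on_cong[OF assms(1) _ assms(3)[of v]])
      (simp add: frechet_derivative_at[OF assms(2), symmetric])
  moreover have "f differentiable (at x)" if "x \<in> S" for x
    using assms(2)[OF that] by (rule differentiableI)
  ultimately show ?thesis by simp
qed

lemma Ck_on_bounded_linear:
  assumes L: "bounded_linear L" and "open S" "Ck_on k f S"
  shows "Ck_on k (\<lambda>x. L (f x)) S"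
  using assms(3)
proof (induction k arbitrary: f)
  case 0
  then show ?case using bounded_linear.continuous_on[OF L] by auto
next
  case (Suc k)
  show ?case
    by (rule Ck_on_SucI[OF assms(2) bounded_linear.has_derivative[OF L Ck_on_has_derivative[OF Suc.prems]]])
      (assumption | intro Suc.IH Ck_on_frechet Suc.prems)+
qed

lemma Ck_on_add:
  assumes "open S" "Ck_on k f S" "Ck_on k g S"
  shows "Ck_on k (\<lambda>x. f x + g x) S"
  using assms(2,3)
proof (induction k arbitrary: f g)
  case 0
  then show ?case by (auto intro: continuous_intros)
next
  case (Suc k)
  show ?case
    by (rule Ck_on_SucI[OF assms(1) has_derivative_add[OF Ck_on_has_derivative[OF Suc.prems(1)] Ck_on_has_derivative[OF Suc.prems(2)]]])
      (assumption | intro Suc.IH Ck_on_frechet Suc.prems)+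
qed

lemma Ck_on_bilinear:
  assumes B: "bounded_bilinear B" and "open S" "Ck_on k f S" "Ck_on k g S"
  shows "Ck_on k (\<lambda>x. B (f x) (g x)) S"
  using assms(3,4)
proof (induction k arbitrary: f g)
  case 0
  then show ?case using bounded_bilinear.continuous_on[OF B] by auto
next
  case (Suc k)
  show ?case
    by (rule Ck_on_SucI[OF assms(2) bounded_bilinear.FDERIV[OF B Ck_on_has_derivative[OF Suc.prems(1)] Ck_on_has_derivative[OF Suc.prems(2)]]])
      (assumption | intro Ck_on_add assms(2) Suc.IH Ck_on_SucD[OF Suc.prems(1)] Ck_on_SucD[OF Suc.prems(2)]
        Suc.prems(1)[THEN Ck_on_frechet] Suc.prems(2)[THEN Ck_on_frechet])+
qed

lemma Ck_on_sum:
  assumes "open S" "\<And>i. i \<in> I \<Longrightarrow> Ck_on k (f i) S"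
  shows "Ck_on k (\<lambda>x. \<Sum>i\<in>I. f i x) S"
  using assms(2)
proof (induction I rule: infinite_finite_induct)
  case (insert i I)
  then show ?case
    using Ck_on_add[OF assms(1), of k "f i" "\<lambda>x. \<Sum>i\<in>I. f i x"] by simp
qed (auto intro: Ck_on_const)

text \<open>
  In the chain rule the derivative of the outer function is expanded along the basis, so that the
  derivative of the composition is a sum of products of functions to which the induction hypothesis
  or a lower order applies.
\<close>

lemma Ck_on_compose:
  fixes g :: "'a::euclidean_space \<Rightarrow> 'b::euclidean_space" and f :: "'b \<Rightarrow> 'c::real_normed_vector"
  assumes "open S" "open T" "Ck_on k g S" "Ck_on k f T" "g ` S \<subseteq> T"
  shows "Ck_on k (\<lambda>x. f (g x)) S"
  using assms(3,4,5)
proof (induction k arbitrary: f)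
  case 0
  then show ?case by (auto intro: continuous_on_compose2)
next
  case (Suc k)
  have d: "((\<lambda>x. f (g x)) has_derivative
      (\<lambda>v. \<Sum>b\<in>Basis. (frechet_derivative g (at x) v \<bullet> b) *\<^sub>R frechet_derivative f (at (g x)) b)) (at x)"
    if "x \<in> S" for x
  proof -
    have f: "(f has_derivative frechet_derivative f (at (g x))) (at (g x))"
      using Ck_on_has_derivative[OF Suc.prems(2)] Suc.prems(3) that by blast
    have expand: "frechet_derivative f (at (g x)) u =
        (\<Sum>b\<in>Basis. (u \<bullet> b) *\<^sub>R frechet_derivative f (at (g x)) b)" for u
    proof -
      interpret linear "frechet_derivative f (at (g x))" using has_derivative_linear[OF f] .
      have "frechet_derivative f (at (g x)) u = frechet_derivative f (at (g x)) (\<Sum>b\<in>Basis. (u \<bullet> b) *\<^sub>R b)"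
        by (simp add: euclidean_representation)
      then show ?thesis by (simp add: sum scaleR)
    qed
    show ?thesis
      by (rule has_derivative_eq_rhs[OF has_derivative_compose[OF Ck_on_has_derivative[OF Suc.prems(1) that] f]])
        (rule ext, rule expand)
  qed
  show ?case
    by (rule Ck_on_SucI[OF assms(1) d])
      (assumption | intro Ck_on_sum Ck_on_bilinear[OF bounded_bilinear_scaleR] assms(1) Ck_on_bounded_linear[OF bounded_linear_inner_left]
         Suc.IH Suc.prems(3) Ck_on_SucD[OF Suc.prems(1)] Suc.prems(1)[THEN Ck_on_frechet] Suc.prems(2)[THEN Ck_on_frechet])+
qed

lemma smooth_on_unfold:
  "smooth_on f S \<longleftrightarrow> (\<forall>x\<in>S. f differentiable (at x)) \<and>
     (\<forall>v. smooth_on (\<lambda>x. frechet_derivative f (at x) v) S)"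
  (is "?L \<longleftrightarrow> ?R")
proof
  assume ?L
  then have "Ck_on (Suc k) f S" for k by (simp add: smooth_on_def del: Ck_on.simps)
  then show ?R by (auto simp: smooth_on_def)
next
  assume R: ?R
  have "Ck_on (Suc k) f S" for k
    using R by (simp add: smooth_on_def)
  then have "Ck_on k f S" for k
    by (rule Ck_on_SucD)
  then show ?L by (simp add: smooth_on_def)
qed

lemma smooth_on_has_derivative:
  "smooth_on f S \<Longrightarrow> x \<in> S \<Longrightarrow> (f has_derivative frechet_derivative f (at x)) (at x)"
  by (subst (asm) smooth_on_unfold) (simp add: frechet_derivative_works)

lemma smooth_on_frechet: "smooth_on f S \<Longrightarrow> smooth_on (\<lambda>x. frechet_derivative f (at x) v) S"
  by (subst (asm) smooth_on_unfold) simp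

lemma smooth_on_continuous: "smooth_on f S \<Longrightarrow> continuous_on S f"
  unfolding smooth_on_def using Ck_on_continuous by blast

lemma smooth_on_cong: "open S \<Longrightarrow> (\<And>y. y \<in> S \<Longrightarrow> f y = g y) \<Longrightarrow> smooth_on f S \<Longrightarrow> smooth_on g S"
  unfolding smooth_on_def by (meson Ck_on_cong)

lemma smooth_on_subset: "smooth_on f S \<Longrightarrow> T \<subseteq> S \<Longrightarrow> smooth_on f T"
  unfolding smooth_on_def by (meson Ck_on_subset)

lemma smooth_on_local:
  "(\<And>x. x \<in> S \<Longrightarrow> \<exists>T. open T \<and> x \<in> T \<and> smooth_on f T) \<Longrightarrow> smooth_on f S"
  unfolding smooth_on_def by (meson Ck_on_local)

lemma smooth_on_const: "smooth_on (\<lambda>x. c) S"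
  by (simp add: smooth_on_def Ck_on_const)

lemma smooth_on_bounded_linear: 
  "bounded_linear L \<Longrightarrow> open S \<Longrightarrow> smooth_on f S \<Longrightarrow> smooth_on (\<lambda>x. L (f x)) S"
  by (simp add: smooth_on_def Ck_on_bounded_linear)

lemma Ck_on_ident: "Ck_on k (\<lambda>x. x) S"
  by (cases k) (auto simp: Ck_on_const)

lemma smooth_on_ident: "smooth_on (\<lambda>x. x) S"
  by (simp add: smooth_on_def Ck_on_ident)

lemma smooth_on_add: 
  "open S \<Longrightarrow> smooth_on f S \<Longrightarrow> smooth_on g S \<Longrightarrow> smooth_on (\<lambda>x. f x + g x) S"
  by (simp add: smooth_on_def Ck_on_add)

lemma smooth_on_bilinear:
  "bounded_bilinear B \<Longrightarrow> open S \<Longrightarrow> smooth_on f S \<Longrightarrow> smooth_on g S \<Longrightarrow> smooth_on (\<lambda>x. B (f x) (g x)) S"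
  by (simp add: smooth_on_def Ck_on_bilinear)

lemmas smooth_on_mult = smooth_on_bilinear[OF bounded_bilinear_mult]
lemmas smooth_on_scaleR = smooth_on_bilinear[OF bounded_bilinear_scaleR]
lemmas smooth_on_inner = smooth_on_bilinear[OF bounded_bilinear_inner]

lemma smooth_on_uminus: "open S \<Longrightarrow> smooth_on f S \<Longrightarrow> smooth_on (\<lambda>x. - f x) S"
  by (rule smooth_on_bounded_linear[OF bounded_linear_minus[OF bounded_linear_ident]])

lemma smooth_on_diff:
  "open S \<Longrightarrow> smooth_on f S \<Longrightarrow> smooth_on g S \<Longrightarrow> smooth_on (\<lambda>x. f x - g x) S"
  using smooth_on_add[of S f "\<lambda>x. - g x"] smooth_on_uminus[of S g] by simp

lemma smooth_on_sum:
  "open S \<Longrightarrow> (\<And>i. i \<in> I \<Longrightarrow> smooth_on (f i) S) \<Longrightarrow> smooth_on (\<lambda>x. \<Sum>i\<in>I. f i x) S"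
  by (simp add: smooth_on_def Ck_on_sum)

lemma smooth_on_compose:
  fixes g :: "'a::euclidean_space \<Rightarrow> 'b::euclidean_space" and f :: "'b \<Rightarrow> 'c::real_normed_vector"
  shows "open S \<Longrightarrow> open T \<Longrightarrow> smooth_on g S \<Longrightarrow> smooth_on f T \<Longrightarrow> g ` S \<subseteq> T \<Longrightarrow>
    smooth_on (\<lambda>x. f (g x)) S"
  unfolding smooth_on_def using Ck_on_compose by blast

lemma smooth_on_Pair:
  assumes "open S" "smooth_on f S" "smooth_on g S"
  shows "smooth_on (\<lambda>x. (f x, g x)) S"
proof -
  have 1: "smooth_on (\<lambda>x. (f x, 0)) S"
    by (rule smooth_on_bounded_linear[OF _ assms(1,2)])
      (intro bounded_linear_Pair bounded_linear_ident bounded_linear_zero)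
  have 2: "smooth_on (\<lambda>x. (0, g x)) S"
    by (rule smooth_on_bounded_linear[OF _ assms(1,3)])
      (intro bounded_linear_Pair bounded_linear_ident bounded_linear_zero)
  from smooth_on_add[OF assms(1) 1 2] show ?thesis by simp
qed

lemma smooth_on_fst: "open S \<Longrightarrow> smooth_on f S \<Longrightarrow> smooth_on (\<lambda>x. fst (f x)) S"
  by (rule smooth_on_bounded_linear[OF bounded_linear_fst])

lemma smooth_on_snd: "open S \<Longrightarrow> smooth_on f S \<Longrightarrow> smooth_on (\<lambda>x. snd (f x)) S"
  by (rule smooth_on_bounded_linear[OF bounded_linear_snd])

lemma smooth_on_projections: "open S \<Longrightarrow> smooth_on fst S" "open S \<Longrightarrow> smooth_on snd S"
  by (rule smooth_on_fst[OF _ smooth_on_ident] smooth_on_snd[OF _ smooth_on_ident], assumption)+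

text \<open>
  The derivative of \<open>1 / x\<close> is a polynomial in \<open>1 / x\<close>, which makes the induction on the order close up.
\<close>

lemma smooth_on_inverse_real: "smooth_on (inverse :: real \<Rightarrow> real) (- {0})"
proof -
  have "Ck_on k (inverse :: real \<Rightarrow> real) (- {0})" for k
  proof (induction k)
    case 0
    show ?case by (auto intro!: continuous_intros)
  next
    case (Suc k)
    have o: "open (- {0::real})" by auto
    show ?case
    proof (rule Ck_on_SucI[OF o])
      show "(inverse has_derivative (\<lambda>v. (inverse x * inverse x) * (- v))) (at x)"
        if "x \<in> - {0}" for x :: real
        using that by (auto intro!: derivative_eq_intros)
    qed (intro Ck_on_bilinear[OF bounded_bilinear_mult] o Suc.IH Ck_on_const)
  qed
  then show ?thesis by (simp add: smooth_on_def)
qed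

lemma smooth_on_divide:
  fixes f g :: "'a::euclidean_space \<Rightarrow> real"
  assumes "open S" "smooth_on f S" "smooth_on g S" "\<And>x. x \<in> S \<Longrightarrow> g x \<noteq> 0"
  shows "smooth_on (\<lambda>x. f x / g x) S"
proof -
  have "smooth_on (\<lambda>x. inverse (g x)) S"
    by (rule smooth_on_compose[OF assms(1) _ assms(3) smooth_on_inverse_real]) (use assms(4) in auto)
  from smooth_on_mult[OF assms(1,2) this] show ?thesis by (simp add: divide_inverse)
qed

section \<open>Smooth cut-offs, Hadamard's lemma and mixed partial derivatives\<close>

text \<open>
  The functions \<open>t\<^sup>-\<^sup>n exp (- 1 / t)\<close>, extended by zero to \<open>t \<le> 0\<close>. The whole family is needed because its linear
  span is closed under differentiation, while the case \<open>n = 0\<close> alone is not.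
\<close>

definition flat_exp :: "nat \<Rightarrow> real \<Rightarrow> real" where
  "flat_exp n t = (if t > 0 then inverse t ^ n / exp (inverse t) else 0)"

lemma flat_exp_tendsto_0: "(flat_exp n \<longlongrightarrow> 0) (at 0)"
proof (rule filterlim_split_at)
  show "(flat_exp n \<longlongrightarrow> 0) (at_left 0)"
    by (rule tendsto_eventually) (auto simp: eventually_at_left_real flat_exp_def intro!: eventually_at_leftI[of "-1"])
  have "((\<lambda>t. inverse t ^ n / exp (inverse t)) \<longlongrightarrow> (0::real)) (at_right 0)"
    by (rule filterlim_compose[OF tendsto_power_div_exp_0 filterlim_inverse_at_top_right])
  then show "(flat_exp n \<longlongrightarrow> 0) (at_right 0)"
    by (rule Lim_transform_eventually) (auto simp: flat_exp_def intro!: eventually_at_rightI[of _ 1])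
qed

lemma flat_exp_DERIV:
  "(flat_exp n has_real_derivative (flat_exp (n + 2) t - real n * flat_exp (n + 1) t)) (at t)"
proof (cases t "0::real" rule: linorder_cases)
  case less
  have "((\<lambda>t. 0) has_real_derivative 0) (at t)" by simp
  then have "(flat_exp n has_real_derivative 0) (at t)"
    by (rule has_field_derivative_transform_within_open[of _ _ _ "{..<0}"]) (use less in \<open>auto simp: flat_exp_def\<close>)
  then show ?thesis using less by (simp add: flat_exp_def)
next
  case greater
  have i: "(inverse has_real_derivative - (inverse t * inverse t)) (at t)"
    using greater by (auto intro!: derivative_eq_intros)
  have rearrange: "(real n * (- (u * u) * u ^ (n - Suc 0)) * E - u ^ n * (E * - (u * u))) / (E * E) =
      u ^ (n + 2) / E - real n * (u ^ (n + 1) / E)" if "E > 0" for u E :: real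
    using that by (cases n) (simp_all add: field_simps)
  have "((\<lambda>t. inverse t ^ n / exp (inverse t)) has_real_derivative
      (flat_exp (n + 2) t - real n * flat_exp (n + 1) t)) (at t)"
    using DERIV_divide[OF DERIV_power[OF i, of n] DERIV_chain2[OF DERIV_exp i]] greater
    unfolding rearrange[OF exp_gt_zero] by (simp add: flat_exp_def)
  then show ?thesis
    by (rule has_field_derivative_transform_within_open[of _ _ _ "{0<..}"]) (use greater in \<open>auto simp: flat_exp_def\<close>)
next
  case equal
  \<comment> \<open>The difference quotient at zero is again a member of the family.\<close>
  have "(\<lambda>h. (flat_exp n (0 + h) - flat_exp n 0) / h) = flat_exp (n + 1)"
    by (auto simp: flat_exp_def fun_eq_iff field_simps)
  then have "(flat_exp n has_real_derivative 0) (at 0)"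
    using flat_exp_tendsto_0[of "n + 1"] by (simp add: DERIV_def)
  then show ?thesis using equal by (simp add: flat_exp_def)
qed

lemma smooth_on_flat_exp: "smooth_on (flat_exp n) UNIV"
proof -
  have "Ck_on k (flat_exp n) UNIV" for k n
  proof (induction k arbitrary: n)
    case 0
    show ?case using DERIV_isCont[OF flat_exp_DERIV] by (auto intro!: continuous_at_imp_continuous_on)
  next
    case (Suc k)
    have "Ck_on k (\<lambda>t. flat_exp (n + 2) t + (- real n) * flat_exp (n + 1) t) UNIV"
      by (intro Ck_on_add Ck_on_bilinear[OF bounded_bilinear_mult] Suc.IH Ck_on_const open_UNIV)
    then have *: "Ck_on k (\<lambda>t. (flat_exp (n + 2) t - real n * flat_exp (n + 1) t) * v) UNIV" for v
      by (intro Ck_on_bilinear[OF bounded_bilinear_mult] Ck_on_const open_UNIV) simp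
    show ?case
      by (rule Ck_on_SucI[OF open_UNIV flat_exp_DERIV[unfolded has_field_derivative_def] *])
  qed
  then show ?thesis by (simp add: smooth_on_def)
qed

text \<open>
  With \<open>s = flat_exp 0\<close>, the quotient \<open>s (r2\<^sup>2 - d\<^sup>2) / (s (r2\<^sup>2 - d\<^sup>2) + s (d\<^sup>2 - r1\<^sup>2))\<close> in the distance \<open>d\<close> from the centre
  has a positive denominator, because the two arguments of \<open>s\<close> add up to a positive number.
\<close>

lemma smooth_plateau:
  fixes y0 :: "'a::euclidean_space"
  assumes "0 < r1" "r1 < r2"
  obtains \<rho> :: "'a \<Rightarrow> real" where "smooth_on \<rho> UNIV"
    "\<And>y. dist y0 y \<le> r1 \<Longrightarrow> \<rho> y = 1" "\<And>y. r2 \<le> dist y0 y \<Longrightarrow> \<rho> y = 0"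
proof
  define q where "q y = (y - y0) \<bullet> (y - y0)" for y
  have q: "q y = (dist y0 y)\<^sup>2" for y
    by (simp add: q_def dist_norm norm_minus_commute[of y0] power2_norm_eq_inner)
  have sq: "smooth_on q UNIV"
    unfolding q_def by (intro smooth_on_inner smooth_on_diff smooth_on_ident smooth_on_const open_UNIV)
  define \<rho> where "\<rho> y = flat_exp 0 (r2\<^sup>2 - q y) / (flat_exp 0 (r2\<^sup>2 - q y) + flat_exp 0 (q y - r1\<^sup>2))" for y
  have r: "r1\<^sup>2 < r2\<^sup>2" using assms by (simp add: power_strict_mono)
  have 1: "smooth_on (\<lambda>y. flat_exp 0 (r2\<^sup>2 - q y)) UNIV"
    by (rule smooth_on_compose[OF open_UNIV open_UNIV _ smooth_on_flat_exp])
      (auto intro!: smooth_on_diff smooth_on_const sq)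
  have 2: "smooth_on (\<lambda>y. flat_exp 0 (q y - r1\<^sup>2)) UNIV"
    by (rule smooth_on_compose[OF open_UNIV open_UNIV _ smooth_on_flat_exp])
      (auto intro!: smooth_on_diff smooth_on_const sq)
  have "flat_exp 0 (r2\<^sup>2 - q y) + flat_exp 0 (q y - r1\<^sup>2) > 0" for y
    using r by (auto simp: flat_exp_def add_pos_nonneg add_nonneg_pos)
  then show "smooth_on \<rho> UNIV"
    unfolding \<rho>_def
    by (intro smooth_on_divide smooth_on_add open_UNIV 1 2) (metis less_irrefl)
  show "\<rho> y = 1" if "dist y0 y \<le> r1" for y
  proof -
    have "q y \<le> r1\<^sup>2" using that q by (simp add: power_mono)
    then show ?thesis using r by (simp add: \<rho>_def flat_exp_def)
  qed
  show "\<rho> y = 0" if "r2 \<le> dist y0 y" for y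
  proof -
    have "r2\<^sup>2 \<le> q y" using that q assms by (simp add: power_mono)
    then show ?thesis by (simp add: \<rho>_def flat_exp_def)
  qed
qed

lemma has_derivative_partial:
  assumes "smooth_on f (U \<times> W)" "x \<in> U" "t \<in> W"
  shows "((\<lambda>x. f (x, t)) has_derivative (\<lambda>v. frechet_derivative f (at (x, t)) (v, 0))) (at x)"
    and "((\<lambda>t. f (x, t)) has_derivative (\<lambda>v. frechet_derivative f (at (x, t)) (0, v))) (at t)"
proof -
  have f: "(f has_derivative frechet_derivative f (at (x, t))) (at (x, t))"
    using smooth_on_has_derivative[OF assms(1)] assms(2,3) by blast
  have "((\<lambda>x. (x, t)) has_derivative (\<lambda>v. (v, 0))) (at x)" "((\<lambda>t. (x, t)) has_derivative (\<lambda>v. (0, v))) (at t)"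
    by (auto intro!: derivative_eq_intros)
  from this[THEN has_derivative_compose, OF f]
  show "((\<lambda>x. f (x, t)) has_derivative (\<lambda>v. frechet_derivative f (at (x, t)) (v, 0))) (at x)"
    and "((\<lambda>t. f (x, t)) has_derivative (\<lambda>v. frechet_derivative f (at (x, t)) (0, v))) (at t)"
    by auto
qed

text \<open>
  Differentiation under the integral sign expresses a directional derivative of the integral as the
  integral of a smooth function of the same kind, so the induction on the order runs over all
  integrands at once.
\<close>

lemma smooth_on_integral_param:
  fixes f :: "'a::euclidean_space \<times> real \<Rightarrow> real"
  assumes "open U" "cbox 0 1 \<subseteq> W" "smooth_on f (U \<times> W)"
  shows "smooth_on (\<lambda>x. integral (cbox 0 1) (\<lambda>t. f (x, t))) U"
proof -
  have "Ck_on k (\<lambda>x. integral (cbox 0 1) (\<lambda>t. f (x, t))) U" for k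
    using assms(3)
  proof (induction k arbitrary: f)
    case 0
    have "continuous_on (U \<times> cbox 0 1) f"
      using smooth_on_continuous[OF 0] by (rule continuous_on_subset) (use assms(2) in auto)
    then show ?case
      using integral_continuous_on_param[of U 0 1 "\<lambda>x t. f (x, t)"] by (simp add: case_prod_unfold)
  next
    case (Suc k)
    define D where "D x t = Blinfun (\<lambda>v. frechet_derivative f (at (x, t)) (v, 0))" for x t
    have f': "blinfun_apply (D x t) = (\<lambda>v. frechet_derivative f (at (x, t)) (v, 0))"
      if "x \<in> U" "t \<in> W" for x t
      unfolding D_def using has_derivative_partial(1)[OF Suc.prems that]
      by (intro bounded_linear_Blinfun_apply has_derivative_bounded_linear)
    have contD: "continuous_on (U \<times> cbox 0 1) (\<lambda>(x, t). D x t)"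
      unfolding continuous_on_def
    proof (intro ballI tendsto_componentwise1)
      fix z j assume z: "z \<in> U \<times> cbox (0::real) 1" and "j \<in> (Basis :: 'a set)"
      have "continuous_on (U \<times> cbox 0 1) (\<lambda>z. frechet_derivative f (at z) (j, 0))"
        using smooth_on_continuous[OF smooth_on_frechet[OF Suc.prems]]
        by (rule continuous_on_subset) (use assms(2) in auto)
      then have "((\<lambda>z. frechet_derivative f (at z) (j, 0)) \<longlongrightarrow> frechet_derivative f (at z) (j, 0))
          (at z within U \<times> cbox 0 1)"
        using z unfolding continuous_on_def by blast
      then have "((\<lambda>y. blinfun_apply (case y of (x, t) \<Rightarrow> D x t) j) \<longlongrightarrow> frechet_derivative f (at z) (j, 0))
          (at z within U \<times> cbox 0 1)"
        by (rule tendsto_cong[THEN iffD1, rotated])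
          (use f' assms(2) in \<open>auto simp: eventually_at_filter subset_iff intro!: always_eventually\<close>)
      moreover have "blinfun_apply (case z of (x, t) \<Rightarrow> D x t) j = frechet_derivative f (at z) (j, 0)"
        using f' z assms(2) by (auto simp: subset_iff)
      ultimately show "((\<lambda>y. blinfun_apply (case y of (x, t) \<Rightarrow> D x t) j) \<longlongrightarrow>
           blinfun_apply (case z of (x, t) \<Rightarrow> D x t) j) (at z within U \<times> cbox 0 1)"
        by simp
    qed
    have int_f: "(\<lambda>t. f (x, t)) integrable_on cbox 0 1" if "x \<in> U" for x
    proof (intro integrable_continuous continuous_on_compose2[OF smooth_on_continuous[OF Suc.prems]])
      show "continuous_on (cbox 0 1) (\<lambda>t. (x, t))" by (intro continuous_intros)
    qed (use that assms(2) in auto)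
    have der: "((\<lambda>x. integral (cbox 0 1) (\<lambda>t. f (x, t))) has_derivative
        (\<lambda>v. integral (cbox 0 1) (\<lambda>t. frechet_derivative f (at (x, t)) (v, 0)))) (at x)" if x: "x \<in> U" for x
    proof -
      obtain e where e: "e > 0" "ball x e \<subseteq> U" using assms(1) x openE by blast
      have "((\<lambda>x. integral (cbox 0 1) (\<lambda>t. f (x, t))) has_derivative integral (cbox 0 1) (D x))
          (at x within ball x e)"
      proof (rule leibniz_rule)
        fix y t assume "y \<in> ball x e" "t \<in> cbox (0::real) 1"
        then have y: "y \<in> U" "t \<in> W" using e assms(2) by auto
        show "((\<lambda>y. f (y, t)) has_derivative blinfun_apply (D y t)) (at y within ball x e)"
          using has_derivative_partial(1)[OF Suc.prems y] f'[OF y] by (simp add: has_derivative_at_withinI)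
      next
        fix y assume "y \<in> ball x e"
        then show "(\<lambda>t. f (y, t)) integrable_on cbox 0 1" using int_f e by auto
      next
        show "continuous_on (ball x e \<times> cbox 0 1) (\<lambda>(x, t). D x t)"
          by (rule continuous_on_subset[OF contD]) (use e in auto)
      qed (use e in auto)
      then have "((\<lambda>x. integral (cbox 0 1) (\<lambda>t. f (x, t))) has_derivative
           blinfun_apply (integral (cbox 0 1) (D x))) (at x)"
        using e by (simp add: at_within_open[of x "ball x e"])
      moreover have "blinfun_apply (integral (cbox 0 1) (D x)) =
          (\<lambda>v. integral (cbox 0 1) (\<lambda>t. frechet_derivative f (at (x, t)) (v, 0)))"
      proof
        fix v
        have "continuous_on (cbox 0 1) (D x)"
          using continuous_on_compose2[OF contD, of "cbox 0 1" "Pair x"] x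
          by (force intro!: continuous_intros)
        then have "integral (cbox 0 1) ((\<lambda>L. blinfun_apply L v) \<circ> D x) = blinfun_apply (integral (cbox 0 1) (D x)) v"
          by (intro integral_linear integrable_continuous blinfun.bounded_linear_left)
        moreover have "integral (cbox 0 1) ((\<lambda>L. blinfun_apply L v) \<circ> D x) =
            integral (cbox 0 1) (\<lambda>t. frechet_derivative f (at (x, t)) (v, 0))"
          by (rule integral_cong) (use f' x assms(2) in auto)
        ultimately show "blinfun_apply (integral (cbox 0 1) (D x)) v =
            integral (cbox 0 1) (\<lambda>t. frechet_derivative f (at (x, t)) (v, 0))" by simp
      qed
      ultimately show ?thesis by simp
    qed
    show ?case
      by (rule Ck_on_SucI[OF assms(1) der]) (assumption | intro Suc.IH smooth_on_frechet Suc.prems)+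
  qed
  then show ?thesis by (simp add: smooth_on_def)
qed

text \<open>
  Integrating the derivative of \<open>H\<close> along the segment from \<open>y0\<close> to \<open>y\<close> gives the factors
  \<open>G b y = \<integral> \<partial>\<^sub>b H (y0 + t (y - y0)) dt\<close> over \<open>0 \<le> t \<le> 1\<close>.
\<close>

lemma hadamard:
  fixes H :: "'a::euclidean_space \<Rightarrow> real"
  assumes H: "smooth_on H (ball y0 R)" and "R > 0"
  obtains G where "\<And>b. smooth_on (G b) (ball y0 R)" "\<And>b. G b y0 = frechet_derivative H (at y0) b"
    "\<And>y. y \<in> ball y0 R \<Longrightarrow> H y = H y0 + (\<Sum>b\<in>Basis. ((y - y0) \<bullet> b) * G b y)"
proof -
  define G where "G b y = integral (cbox 0 1) (\<lambda>t. frechet_derivative H (at (y0 + t *\<^sub>R (y - y0))) b)" for b y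
  have base: "G b y0 = frechet_derivative H (at y0) b" for b
    by (simp add: G_def)
  have smooth: "smooth_on (G b) (ball y0 R)" for b
  proof (rule smooth_on_local)
    fix x assume x: "x \<in> ball y0 R"
    \<comment> \<open>On a ball of a smaller radius \<open>r\<close> the segments may be prolonged to \<open>|t| < R / r\<close>, which provides
      the open neighbourhood of the unit interval on which the integrand is smooth.\<close>
    define r where "r = (dist y0 x + R) / 2"
    have r: "0 < r" "r < R" "dist y0 x < r" using x \<open>R > 0\<close> by (auto simp: r_def add_nonneg_pos)
    have unit: "(cbox 0 1 :: real set) \<subseteq> ball 0 (R / r)"
    proof
      fix t :: real assume "t \<in> cbox 0 1"
      then have "\<bar>t\<bar> \<le> 1" by auto
      also have "1 < R / r" using r by simp
      finally show "t \<in> ball (0::real) (R / r)" by simp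
    qed
    have sm: "smooth_on (\<lambda>p. frechet_derivative H (at (y0 + snd p *\<^sub>R (fst p - y0))) b) (ball y0 r \<times> ball (0::real) (R / r))"
    proof (rule smooth_on_compose[OF _ _ _ smooth_on_frechet[OF H]])
      show "smooth_on (\<lambda>p. y0 + snd p *\<^sub>R (fst p - y0)) (ball y0 r \<times> ball (0::real) (R / r))"
        by (intro smooth_on_add smooth_on_const smooth_on_scaleR smooth_on_snd smooth_on_fst smooth_on_diff
            smooth_on_ident open_Times open_ball)
      show "(\<lambda>p. y0 + snd p *\<^sub>R (fst p - y0)) ` (ball y0 r \<times> ball (0::real) (R / r)) \<subseteq> ball y0 R"
      proof (rule image_subsetI)
        fix p assume "p \<in> ball y0 r \<times> ball (0::real) (R / r)"
        then have "norm (fst p - y0) < r" "\<bar>snd p\<bar> < R / r"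
          by (auto simp: dist_norm norm_minus_commute)
        then have "\<bar>snd p\<bar> * norm (fst p - y0) < (R / r) * r"
          by (intro mult_strict_mono') auto
        then show "y0 + snd p *\<^sub>R (fst p - y0) \<in> ball y0 R"
          using r by (simp add: dist_norm)
      qed
    qed (auto intro: open_Times)
    have "smooth_on (G b) (ball y0 r)"
      using smooth_on_integral_param[OF open_ball unit sm] by (simp add: G_def[abs_def])
    then show "\<exists>T. open T \<and> x \<in> T \<and> smooth_on (G b) T" using r by (intro exI[of _ "ball y0 r"]) auto
  qed
  have taylor: "H y = H y0 + (\<Sum>b\<in>Basis. ((y - y0) \<bullet> b) * G b y)" if y: "y \<in> ball y0 R" for y
  proof -
    have seg: "y0 + t *\<^sub>R (y - y0) \<in> ball y0 R" if "t \<in> cbox 0 1" for t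
    proof -
      have "\<bar>t\<bar> * norm (y - y0) \<le> 1 * norm (y - y0)" using that by (intro mult_right_mono) auto
      then show ?thesis using y by (simp add: dist_norm norm_minus_commute)
    qed
    have cont: "continuous_on (cbox 0 1) (\<lambda>t. frechet_derivative H (at (y0 + t *\<^sub>R (y - y0))) b)" for b
      by (rule continuous_on_compose2[OF smooth_on_continuous[OF smooth_on_frechet[OF H]]])
        (use seg in \<open>auto intro!: continuous_intros\<close>)
    have expand: "frechet_derivative H (at z) u = (\<Sum>b\<in>Basis. (u \<bullet> b) * frechet_derivative H (at z) b)"
      if "z \<in> ball y0 R" for z u
    proof -
      interpret linear "frechet_derivative H (at z)"
        using has_derivative_linear[OF smooth_on_has_derivative[OF H that]] .
      have "frechet_derivative H (at z) u = frechet_derivative H (at z) (\<Sum>b\<in>Basis. (u \<bullet> b) *\<^sub>R b)"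
        by (simp add: euclidean_representation)
      then show ?thesis by (simp add: sum scaleR)
    qed
    have "((\<lambda>t. frechet_derivative H (at (y0 + t *\<^sub>R (y - y0))) (y - y0)) has_integral
        H (y0 + 1 *\<^sub>R (y - y0)) - H (y0 + 0 *\<^sub>R (y - y0))) {0..1}"
    proof (rule fundamental_theorem_of_calculus)
      fix t :: real assume t: "t \<in> {0..1}"
      have "((\<lambda>t. y0 + t *\<^sub>R (y - y0)) has_derivative (\<lambda>h. h *\<^sub>R (y - y0))) (at t within {0..1})"
        by (auto intro!: derivative_eq_intros)
      from has_derivative_compose[OF this smooth_on_has_derivative[OF H]] seg t
      have d: "((\<lambda>t. H (y0 + t *\<^sub>R (y - y0))) has_derivative
          (\<lambda>h. frechet_derivative H (at (y0 + t *\<^sub>R (y - y0))) (h *\<^sub>R (y - y0)))) (at t within {0..1})" by simp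
      interpret linear "frechet_derivative H (at (y0 + t *\<^sub>R (y - y0)))"
        using has_derivative_linear[OF smooth_on_has_derivative[OF H seg]] t by simp
      show "((\<lambda>t. H (y0 + t *\<^sub>R (y - y0))) has_vector_derivative
          frechet_derivative H (at (y0 + t *\<^sub>R (y - y0))) (y - y0)) (at t within {0..1})"
        using d by (simp add: has_vector_derivative_def scaleR)
    qed simp
    then have "H y - H y0 = integral (cbox 0 1) (\<lambda>t. frechet_derivative H (at (y0 + t *\<^sub>R (y - y0))) (y - y0))"
      by (simp add: integral_unique)
    also have "\<dots> = integral (cbox 0 1) (\<lambda>t. \<Sum>b\<in>Basis. ((y - y0) \<bullet> b) * frechet_derivative H (at (y0 + t *\<^sub>R (y - y0))) b)"
      by (rule integral_cong) (rule expand, rule seg)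
    also have "\<dots> = (\<Sum>b\<in>Basis. integral (cbox 0 1) (\<lambda>t. ((y - y0) \<bullet> b) * frechet_derivative H (at (y0 + t *\<^sub>R (y - y0))) b))"
      by (intro integral_sum integrable_continuous continuous_intros cont finite_Basis)
    also have "\<dots> = (\<Sum>b\<in>Basis. ((y - y0) \<bullet> b) * G b y)"
      by (simp add: G_def)
    finally show ?thesis by simp
  qed
  from smooth base taylor show thesis by (rule that)
qed

text \<open>
  Two applications of the mean value theorem, first in the direction of \<open>v\<close> and then in that of \<open>w\<close>.
  The left-hand side of the equation is symmetric in \<open>v\<close> and \<open>w\<close>, which is the reason why second
  derivatives commute.
\<close>

lemma second_difference_quotient:
  fixes f :: "'a::euclidean_space \<Rightarrow> real"
  assumes f: "smooth_on f (ball x e)" and h: "0 < h" "h * (norm v + norm w) < e"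
  shows "\<exists>p. dist x p \<le> h * (norm v + norm w) \<and>
    f (x + h *\<^sub>R v + h *\<^sub>R w) - f (x + h *\<^sub>R v) - f (x + h *\<^sub>R w) + f x =
      h * (h * frechet_derivative (\<lambda>y. frechet_derivative f (at y) v) (at p) w)"
proof -
  have n: "norm (s *\<^sub>R v + t *\<^sub>R w) \<le> h * (norm v + norm w)"
    if "0 \<le> s" "s \<le> h" "0 \<le> t" "t \<le> h" for s t
  proof -
    have "norm (s *\<^sub>R v + t *\<^sub>R w) \<le> s * norm v + t * norm w"
      using that norm_triangle_ineq[of "s *\<^sub>R v" "t *\<^sub>R w"] by simp
    also have "\<dots> \<le> h * norm v + h * norm w"
      using that by (intro add_mono mult_right_mono) auto
    finally show ?thesis by (simp add: distrib_left)
  qed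
  have dx: "dist x (x + a + b) = norm (a + b)" for a b
    by (metis add.assoc add_diff_cancel_left' dist_commute dist_norm)
  have inb: "x + s *\<^sub>R v + t *\<^sub>R w \<in> ball x e" if "0 \<le> s" "s \<le> h" "0 \<le> t" "t \<le> h" for s t
    using n[OF that] h by (simp add: dx)
  have line: "((\<lambda>s. k (a + s *\<^sub>R u)) has_real_derivative frechet_derivative k (at (a + s *\<^sub>R u)) u) (at s)"
    if k: "smooth_on k (ball x e)" and "a + s *\<^sub>R u \<in> ball x e" for k :: "'a \<Rightarrow> real" and a u s
  proof -
    have "((\<lambda>s. a + s *\<^sub>R u) has_derivative (\<lambda>h. h *\<^sub>R u)) (at s)"
      by (auto intro!: derivative_eq_intros)
    from has_derivative_compose[OF this smooth_on_has_derivative[OF k that(2)]]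
    have d: "((\<lambda>s. k (a + s *\<^sub>R u)) has_derivative (\<lambda>h. frechet_derivative k (at (a + s *\<^sub>R u)) (h *\<^sub>R u))) (at s)" .
    interpret linear "frechet_derivative k (at (a + s *\<^sub>R u))"
      using has_derivative_linear[OF smooth_on_has_derivative[OF k that(2)]] .
    show ?thesis using d by (simp add: has_field_derivative_def scaleR mult_commute_abs)
  qed
  define D where "D y = frechet_derivative f (at y) v" for y
  have D: "smooth_on D (ball x e)" unfolding D_def by (rule smooth_on_frechet[OF f])
  have "((\<lambda>s. f (x + s *\<^sub>R v + h *\<^sub>R w) - f (x + s *\<^sub>R v)) has_real_derivative
      D (x + s *\<^sub>R v + h *\<^sub>R w) - D (x + s *\<^sub>R v)) (at s)" if "0 \<le> s" "s \<le> h" for s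
    using line[OF f, of "x + h *\<^sub>R w" s v] line[OF f, of x s v] inb[of s h] inb[of s 0] that h(1)
    by (intro DERIV_diff) (auto simp: D_def algebra_simps)
  from MVT2[OF h(1) this] obtain s where s: "0 < s" "s < h" and
    1: "f (x + h *\<^sub>R v + h *\<^sub>R w) - f (x + h *\<^sub>R v) - (f (x + h *\<^sub>R w) - f x) =
      h * (D (x + s *\<^sub>R v + h *\<^sub>R w) - D (x + s *\<^sub>R v))" by auto
  have "((\<lambda>t. D (x + s *\<^sub>R v + t *\<^sub>R w)) has_real_derivative
      frechet_derivative D (at (x + s *\<^sub>R v + t *\<^sub>R w)) w) (at t)" if "0 \<le> t" "t \<le> h" for t
    using line[OF D, of "x + s *\<^sub>R v" t w] inb[of s t] that s by simp
  from MVT2[OF h(1) this] obtain t where t: "0 < t" "t < h" and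
    2: "D (x + s *\<^sub>R v + h *\<^sub>R w) - D (x + s *\<^sub>R v) = h * frechet_derivative D (at (x + s *\<^sub>R v + t *\<^sub>R w)) w"
    by auto
  have "dist x (x + s *\<^sub>R v + t *\<^sub>R w) \<le> h * (norm v + norm w)"
    using n[of s t] s t by (simp add: dx)
  with 1 2 show ?thesis unfolding D_def by (intro exI[of _ "x + s *\<^sub>R v + t *\<^sub>R w"]) simp
qed

text \<open>
  Arbitrarily close to \<open>x\<close> there are points \<open>p\<close> and \<open>q\<close> such that one iterated derivative at \<open>p\<close> equals
  the other one at \<open>q\<close>, so by continuity they agree at \<open>x\<close>.
\<close>

lemma mixed_derivatives_commute:
  fixes f :: "'a::euclidean_space \<Rightarrow> real"
  assumes f: "smooth_on f S" and "open S" "x \<in> S"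
  shows "frechet_derivative (\<lambda>y. frechet_derivative f (at y) v) (at x) w =
    frechet_derivative (\<lambda>y. frechet_derivative f (at y) w) (at x) v"
proof (rule ccontr)
  define P where "P y = frechet_derivative (\<lambda>y. frechet_derivative f (at y) v) (at y) w" for y
  define Q where "Q y = frechet_derivative (\<lambda>y. frechet_derivative f (at y) w) (at y) v" for y
  assume "\<not> ?thesis"
  then have d: "\<bar>P x - Q x\<bar> > 0" by (simp add: P_def Q_def)
  have "isCont P x" "isCont Q x"
    using smooth_on_continuous[OF smooth_on_frechet[OF smooth_on_frechet[OF f]]] assms(2,3)
    unfolding P_def[abs_def] Q_def[abs_def] by (simp_all add: continuous_on_eq_continuous_at)
  then obtain d1 d2 where d12: "d1 > 0" "d2 > 0"
    "\<And>y. dist y x < d1 \<Longrightarrow> dist (P y) (P x) < \<bar>P x - Q x\<bar> / 2"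
    "\<And>y. dist y x < d2 \<Longrightarrow> dist (Q y) (Q x) < \<bar>P x - Q x\<bar> / 2"
    using d unfolding continuous_at_eps_delta by (metis half_gt_zero)
  obtain e where e: "e > 0" "ball x e \<subseteq> S" using assms(2,3) openE by blast
  define h where "h = min e (min d1 d2) / (2 * (norm v + norm w + 1))"
  have pos: "norm v + norm w + 1 > 0" by (simp add: add_nonneg_pos)
  then have h: "h > 0" using e d12 by (simp add: h_def)
  have "h * (norm v + norm w) < h * (2 * (norm v + norm w + 1))"
    using h by (intro mult_strict_left_mono) (auto simp: add_nonneg_pos)
  also have "\<dots> = min e (min d1 d2)" using pos by (simp add: h_def)
  finally have small: "h * (norm v + norm w) < e" "h * (norm v + norm w) < d1" "h * (norm v + norm w) < d2"
    by auto
  have fe: "smooth_on f (ball x e)" using f e(2) by (rule smooth_on_subset)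
  obtain p where p: "dist x p \<le> h * (norm v + norm w)"
    "f (x + h *\<^sub>R v + h *\<^sub>R w) - f (x + h *\<^sub>R v) - f (x + h *\<^sub>R w) + f x = h * (h * P p)"
    using second_difference_quotient[OF fe h small(1)] unfolding P_def by blast
  obtain q where q: "dist x q \<le> h * (norm v + norm w)"
    "f (x + h *\<^sub>R w + h *\<^sub>R v) - f (x + h *\<^sub>R w) - f (x + h *\<^sub>R v) + f x = h * (h * Q q)"
    using second_difference_quotient[OF fe h, of w v] small(1) unfolding Q_def by (auto simp: add.commute)
  have swap: "x + h *\<^sub>R w + h *\<^sub>R v = x + h *\<^sub>R v + h *\<^sub>R w" by (simp add: algebra_simps)
  have "h * (h * P p) = h * (h * Q q)" using p(2) q(2)[unfolded swap] by linarith
  then have "P p = Q q" using h by simp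
  moreover have "dist (P p) (P x) < \<bar>P x - Q x\<bar> / 2" "dist (Q q) (Q x) < \<bar>P x - Q x\<bar> / 2"
    using p(1) q(1) small d12 by (auto simp: dist_commute)
  ultimately show False by (simp add: dist_real_def abs_if split: if_splits)
qed

lemma partial_derivatives:
  assumes "smooth_on f (U \<times> W)" "x \<in> U" "t \<in> W"
  shows "frechet_derivative (\<lambda>x. f (x, t)) (at x) v = frechet_derivative f (at (x, t)) (v, 0)"
    and "frechet_derivative (\<lambda>t. f (x, t)) (at t) w = frechet_derivative f (at (x, t)) (0, w)"
  by (simp_all only: has_derivative_partial[OF assms, THEN frechet_derivative_at, symmetric])

lemma derivative_along_diagonal:
  assumes f: "smooth_on f (U \<times> U)" and "x \<in> U"
  shows "frechet_derivative (\<lambda>s. f (s, s)) (at x) v =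
    frechet_derivative (\<lambda>s. f (s, x)) (at x) v + frechet_derivative (\<lambda>t. f (x, t)) (at x) v"
proof -
  have F: "(f has_derivative frechet_derivative f (at (x, x))) (at (x, x))"
    using smooth_on_has_derivative[OF f] assms(2) by blast
  interpret linear "frechet_derivative f (at (x, x))"
    using has_derivative_linear[OF F] .
  have "((\<lambda>s. (s, s)) has_derivative (\<lambda>v. (v, v))) (at x)"
    by (auto intro!: derivative_eq_intros)
  from has_derivative_compose[OF this F]
  have "frechet_derivative (\<lambda>s. f (s, s)) (at x) v = frechet_derivative f (at (x, x)) (v, v)"
    by (simp only: frechet_derivative_at[symmetric])
  also have "\<dots> = frechet_derivative f (at (x, x)) (v, 0) + frechet_derivative f (at (x, x)) (0, v)"
    using add[of "(v, 0)" "(0, v)"] by simp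
  finally show ?thesis
    by (simp only: partial_derivatives[OF f assms(2) assms(2)])
qed

lemma mixed_partials_commute:
  fixes f :: "'a::euclidean_space \<times> 'b::euclidean_space \<Rightarrow> real"
  assumes f: "smooth_on f (U \<times> W)" and o: "open U" "open W" and "x \<in> U" "t \<in> W"
  shows "frechet_derivative (\<lambda>x. frechet_derivative (\<lambda>t. f (x, t)) (at t) w) (at x) v =
    frechet_derivative (\<lambda>t. frechet_derivative (\<lambda>x. f (x, t)) (at x) v) (at t) w"
proof -
  note D = smooth_on_frechet[OF f]
  have "frechet_derivative (\<lambda>x. frechet_derivative (\<lambda>t. f (x, t)) (at t) w) (at x) v =
      frechet_derivative (\<lambda>x. frechet_derivative f (at (x, t)) (0, w)) (at x) v"
    by (subst frechet_derivative_cong_open[OF o(1) assms(4) partial_derivatives(2)[OF f _ assms(5)]]) simp_all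
  also have "\<dots> = frechet_derivative (\<lambda>z. frechet_derivative f (at z) (0, w)) (at (x, t)) (v, 0)"
    by (rule partial_derivatives(1)[OF D assms(4,5)])
  also have "\<dots> = frechet_derivative (\<lambda>z. frechet_derivative f (at z) (v, 0)) (at (x, t)) (0, w)"
    by (rule mixed_derivatives_commute[OF f]) (use assms in \<open>auto intro: open_Times\<close>)
  also have "\<dots> = frechet_derivative (\<lambda>t. frechet_derivative f (at (x, t)) (v, 0)) (at t) w"
    by (rule partial_derivatives(2)[OF D assms(4,5), symmetric])
  also have "\<dots> = frechet_derivative (\<lambda>t. frechet_derivative (\<lambda>x. f (x, t)) (at x) v) (at t) w"
    by (subst frechet_derivative_cong_open[OF o(2) assms(5) partial_derivatives(1)[OF f assms(4)]]) simp_all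
  finally show ?thesis .
qed

section \<open>Smooth functions, point derivations and vector fields on a manifold\<close>

locale smooth_manifold =
  fixes A :: "('m::{t2_space, second_countable_topology}, 'e::euclidean_space) atlas"
  assumes atlas: "smooth_atlas A"
begin

lemma chart:
  assumes "(U, \<phi>) \<in> A"
  shows chart_open: "open U" and chart_open_image: "open (\<phi> ` U)"
    and chart_inv: "\<And>p. p \<in> U \<Longrightarrow> inv_into U \<phi> (\<phi> p) = p"
    and chart_image_inv: "\<And>y. y \<in> \<phi> ` U \<Longrightarrow> \<phi> (inv_into U \<phi> y) = y"
    and chart_inv_mem: "\<And>y. y \<in> \<phi> ` U \<Longrightarrow> inv_into U \<phi> y \<in> U"
    and chart_continuous: "continuous_on U \<phi>"
    and chart_inv_continuous: "continuous_on (\<phi> ` U) (inv_into U \<phi>)"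
proof -
  have "open U \<and> open (\<phi> ` U) \<and> homeomorphism U (\<phi> ` U) \<phi> (inv_into U \<phi>)"
    using atlas assms unfolding smooth_atlas_def by fast
  then show "open U" "open (\<phi> ` U)" "\<And>p. p \<in> U \<Longrightarrow> inv_into U \<phi> (\<phi> p) = p"
    "\<And>y. y \<in> \<phi> ` U \<Longrightarrow> \<phi> (inv_into U \<phi> y) = y" "\<And>y. y \<in> \<phi> ` U \<Longrightarrow> inv_into U \<phi> y \<in> U"
    "continuous_on U \<phi>" "continuous_on (\<phi> ` U) (inv_into U \<phi>)"
    unfolding homeomorphism_def by (auto simp: f_inv_into_f inv_into_into)
qed

lemma chart_at: obtains U \<phi> where "(U, \<phi>) \<in> A" "p \<in> U"
proof -
  have "p \<in> (\<Union>(U, \<phi>)\<in>A. U)" using atlas unfolding smooth_atlas_def by simp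
  then show thesis using that by auto
qed

lemma chart_preimage_open:
  assumes "(U, \<phi>) \<in> A" "open W"
  shows "open {q \<in> U. \<phi> q \<in> W}"
proof -
  have "{q \<in> U. \<phi> q \<in> W} = U \<inter> \<phi> -` W" by auto
  then show ?thesis
    using continuous_open_preimage[OF chart_continuous chart_open assms(2)] assms(1) by simp
qed

text \<open>
  Smooth maps from Euclidean space into the manifold. A smooth function composed with such a map is
  a smooth function between Euclidean spaces, so the smoothness of expressions in several points of
  the manifold, with one parameter for each point, follows from composition rules.
\<close>

definition smooth_param :: "('d::euclidean_space \<Rightarrow> 'm) \<Rightarrow> 'd set \<Rightarrow> bool" where
  "smooth_param c S \<longleftrightarrow> continuous_on S c \<and> (\<forall>(V, \<psi>)\<in>A. smooth_on (\<lambda>s. \<psi> (c s)) (S \<inter> c -` V))"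

lemma smooth_paramD:
  assumes "smooth_param c S" "(V, \<psi>) \<in> A"
  shows "smooth_on (\<lambda>s. \<psi> (c s)) (S \<inter> c -` V)"
  using assms unfolding smooth_param_def by blast

lemma smooth_param_open:
  assumes "smooth_param c S" "open S" "open V"
  shows "open (S \<inter> c -` V)"
  using assms unfolding smooth_param_def by (blast intro: continuous_open_preimage)

lemma smooth_param_chart:
  assumes "(U, \<phi>) \<in> A"
  shows "smooth_param (inv_into U \<phi>) (\<phi> ` U)"
  unfolding smooth_param_def
proof (intro conjI ballI, rule chart_inv_continuous[OF assms], clarify)
  fix V \<psi> assume V: "(V, \<psi>) \<in> A"
  have "\<phi> ` U \<inter> inv_into U \<phi> -` V = \<phi> ` (U \<inter> V)"
    using chart_inv[OF assms] by force
  moreover have "smooth_on (\<psi> \<circ> inv_into U \<phi>) (\<phi> ` (U \<inter> V))"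
    using atlas assms V unfolding smooth_atlas_def by fast
  ultimately show "smooth_on (\<lambda>s. \<psi> (inv_into U \<phi> s)) (\<phi> ` U \<inter> inv_into U \<phi> -` V)"
    by (simp add: o_def)
qed

lemma smooth_param_const: "smooth_param (\<lambda>s. a) S"
  by (auto simp: smooth_param_def smooth_on_const)

lemma smooth_param_compose:
  assumes c: "smooth_param c T" and "open S" "open T" and h: "smooth_on h S" and "h ` S \<subseteq> T"
  shows "smooth_param (\<lambda>s. c (h s)) S"
  unfolding smooth_param_def
proof (intro conjI ballI)
  show cont: "continuous_on S (\<lambda>s. c (h s))"
    using c smooth_on_continuous[OF h] assms(5) unfolding smooth_param_def
    by (blast intro: continuous_on_compose2)
  show "case z of (V, \<psi>) \<Rightarrow> smooth_on (\<lambda>s. \<psi> (c (h s))) (S \<inter> (\<lambda>s. c (h s)) -` V)" if "z \<in> A" for z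
  proof (cases z)
    case (Pair V \<psi>)
    with that have V: "(V, \<psi>) \<in> A" by simp
    have "smooth_on (\<lambda>s. \<psi> (c (h s))) (S \<inter> (\<lambda>s. c (h s)) -` V)"
      by (rule smooth_on_compose[OF continuous_open_preimage[OF cont assms(2) chart_open[OF V]]
            smooth_param_open[OF c assms(3) chart_open[OF V]] smooth_on_subset[OF h] smooth_paramD[OF c V]])
        (use assms(5) in auto)
    with Pair show ?thesis by simp
  qed
qed

lemma smooth_fun_param:
  assumes f: "smooth_fun A f" and c: "smooth_param c S" and "open S"
  shows "smooth_on (\<lambda>s. f (c s)) S"
proof (rule smooth_on_local)
  fix s assume s: "s \<in> S"
  obtain V \<psi> where V: "(V, \<psi>) \<in> A" "c s \<in> V" by (rule chart_at)
  have o: "open (S \<inter> c -` V)" by (rule smooth_param_open[OF c assms(3) chart_open[OF V(1)]])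
  have "smooth_on (\<lambda>y. f (inv_into V \<psi> y)) (\<psi> ` V)"
    using f V unfolding smooth_fun_def by (fastforce simp: o_def)
  then have "smooth_on (\<lambda>s. f (inv_into V \<psi> (\<psi> (c s)))) (S \<inter> c -` V)"
    by (rule smooth_on_compose[OF o chart_open_image[OF V(1)] smooth_paramD[OF c V(1)]]) auto
  then have "smooth_on (\<lambda>s. f (c s)) (S \<inter> c -` V)"
    by (rule smooth_on_cong[OF o, rotated]) (auto simp: chart_inv[OF V(1)])
  then show "\<exists>T. open T \<and> s \<in> T \<and> smooth_on (\<lambda>s. f (c s)) T" using o s V by blast
qed

lemma smooth_funI:
  assumes "\<And>U \<phi>. (U, \<phi>) \<in> A \<Longrightarrow> smooth_on (\<lambda>y. f (inv_into U \<phi> y)) (\<phi> ` U)"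
  shows "smooth_fun A f"
  using assms unfolding smooth_fun_def by (auto simp: o_def)

lemma smooth_funD:
  assumes "smooth_fun A f" "(U, \<phi>) \<in> A"
  shows "smooth_on (\<lambda>y. f (inv_into U \<phi> y)) (\<phi> ` U)"
  using assms unfolding smooth_fun_def by (fastforce simp: o_def)

lemma smooth_fun_localI:
  assumes "\<And>p. \<exists>U \<phi> W. (U, \<phi>) \<in> A \<and> p \<in> U \<and> open W \<and> \<phi> p \<in> W \<and> W \<subseteq> \<phi> ` U \<and>
    smooth_on (\<lambda>y. f (inv_into U \<phi> y)) W"
  shows "smooth_fun A f"
proof (rule smooth_funI, rule smooth_on_local)
  fix V \<psi> y assume V: "(V, \<psi>) \<in> A" and y: "y \<in> \<psi> ` V"
  let ?c = "inv_into V \<psi>"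
  from assms[of "?c y"] obtain U \<phi> W where U: "(U, \<phi>) \<in> A" "?c y \<in> U"
    and W: "open W" "\<phi> (?c y) \<in> W" "W \<subseteq> \<phi> ` U" "smooth_on (\<lambda>y. f (inv_into U \<phi> y)) W"
    by (elim exE conjE)
  define T where "T = \<psi> ` V \<inter> ?c -` {q \<in> U. \<phi> q \<in> W}"
  have T: "open T" unfolding T_def
    by (rule smooth_param_open[OF smooth_param_chart[OF V] chart_open_image[OF V] chart_preimage_open[OF U(1) W(1)]])
  have "smooth_on (\<lambda>s. \<phi> (?c s)) T"
    by (rule smooth_on_subset[OF smooth_paramD[OF smooth_param_chart[OF V] U(1)]]) (auto simp: T_def)
  then have "smooth_on (\<lambda>s. f (inv_into U \<phi> (\<phi> (?c s)))) T"
    by (rule smooth_on_compose[OF T W(1) _ W(4)]) (auto simp: T_def)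
  then have "smooth_on (\<lambda>s. f (?c s)) T"
    by (rule smooth_on_cong[OF T, rotated]) (auto simp: chart_inv[OF U(1)] T_def)
  then show "\<exists>T. open T \<and> y \<in> T \<and> smooth_on (\<lambda>s. f (?c s)) T"
    using T y U W by (intro exI[of _ T]) (auto simp: T_def)
qed

lemma smooth_fun_const: "smooth_fun A (\<lambda>p. c)"
  by (simp add: smooth_funI smooth_on_const)

lemma smooth_fun_add: "smooth_fun A f \<Longrightarrow> smooth_fun A h \<Longrightarrow> smooth_fun A (\<lambda>p. f p + h p)"
  by (rule smooth_funI) (auto intro!: smooth_on_add chart_open_image dest: smooth_funD)

lemma smooth_fun_mult: "smooth_fun A f \<Longrightarrow> smooth_fun A h \<Longrightarrow> smooth_fun A (\<lambda>p. f p * h p)"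
  by (rule smooth_funI) (auto intro!: smooth_on_mult chart_open_image dest: smooth_funD)

lemma smooth_fun_diff: "smooth_fun A f \<Longrightarrow> smooth_fun A h \<Longrightarrow> smooth_fun A (\<lambda>p. f p - h p)"
  by (rule smooth_funI) (auto intro!: smooth_on_diff chart_open_image dest: smooth_funD)

lemma smooth_fun_sum:
  "(\<And>i. i \<in> I \<Longrightarrow> smooth_fun A (f i)) \<Longrightarrow> smooth_fun A (\<lambda>p. \<Sum>i\<in>I. f i p)"
  by (rule smooth_funI) (auto intro!: smooth_on_sum chart_open_image dest: smooth_funD)

lemma smooth_fun_plus: "smooth_fun A f \<Longrightarrow> smooth_fun A h \<Longrightarrow> smooth_fun A (f + h)"
  using smooth_fun_add[of f h] by (simp add: plus_fun_def)

lemma smooth_fun_times: "smooth_fun A f \<Longrightarrow> smooth_fun A h \<Longrightarrow> smooth_fun A (f * h)"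
  using smooth_fun_mult[of f h] by (simp add: times_fun_def)

lemma smooth_fun_zero: "smooth_fun A 0"
  using smooth_fun_const[of 0] by (simp add: zero_fun_def)

lemma smooth_fun_minus: "smooth_fun A f \<Longrightarrow> smooth_fun A h \<Longrightarrow> smooth_fun A (f - h)"
  using smooth_fun_diff[of f h] by (simp add: fun_diff_def)

text \<open>
  The sets where \<open>\<phi> p \<in> ball y0 R\<close> and where \<open>p\<close> is outside the preimage of \<open>cball y0 r\<close> cover the manifold.
  The second one is open because the preimage is compact and the manifold is Hausdorff.
\<close>

lemma smooth_fun_extend_by_zero:
  assumes U: "(U, \<phi>) \<in> A" and "r < R" "ball y0 R \<subseteq> \<phi> ` U" and h: "smooth_on h (ball y0 R)"
    and h0: "\<And>y. y \<in> ball y0 R \<Longrightarrow> r \<le> dist y0 y \<Longrightarrow> h y = 0"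
  shows "smooth_fun A (\<lambda>p. if p \<in> U \<and> \<phi> p \<in> ball y0 R then h (\<phi> p) else 0)" (is "smooth_fun A ?f")
proof (rule smooth_funI, rule smooth_on_local)
  fix V \<psi> y assume V: "(V, \<psi>) \<in> A" and y: "y \<in> \<psi> ` V"
  let ?c = "inv_into V \<psi>"
  note c = smooth_param_chart[OF V] and oV = chart_open_image[OF V]
  show "\<exists>T. open T \<and> y \<in> T \<and> smooth_on (\<lambda>y. ?f (?c y)) T"
  proof (cases "?c y \<in> U \<and> \<phi> (?c y) \<in> ball y0 R")
    case True
    define T where "T = \<psi> ` V \<inter> ?c -` {q \<in> U. \<phi> q \<in> ball y0 R}"
    have T: "open T" unfolding T_def
      by (rule smooth_param_open[OF c oV chart_preimage_open[OF U open_ball]])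
    have "smooth_on (\<lambda>s. \<phi> (?c s)) T"
      by (rule smooth_on_subset[OF smooth_paramD[OF c U]]) (auto simp: T_def)
    then have "smooth_on (\<lambda>s. h (\<phi> (?c s))) T"
      by (rule smooth_on_compose[OF T open_ball _ h]) (auto simp: T_def)
    then have "smooth_on (\<lambda>y. ?f (?c y)) T"
      by (rule smooth_on_cong[OF T, rotated]) (auto simp: T_def)
    moreover have "y \<in> T" using True y by (simp add: T_def)
    ultimately show ?thesis using T by (intro exI[of _ T] conjI)
  next
    case False
    define K where "K = inv_into U \<phi> ` cball y0 r"
    have sub: "cball y0 r \<subseteq> ball y0 R" using assms(2) by auto
    have "compact K" unfolding K_def
      by (rule compact_continuous_image[OF continuous_on_subset[OF chart_inv_continuous[OF U]]])
        (use sub assms(3) in auto)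
    then have "open (- K)" using compact_imp_closed by blast
    define T where "T = \<psi> ` V \<inter> ?c -` (- K)"
    have T: "open T" unfolding T_def by (rule smooth_param_open[OF c oV \<open>open (- K)\<close>])
    have "?f q = 0" if "q \<notin> K" for q
    proof (cases "q \<in> U \<and> \<phi> q \<in> ball y0 R")
      case True
      then have "\<phi> q \<notin> cball y0 r" using that chart_inv[OF U] unfolding K_def by (metis image_eqI)
      then show ?thesis using h0 True by auto
    qed auto
    then have smooth: "smooth_on (\<lambda>y. ?f (?c y)) T"
      by (intro smooth_on_cong[OF T _ smooth_on_const[of 0]]) (simp add: T_def)
    have "?c y \<notin> K"
    proof
      assume "?c y \<in> K"
      then obtain z where z: "z \<in> cball y0 r" "?c y = inv_into U \<phi> z" unfolding K_def by blast
      then have "z \<in> \<phi> ` U" using sub assms(3) by blast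
      then show False using False z sub chart_inv_mem[OF U] chart_image_inv[OF U] by auto
    qed
    then have "y \<in> T" using y by (simp add: T_def)
    with T smooth show ?thesis by (intro exI[of _ T] conjI)
  qed
qed

lemma chart_ball:
  assumes "(U, \<phi>) \<in> A" "p \<in> U" "open N" "p \<in> N"
  obtains R where "R > 0" "ball (\<phi> p) R \<subseteq> \<phi> ` U" "\<And>q. q \<in> U \<Longrightarrow> \<phi> q \<in> ball (\<phi> p) R \<Longrightarrow> q \<in> N"
proof -
  have "open (\<phi> ` U \<inter> inv_into U \<phi> -` N)"
    by (rule continuous_open_preimage[OF chart_inv_continuous chart_open_image assms(3)]) (rule assms(1))+
  moreover have "\<phi> p \<in> \<phi> ` U \<inter> inv_into U \<phi> -` N"
    using assms chart_inv by simp
  ultimately obtain R where "R > 0" "ball (\<phi> p) R \<subseteq> \<phi> ` U \<inter> inv_into U \<phi> -` N"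
    using openE by blast
  then show thesis using that chart_inv[OF assms(1)] by fastforce
qed

lemma bump_function:
  assumes "open N" "p \<in> N"
  obtains f where "smooth_fun A f" "f p = 1" "\<And>q. q \<notin> N \<Longrightarrow> f q = 0"
proof -
  obtain U \<phi> where U: "(U, \<phi>) \<in> A" "p \<in> U" by (rule chart_at)
  obtain R where R: "R > 0" "ball (\<phi> p) R \<subseteq> \<phi> ` U" "\<And>q. q \<in> U \<Longrightarrow> \<phi> q \<in> ball (\<phi> p) R \<Longrightarrow> q \<in> N"
    using chart_ball[OF U assms] by blast
  have third_half: "0 < R / 3" "R / 3 < R / 2" using R(1) by simp_all
  obtain \<rho> where \<rho>: "smooth_on \<rho> UNIV" "\<And>y. dist (\<phi> p) y \<le> R / 3 \<Longrightarrow> \<rho> y = (1::real)"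
    "\<And>y. R / 2 \<le> dist (\<phi> p) y \<Longrightarrow> \<rho> y = 0"
    by (rule smooth_plateau[OF third_half, of "\<phi> p"]) (rule that)
  show thesis
  proof (rule that)
    show "smooth_fun A (\<lambda>q. if q \<in> U \<and> \<phi> q \<in> ball (\<phi> p) R then \<rho> (\<phi> q) else 0)"
      by (rule smooth_fun_extend_by_zero[OF U(1) _ R(2) smooth_on_subset[OF \<rho>(1)], of "R / 2"])
        (use R(1) \<rho>(3) in auto)
  qed (use U R \<rho> in auto)
qed

text \<open>
  A vector field acts only on globally smooth functions, so the coordinates of a chart have to be
  replaced by global functions that agree with them near a given point.
\<close>

lemma chart_coordinates:
  assumes U: "(U, \<phi>) \<in> A" "p \<in> U"
  obtains \<xi> :: "'e \<Rightarrow> 'm \<Rightarrow> real" and N where "open N" "p \<in> N" "N \<subseteq> U"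
    "\<And>b. smooth_fun A (\<xi> b)" "\<And>b q. q \<in> N \<Longrightarrow> \<xi> b q = \<phi> q \<bullet> b"
proof -
  obtain R where R: "R > 0" "ball (\<phi> p) R \<subseteq> \<phi> ` U"
    by (rule openE[OF chart_open_image[OF U(1)] imageI[OF U(2)]])
  have third_half: "0 < R / 3" "R / 3 < R / 2" using R(1) by simp_all
  obtain \<rho> where \<rho>: "smooth_on \<rho> UNIV" "\<And>y. dist (\<phi> p) y \<le> R / 3 \<Longrightarrow> \<rho> y = (1::real)"
    "\<And>y. R / 2 \<le> dist (\<phi> p) y \<Longrightarrow> \<rho> y = 0"
    by (rule smooth_plateau[OF third_half, of "\<phi> p"]) (rule that)
  define N where "N = {q \<in> U. \<phi> q \<in> ball (\<phi> p) (R / 3)}"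
  define \<xi> where "\<xi> b q = (if q \<in> U \<and> \<phi> q \<in> ball (\<phi> p) R then \<rho> (\<phi> q) * (\<phi> q \<bullet> b) else 0)" for b q
  show thesis
  proof (rule that)
    show "open N" unfolding N_def by (rule chart_preimage_open[OF U(1) open_ball])
    have "smooth_on (\<lambda>y. \<rho> y * (y \<bullet> b)) (ball (\<phi> p) R)" for b
      by (intro smooth_on_mult smooth_on_inner smooth_on_subset[OF \<rho>(1)] smooth_on_ident smooth_on_const
          open_ball subset_UNIV)
    then show "smooth_fun A (\<xi> b)" for b
      unfolding \<xi>_def
      by (intro smooth_fun_extend_by_zero[OF U(1) _ R(2), of "R / 2"]) (use R(1) \<rho>(3) in auto)
    show "\<xi> b q = \<phi> q \<bullet> b" if "q \<in> N" for b q
      using that R(1) \<rho>(2) by (auto simp: \<xi>_def N_def)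
  qed (use U R in \<open>auto simp: N_def\<close>)
qed

text \<open>
  Linearity and the product rule are required on smooth functions only. The values on other functions
  are arbitrary, as they are for directional derivatives.
\<close>

definition point_derivation :: "'m \<Rightarrow> (('m \<Rightarrow> real) \<Rightarrow> real) \<Rightarrow> bool" where
  "point_derivation p \<delta> \<longleftrightarrow>
     (\<forall>f h. smooth_fun A f \<longrightarrow> smooth_fun A h \<longrightarrow> \<delta> (\<lambda>q. f q + h q) = \<delta> f + \<delta> h) \<and>
     (\<forall>c f. smooth_fun A f \<longrightarrow> \<delta> (\<lambda>q. c * f q) = c * \<delta> f) \<and>
     (\<forall>f h. smooth_fun A f \<longrightarrow> smooth_fun A h \<longrightarrow> \<delta> (\<lambda>q. f q * h q) = f p * \<delta> h + h p * \<delta> f)"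

lemma point_derivationD:
  assumes "point_derivation p \<delta>" "smooth_fun A f" "smooth_fun A h"
  shows "\<delta> (\<lambda>q. f q + h q) = \<delta> f + \<delta> h" "\<delta> (\<lambda>q. c * f q) = c * \<delta> f"
    "\<delta> (\<lambda>q. f q * h q) = f p * \<delta> h + h p * \<delta> f"
  using assms unfolding point_derivation_def by blast+

lemma point_derivation_const:
  assumes "point_derivation p \<delta>"
  shows "\<delta> (\<lambda>q. c) = 0"
proof -
  have "\<delta> (\<lambda>q. 1 * 1) = 1 * \<delta> (\<lambda>q. 1) + 1 * \<delta> (\<lambda>q. 1)"
    using point_derivationD(3)[OF assms smooth_fun_const smooth_fun_const, of 1 1] by simp
  then have "\<delta> (\<lambda>q. 1) = 0" by simp
  then show ?thesis
    using point_derivationD(2)[OF assms smooth_fun_const[of 1] smooth_fun_const, of c] by simp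
qed

lemma point_derivation_sum:
  assumes "point_derivation p \<delta>" "\<And>i. i \<in> I \<Longrightarrow> smooth_fun A (f i)"
  shows "\<delta> (\<lambda>q. \<Sum>i\<in>I. f i q) = (\<Sum>i\<in>I. \<delta> (f i))"
  using assms(2)
proof (induction I rule: infinite_finite_induct)
  case (insert i I)
  then show ?case
    using point_derivationD(1)[OF assms(1), of "f i" "\<lambda>q. \<Sum>i\<in>I. f i q"] smooth_fun_sum[of I f] by simp
qed (auto simp: point_derivation_const[OF assms(1)])

text \<open>
  Hadamard's lemma writes \<open>f - f p\<close> near \<open>p\<close> as a combination of the functions \<open>\<xi> b - \<xi> b p\<close>, which vanish at
  \<open>p\<close>, with smooth factors. After multiplication by a cut-off \<open>\<kappa>\<close> this is an identity between global
  smooth functions, and the product rule leaves only the values of the factors at \<open>p\<close>. The same cut-off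
  shows that a point derivation depends on \<open>f\<close> near \<open>p\<close> only.
\<close>

lemma point_derivation_coordinates:
  assumes U: "(U, \<phi>) \<in> A" "p \<in> U" and d: "point_derivation p \<delta>" and N: "open N" "p \<in> N"
    and \<xi>: "\<And>b. smooth_fun A (\<xi> b)" "\<And>b q. q \<in> N \<Longrightarrow> \<xi> b q = \<phi> q \<bullet> b" and f: "smooth_fun A f"
  shows "\<delta> f = (\<Sum>b\<in>Basis. \<delta> (\<xi> b) * frechet_derivative (\<lambda>y. f (inv_into U \<phi> y)) (at (\<phi> p)) b)"
proof -
  obtain R where R: "R > 0" "ball (\<phi> p) R \<subseteq> \<phi> ` U" "\<And>q. q \<in> U \<Longrightarrow> \<phi> q \<in> ball (\<phi> p) R \<Longrightarrow> q \<in> N"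
    using chart_ball[OF U N] by blast
  let ?B = "ball (\<phi> p) R" and ?H = "\<lambda>y. f (inv_into U \<phi> y)"
  have "smooth_on ?H ?B" by (rule smooth_on_subset[OF smooth_funD[OF f U(1)] R(2)])
  then obtain G where G: "\<And>b. smooth_on (G b) ?B" "\<And>b. G b (\<phi> p) = frechet_derivative ?H (at (\<phi> p)) b"
    "\<And>y. y \<in> ?B \<Longrightarrow> ?H y = ?H (\<phi> p) + (\<Sum>b\<in>Basis. ((y - \<phi> p) \<bullet> b) * G b y)"
    using hadamard[OF _ R(1)] by blast
  have third_half: "0 < R / 3" "R / 3 < R / 2" using R(1) by simp_all
  obtain \<rho> where \<rho>: "smooth_on \<rho> UNIV" "\<And>y. dist (\<phi> p) y \<le> R / 3 \<Longrightarrow> \<rho> y = (1::real)"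
    "\<And>y. R / 2 \<le> dist (\<phi> p) y \<Longrightarrow> \<rho> y = 0"
    by (rule smooth_plateau[OF third_half, of "\<phi> p"]) (rule that)
  define \<kappa> where "\<kappa> q = (if q \<in> U \<and> \<phi> q \<in> ?B then \<rho> (\<phi> q) else 0)" for q
  define \<gamma> where "\<gamma> b q = (if q \<in> U \<and> \<phi> q \<in> ?B then \<rho> (\<phi> q) * G b (\<phi> q) else 0)" for b q
  have \<kappa>: "smooth_fun A \<kappa>"
    unfolding \<kappa>_def
    by (rule smooth_fun_extend_by_zero[OF U(1) _ R(2) smooth_on_subset[OF \<rho>(1)], of "R / 2"])
      (use R(1) \<rho>(3) in auto)
  have "smooth_on (\<lambda>y. \<rho> y * G b y) ?B" for b
    by (intro smooth_on_mult smooth_on_subset[OF \<rho>(1)] G(1) open_ball subset_UNIV)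
  then have \<gamma>: "smooth_fun A (\<gamma> b)" for b
    unfolding \<gamma>_def
    by (intro smooth_fun_extend_by_zero[OF U(1) _ R(2), of "R / 2"]) (use R(1) \<rho>(3) in auto)
  have at_p: "\<kappa> p = 1" "\<gamma> b p = frechet_derivative ?H (at (\<phi> p)) b" for b
    using U R(1) \<rho>(2) G(2) by (auto simp: \<kappa>_def \<gamma>_def)
  have fp: "smooth_fun A (\<lambda>q. f q - f p)" and \<xi>p: "smooth_fun A (\<lambda>q. \<xi> b q - \<xi> b p)" for b
    by (intro smooth_fun_diff f \<xi> smooth_fun_const)+
  have shift: "\<delta> (\<lambda>q. h q - h p) = \<delta> h" if "smooth_fun A h" for h
    using point_derivationD(1)[OF d that smooth_fun_const, of "- h p"] point_derivation_const[OF d] by simp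
  have eq: "(\<lambda>q. \<kappa> q * (f q - f p)) = (\<lambda>q. \<Sum>b\<in>Basis. (\<xi> b q - \<xi> b p) * \<gamma> b q)"
  proof
    fix q
    show "\<kappa> q * (f q - f p) = (\<Sum>b\<in>Basis. (\<xi> b q - \<xi> b p) * \<gamma> b q)"
    proof (cases "q \<in> U \<and> \<phi> q \<in> ?B")
      case True
      then have "\<xi> b q - \<xi> b p = (\<phi> q - \<phi> p) \<bullet> b" for b
        using \<xi>(2) R(3) N(2) by (simp add: inner_diff_left)
      moreover have "f q - f p = (\<Sum>b\<in>Basis. ((\<phi> q - \<phi> p) \<bullet> b) * G b (\<phi> q))"
        using G(3)[of "\<phi> q"] True U chart_inv[OF U(1)] by simp
      ultimately show ?thesis using True by (simp add: \<kappa>_def \<gamma>_def sum_distrib_left mult_ac)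
    qed (auto simp: \<kappa>_def \<gamma>_def)
  qed
  have "\<delta> f = \<delta> (\<lambda>q. \<kappa> q * (f q - f p))"
    using point_derivationD(3)[OF d \<kappa> fp] at_p shift[OF f] by simp
  also have "\<dots> = (\<Sum>b\<in>Basis. \<delta> (\<lambda>q. (\<xi> b q - \<xi> b p) * \<gamma> b q))"
    unfolding eq by (rule point_derivation_sum[OF d smooth_fun_mult[OF \<xi>p \<gamma>]])
  also have "\<dots> = (\<Sum>b\<in>Basis. \<delta> (\<xi> b) * frechet_derivative ?H (at (\<phi> p)) b)"
    using point_derivationD(3)[OF d \<xi>p \<gamma>] at_p shift[OF \<xi>(1)] by (simp add: mult.commute)
  finally show ?thesis .
qed

lemma point_derivation_directional:
  assumes c: "smooth_param c S" and "open S" "s \<in> S"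
  shows "point_derivation (c s) (\<lambda>f. frechet_derivative (\<lambda>t. f (c t)) (at s) v)"
proof -
  have d: "((\<lambda>t. f (c t)) has_derivative frechet_derivative (\<lambda>t. f (c t)) (at s)) (at s)" if "smooth_fun A f" for f
    by (rule smooth_on_has_derivative[OF smooth_fun_param[OF that c assms(2)] assms(3)])
  show ?thesis
    unfolding point_derivation_def
  proof (intro conjI allI impI)
    fix f h assume f: "smooth_fun A f" and h: "smooth_fun A h"
    show "frechet_derivative (\<lambda>t. f (c t) + h (c t)) (at s) v =
        frechet_derivative (\<lambda>t. f (c t)) (at s) v + frechet_derivative (\<lambda>t. h (c t)) (at s) v"
      by (simp only: frechet_derivative_at[OF has_derivative_add[OF d[OF f] d[OF h]], symmetric])
    show "frechet_derivative (\<lambda>t. f (c t) * h (c t)) (at s) v =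
        f (c s) * frechet_derivative (\<lambda>t. h (c t)) (at s) v + h (c s) * frechet_derivative (\<lambda>t. f (c t)) (at s) v"
      by (simp only: frechet_derivative_at[OF has_derivative_mult[OF d[OF f] d[OF h]], symmetric] mult.commute)
  next
    fix a f assume f: "smooth_fun A f"
    show "frechet_derivative (\<lambda>t. a * f (c t)) (at s) v = a * frechet_derivative (\<lambda>t. f (c t)) (at s) v"
      by (simp only: frechet_derivative_at[OF has_derivative_mult_right[OF d[OF f], of a], symmetric])
  qed
qed

lemma vector_fieldD:
  assumes "X \<in> vector_fields A"
  shows vf_smooth: "smooth_fun A f \<Longrightarrow> smooth_fun A (X f)"
    and vf_nonsmooth: "\<not> smooth_fun A f \<Longrightarrow> X f = 0"
    and vf_add: "smooth_fun A f \<Longrightarrow> smooth_fun A h \<Longrightarrow> X (f + h) = X f + X h"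
    and vf_scale: "smooth_fun A f \<Longrightarrow> X (\<lambda>p. c * f p) = (\<lambda>p. c * X f p)"
    and vf_mult: "smooth_fun A f \<Longrightarrow> smooth_fun A h \<Longrightarrow> X (f * h) = f * X h + h * X f"
  using assms unfolding vector_fields_def by blast+

lemma vector_fieldI:
  assumes "\<And>f. smooth_fun A f \<Longrightarrow> smooth_fun A (X f)" "\<And>f. \<not> smooth_fun A f \<Longrightarrow> X f = 0"
    "\<And>p. point_derivation p (\<lambda>f. X f p)"
  shows "X \<in> vector_fields A"
  unfolding vector_fields_def mem_Collect_eq
proof (intro conjI allI impI)
  fix f h assume "smooth_fun A f" "smooth_fun A h"
  then show "X (f + h) = X f + X h" "X (f * h) = f * X h + h * X f"
    using assms(3) by (auto simp: fun_eq_iff plus_fun_def times_fun_def point_derivation_def)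
next
  fix c f assume "smooth_fun A f"
  then show "X (\<lambda>p. c * f p) = (\<lambda>p. c * X f p)"
    using assms(3) by (auto simp: fun_eq_iff point_derivation_def)
qed (use assms in auto)

lemma vf_point_derivation:
  assumes "X \<in> vector_fields A"
  shows "point_derivation p (\<lambda>f. X f p)"
  using vf_add[OF assms] vf_scale[OF assms] vf_mult[OF assms]
  by (auto simp: point_derivation_def plus_fun_def times_fun_def)

lemma vf_plus:
  assumes "X \<in> vector_fields A" "Y \<in> vector_fields A"
  shows "X + Y \<in> vector_fields A"
  using assms by (auto simp: vector_fields_def smooth_fun_plus fun_eq_iff algebra_simps)

lemma vf_uminus:
  assumes "X \<in> vector_fields A"
  shows "- X \<in> vector_fields A"
proof (rule vector_fieldI)
  show "smooth_fun A ((- X) f)" if "smooth_fun A f" for f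
    using smooth_fun_diff[OF smooth_fun_const vf_smooth[OF assms that], of 0] by (simp add: fun_Compl_def)
  show "(- X) f = 0" if "\<not> smooth_fun A f" for f
    using vf_nonsmooth[OF assms that] by (auto simp: fun_eq_iff)
  show "point_derivation p (\<lambda>f. (- X) f p)" for p
    using vf_point_derivation[OF assms, of p] by (auto simp: point_derivation_def)
qed

lemma vf_minus:
  assumes "X \<in> vector_fields A" "Y \<in> vector_fields A"
  shows "X - Y \<in> vector_fields A"
  using vf_plus[OF assms(1) vf_uminus[OF assms(2)]] by simp

lemma vf_zero: "0 \<in> vector_fields A"
  by (rule vector_fieldI) (auto simp: smooth_fun_zero point_derivation_def)

lemma vf_sum: "(\<And>i. i \<in> I \<Longrightarrow> X i \<in> vector_fields A) \<Longrightarrow> (\<Sum>i\<in>I. X i) \<in> vector_fields A"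
  by (induction I rule: infinite_finite_induct) (auto simp: vf_zero vf_plus)

lemma vf_fscale:
  assumes h: "smooth_fun A h" and X: "X \<in> vector_fields A"
  shows "fscale h X \<in> vector_fields A"
proof (rule vector_fieldI)
  show "smooth_fun A (fscale h X f)" if "smooth_fun A f" for f
    using smooth_fun_times[OF h vf_smooth[OF X that]] by (simp add: fscale_def)
  show "fscale h X f = 0" if "\<not> smooth_fun A f" for f
    using vf_nonsmooth[OF X that] by (simp add: fscale_def)
  show "point_derivation p (\<lambda>f. fscale h X f p)" for p
    using vf_point_derivation[OF X, of p] by (auto simp: point_derivation_def fscale_def algebra_simps)
qed

lemma vf_const: "X \<in> vector_fields A \<Longrightarrow> X (\<lambda>p. c) = 0"
  using point_derivation_const[OF vf_point_derivation] by (auto simp: fun_eq_iff)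

lemma vf_arg_zero: "X \<in> vector_fields A \<Longrightarrow> X 0 = 0"
  using vf_const[of X 0] by (simp add: zero_fun_def)

lemma vf_bracket:
  assumes X: "X \<in> vector_fields A" and Y: "Y \<in> vector_fields A"
  shows "lie_bracket X Y \<in> vector_fields A"
  unfolding vector_fields_def mem_Collect_eq
proof (intro conjI allI impI)
  fix f h assume f: "smooth_fun A f" and h: "smooth_fun A h"
  note s = vf_smooth[OF X] vf_smooth[OF Y] f h
  show "smooth_fun A (lie_bracket X Y f)"
    unfolding lie_bracket_def by (intro smooth_fun_minus s)
  show "lie_bracket X Y (f + h) = lie_bracket X Y f + lie_bracket X Y h"
    by (simp add: lie_bracket_def vf_add[OF X] vf_add[OF Y] s)
  show "lie_bracket X Y (f * h) = f * lie_bracket X Y h + h * lie_bracket X Y f"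
    by (simp add: lie_bracket_def vf_add[OF X] vf_add[OF Y] vf_mult[OF X] vf_mult[OF Y] s smooth_fun_times algebra_simps)
next
  fix f assume "\<not> smooth_fun A f"
  then show "lie_bracket X Y f = 0"
    by (simp add: lie_bracket_def vf_nonsmooth[OF X] vf_nonsmooth[OF Y] vf_arg_zero[OF X] vf_arg_zero[OF Y])
next
  fix c f assume f: "smooth_fun A f"
  show "lie_bracket X Y (\<lambda>p. c * f p) = (\<lambda>p. c * lie_bracket X Y f p)"
    by (simp add: lie_bracket_def vf_scale[OF X] vf_scale[OF Y] vf_smooth[OF X] vf_smooth[OF Y] f fun_eq_iff algebra_simps)
qed

end

section \<open>The left invariant frame of a Lie group\<close>

lemma sum_fun_apply: "(\<Sum>i\<in>I. F i) x = (\<Sum>i\<in>I. F i x)"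
  by (induction I rule: infinite_finite_induct) auto

locale lie_group_manifold = smooth_manifold A
  for A :: "('g::{topological_group_add, t2_space, second_countable_topology}, 'e::euclidean_space) atlas" +
  assumes lie_group: "lie_group A"
begin

lemma smooth_param_add:
  assumes c: "smooth_param c S" and d: "smooth_param d S" and S: "open S"
  shows "smooth_param (\<lambda>s. c s + d s) S"
  unfolding smooth_param_def
proof (intro conjI ballI)
  show cont: "continuous_on S (\<lambda>s. c s + d s)"
    using c d by (auto simp: smooth_param_def intro: continuous_intros)
  show "case z of (W, \<omega>) \<Rightarrow> smooth_on (\<lambda>s. \<omega> (c s + d s)) (S \<inter> (\<lambda>s. c s + d s) -` W)" if "z \<in> A" for z
  proof (cases z)
    case (Pair W \<omega>)
    with that have W: "(W, \<omega>) \<in> A" by simp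
    have "smooth_on (\<lambda>s. \<omega> (c s + d s)) (S \<inter> (\<lambda>s. c s + d s) -` W)"
    proof (rule smooth_on_local)
      fix s assume s: "s \<in> S \<inter> (\<lambda>s. c s + d s) -` W"
      obtain U \<phi> where U: "(U, \<phi>) \<in> A" "c s \<in> U" by (rule chart_at)
      obtain V \<psi> where V: "(V, \<psi>) \<in> A" "d s \<in> V" by (rule chart_at)
      let ?P = "U \<times> V \<inter> (\<lambda>(x, y). x + y) -` W"
      have inv: "inv_into (U \<times> V) (map_prod \<phi> \<psi>) (\<phi> x, \<psi> y) = (x, y)" if "x \<in> U" "y \<in> V" for x y
      proof -
        have "inj_on \<phi> U" "inj_on \<psi> V"
          using chart_inv[OF U(1)] chart_inv[OF V(1)] by (metis inj_on_def)+
        then show ?thesis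
          using inv_into_f_f[OF map_prod_inj_on, of \<phi> U \<psi> V "(x, y)"] that by simp
      qed
      have op: "smooth_on (\<omega> \<circ> (\<lambda>(x, y). x + y) \<circ> inv_into (U \<times> V) (map_prod \<phi> \<psi>)) (map_prod \<phi> \<psi> ` ?P)"
      proof -
        have "(U \<times> V, map_prod \<phi> \<psi>) \<in> prod_atlas A A"
          using U V unfolding prod_atlas_def by blast
        then show ?thesis
          using lie_group W unfolding lie_group_def smooth_map_def by fast
      qed
      have oP: "open (map_prod \<phi> \<psi> ` ?P)"
      proof -
        let ?g = "\<lambda>z. inv_into U \<phi> (fst z) + inv_into V \<psi> (snd z)"
        have "map_prod \<phi> \<psi> ` ?P = (\<phi> ` U \<times> \<psi> ` V) \<inter> ?g -` W"
          using chart_inv[OF U(1)] chart_inv[OF V(1)] by force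
        moreover have "continuous_on (\<phi> ` U \<times> \<psi> ` V) ?g"
          by (intro continuous_on_add continuous_on_compose2[OF chart_inv_continuous[OF U(1)]]
              continuous_on_compose2[OF chart_inv_continuous[OF V(1)]] continuous_intros) auto
        ultimately show ?thesis
          using continuous_open_preimage[of "\<phi> ` U \<times> \<psi> ` V" ?g W] chart_open[OF W]
            open_Times[OF chart_open_image[OF U(1)] chart_open_image[OF V(1)]] by simp
      qed
      define T where "T = (S \<inter> c -` U) \<inter> (S \<inter> d -` V) \<inter> (S \<inter> (\<lambda>s. c s + d s) -` W)"
      have T: "open T"
        unfolding T_def
        by (intro open_Int smooth_param_open[OF c S chart_open[OF U(1)]] smooth_param_open[OF d S chart_open[OF V(1)]]
            continuous_open_preimage[OF cont S chart_open[OF W]])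
      have coords: "smooth_on (\<lambda>s. (\<phi> (c s), \<psi> (d s))) T"
        by (intro smooth_on_Pair[OF T] smooth_on_subset[OF smooth_paramD[OF c U(1)]]
            smooth_on_subset[OF smooth_paramD[OF d V(1)]]) (auto simp: T_def)
      have img: "(\<lambda>s. (\<phi> (c s), \<psi> (d s))) ` T \<subseteq> map_prod \<phi> \<psi> ` ?P"
      proof (rule image_subsetI)
        fix s assume "s \<in> T"
        then have "(c s, d s) \<in> ?P" by (simp add: T_def)
        from imageI[OF this, of "map_prod \<phi> \<psi>"] show "(\<phi> (c s), \<psi> (d s)) \<in> map_prod \<phi> \<psi> ` ?P" by simp
      qed
      have "smooth_on (\<lambda>s. (\<omega> \<circ> (\<lambda>(x, y). x + y) \<circ> inv_into (U \<times> V) (map_prod \<phi> \<psi>)) (\<phi> (c s), \<psi> (d s))) T"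
        by (rule smooth_on_compose[OF T oP coords op img])
      then have "smooth_on (\<lambda>s. \<omega> (c s + d s)) T"
        by (rule smooth_on_cong[OF T, rotated]) (simp add: T_def inv)
      moreover have "s \<in> T" using s U V by (simp add: T_def)
      ultimately show "\<exists>T. open T \<and> s \<in> T \<and> smooth_on (\<lambda>s. \<omega> (c s + d s)) T"
        using T by (intro exI[of _ T] conjI)
    qed
    with Pair show ?thesis by simp
  qed
qed

lemma smooth_param_uminus:
  assumes c: "smooth_param c S" and S: "open S"
  shows "smooth_param (\<lambda>s. - c s) S"
  unfolding smooth_param_def
proof (intro conjI ballI)
  show cont: "continuous_on S (\<lambda>s. - c s)"
    using c by (auto simp: smooth_param_def intro: continuous_intros)
  show "case z of (W, \<omega>) \<Rightarrow> smooth_on (\<lambda>s. \<omega> (- c s)) (S \<inter> (\<lambda>s. - c s) -` W)" if "z \<in> A" for z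
  proof (cases z)
    case (Pair W \<omega>)
    with that have W: "(W, \<omega>) \<in> A" by simp
    have "smooth_on (\<lambda>s. \<omega> (- c s)) (S \<inter> (\<lambda>s. - c s) -` W)"
    proof (rule smooth_on_local)
      fix s assume s: "s \<in> S \<inter> (\<lambda>s. - c s) -` W"
      obtain U \<phi> where U: "(U, \<phi>) \<in> A" "c s \<in> U" by (rule chart_at)
      let ?P = "U \<inter> uminus -` W"
      have op: "smooth_on (\<omega> \<circ> uminus \<circ> inv_into U \<phi>) (\<phi> ` ?P)"
        using lie_group W U unfolding lie_group_def smooth_map_def by fast
      have oP: "open (\<phi> ` ?P)"
      proof -
        have "\<phi> ` ?P = \<phi> ` U \<inter> (\<lambda>z. - inv_into U \<phi> z) -` W"
          using chart_inv[OF U(1)] by force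
        then show ?thesis
          using continuous_open_preimage[OF continuous_on_minus[OF chart_inv_continuous[OF U(1)]]
              chart_open_image[OF U(1)] chart_open[OF W]] by simp
      qed
      define T where "T = (S \<inter> c -` U) \<inter> (S \<inter> (\<lambda>s. - c s) -` W)"
      have T: "open T"
        unfolding T_def
        by (intro open_Int smooth_param_open[OF c S chart_open[OF U(1)]]
            continuous_open_preimage[OF cont S chart_open[OF W]])
      have coords: "smooth_on (\<lambda>s. \<phi> (c s)) T"
        by (intro smooth_on_subset[OF smooth_paramD[OF c U(1)]]) (auto simp: T_def)
      have img: "(\<lambda>s. \<phi> (c s)) ` T \<subseteq> \<phi> ` ?P"
        by (auto simp: T_def)
      have "smooth_on (\<lambda>s. (\<omega> \<circ> uminus \<circ> inv_into U \<phi>) (\<phi> (c s))) T"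
        by (rule smooth_on_compose[OF T oP coords op img])
      then have "smooth_on (\<lambda>s. \<omega> (- c s)) T"
        by (rule smooth_on_cong[OF T, rotated]) (simp add: T_def chart_inv[OF U(1)])
      moreover have "s \<in> T" using s U by (simp add: T_def)
      ultimately show "\<exists>T. open T \<and> s \<in> T \<and> smooth_on (\<lambda>s. \<omega> (- c s)) T"
        using T by (intro exI[of _ T] conjI)
    qed
    with Pair show ?thesis by simp
  qed
qed

lemma smooth_param_minus:
  "smooth_param c S \<Longrightarrow> smooth_param d S \<Longrightarrow> open S \<Longrightarrow> smooth_param (\<lambda>s. c s - d s) S"
  using smooth_param_add[of c S "\<lambda>s. - d s"] smooth_param_uminus[of d S] by simp

text \<open>
  The form in which smoothness of a map of the group into itself is stated here is preservation of
  smooth parametrisations, because the group operations preserve them.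
\<close>

lemma smooth_fun_comp:
  assumes "smooth_fun A f"
    and "\<And>(c :: 'e \<Rightarrow> 'g) S. open S \<Longrightarrow> smooth_param c S \<Longrightarrow> smooth_param (\<lambda>s. F (c s)) S"
  shows "smooth_fun A (\<lambda>x. f (F x))"
  by (rule smooth_funI)
    (rule smooth_fun_param[OF assms(1) assms(2)[OF chart_open_image smooth_param_chart] chart_open_image])

lemma smooth_fun_left: "smooth_fun A f \<Longrightarrow> smooth_fun A (\<lambda>y. f (a + y))"
  by (erule smooth_fun_comp) (intro smooth_param_add smooth_param_const)

lemma smooth_fun_left_iff: "smooth_fun A (\<lambda>y. f (a + y)) \<longleftrightarrow> smooth_fun A f"
proof
  assume "smooth_fun A (\<lambda>y. f (a + y))"
  from smooth_fun_left[OF this, of "- a"] show "smooth_fun A f" by simp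
qed (rule smooth_fun_left)

lemma vf_left_translate:
  assumes X: "X \<in> vector_fields A"
  shows "left_translate a X \<in> vector_fields A"
proof (rule vector_fieldI)
  show "smooth_fun A (left_translate a X f)" if "smooth_fun A f" for f
    unfolding left_translate_def by (rule smooth_fun_left[OF vf_smooth[OF X smooth_fun_left[OF that]]])
  show "left_translate a X f = 0" if "\<not> smooth_fun A f" for f
    using that vf_nonsmooth[OF X, of "\<lambda>y. f (a + y)"] smooth_fun_left_iff[of f a]
    by (simp add: left_translate_def fun_eq_iff)
  show "point_derivation x (\<lambda>f. left_translate a X f x)" for x
    using vf_point_derivation[OF X, of "- a + x"] smooth_fun_left[of _ a]
    by (simp add: point_derivation_def left_translate_def)
qed

lemma left_invariant_fieldsD:
  assumes "X \<in> left_invariant_fields A"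
  shows "X \<in> vector_fields A" "left_translate a X = X"
  using assms by (auto simp: left_invariant_fields_def)

lemma left_invariant_bracket:
  assumes X: "X \<in> left_invariant_fields A" and Y: "Y \<in> left_invariant_fields A"
  shows "lie_bracket X Y \<in> left_invariant_fields A"
proof -
  have shift: "Z (\<lambda>y. f (a + y)) = (\<lambda>y. Z f (a + y))" if "Z \<in> left_invariant_fields A" for Z f a
  proof
    fix y
    have "left_translate a Z f (a + y) = Z f (a + y)" using left_invariant_fieldsD(2)[OF that] by simp
    then show "Z (\<lambda>y. f (a + y)) y = Z f (a + y)" by (simp add: left_translate_def)
  qed
  have "left_translate a (lie_bracket X Y) = lie_bracket X Y" for a
  proof
    fix f
    have "X (Y (\<lambda>y. f (a + y))) = (\<lambda>y. X (Y f) (a + y))" "Y (X (\<lambda>y. f (a + y))) = (\<lambda>y. Y (X f) (a + y))"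
      by (simp_all only: shift[OF X, of f a] shift[OF Y, of f a] shift[OF X, of "Y f" a] shift[OF Y, of "X f" a])
    then show "left_translate a (lie_bracket X Y) f = lie_bracket X Y f"
      by (simp add: left_translate_def lie_bracket_def fun_eq_iff)
  qed
  with vf_bracket[OF left_invariant_fieldsD(1)[OF X] left_invariant_fieldsD(1)[OF Y]] show ?thesis
    unfolding left_invariant_fields_def by blast
qed

end

text \<open>
  A chart around the neutral element, together with global smooth functions \<open>\<xi> b\<close> that agree on a
  neighbourhood \<open>N\<close> with its coordinates.
\<close>

locale lie_group_chart = lie_group_manifold A
  for A :: "('g::{topological_group_add, t2_space, second_countable_topology}, 'e::euclidean_space) atlas" +
  fixes U :: "'g set" and \<phi> :: "'g \<Rightarrow> 'e" and \<xi> :: "'e \<Rightarrow> 'g \<Rightarrow> real" and N :: "'g set"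
  assumes U: "(U, \<phi>) \<in> A" and N: "open N" "0 \<in> N" "N \<subseteq> U"
    and \<xi>: "\<And>b. smooth_fun A (\<xi> b)" "\<And>b q. q \<in> N \<Longrightarrow> \<xi> b q = \<phi> q \<bullet> b"
begin

abbreviation \<theta> :: "'e \<Rightarrow> 'g" where "\<theta> \<equiv> inv_into U \<phi>"
abbreviation e0 :: 'e where "e0 \<equiv> \<phi> 0"

definition deriv_at_zero :: "'e \<Rightarrow> ('g \<Rightarrow> real) \<Rightarrow> real" where
  "deriv_at_zero b h = frechet_derivative (\<lambda>v. h (\<theta> v)) (at e0) b"

text \<open>
  Left invariant and right invariant extensions of the coordinate vectors at the neutral element.
  Vector fields send functions that are not smooth to zero, hence the case distinction.
\<close>

definition left_frame :: "'e \<Rightarrow> 'g vfield" where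
  "left_frame b f = (if smooth_fun A f then (\<lambda>x. deriv_at_zero b (\<lambda>y. f (x + y))) else 0)"

definition right_frame :: "'e \<Rightarrow> 'g vfield" where
  "right_frame b f = (if smooth_fun A f then (\<lambda>x. deriv_at_zero b (\<lambda>y. f (y + x))) else 0)"

text \<open>
  The coefficient of \<open>X\<close> at \<open>x\<close> along \<open>left_frame b\<close>: left translation moves \<open>x\<close> to the neutral element, where
  the coefficient of a tangent vector is its action on the coordinate function \<open>\<xi> b\<close>.
\<close>

definition frame_coeff :: "'e \<Rightarrow> 'g vfield \<Rightarrow> 'g \<Rightarrow> real" where
  "frame_coeff b X = (\<lambda>x. X (\<lambda>y. \<xi> b (- x + y)) x)"

lemma zero_in_U: "0 \<in> U" using N by auto

lemma open_chart: "open (\<phi> ` U)" by (rule chart_open_image[OF U])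

lemma e0: "e0 \<in> \<phi> ` U" "\<theta> e0 = 0"
  using zero_in_U chart_inv[OF U] by auto

lemmas \<theta> = smooth_param_chart[OF U]

lemma \<theta>_fst: "open S \<Longrightarrow> smooth_param (\<lambda>z. \<theta> (fst z)) (\<phi> ` U \<times> S)"
  by (rule smooth_param_compose[OF \<theta> _ open_chart])
    (auto intro: smooth_on_projections open_Times open_chart)

lemma \<theta>_snd: "open S \<Longrightarrow> smooth_param (\<lambda>z. \<theta> (snd z)) (S \<times> \<phi> ` U)"
  by (rule smooth_param_compose[OF \<theta> _ open_chart])
    (auto intro: smooth_on_projections open_Times open_chart)

text \<open>
  In charts this is the partial derivative of a smooth function of two variables, evaluated at a
  fixed value of the second one.
\<close>

lemma smooth_fun_deriv_at_zero:
  assumes P: "\<And>V \<psi>. (V, \<psi>) \<in> A \<Longrightarrow>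
    smooth_on (\<lambda>z. P (inv_into V \<psi> (fst z)) (\<theta> (snd z))) (\<psi> ` V \<times> \<phi> ` U)"
  shows "smooth_fun A (\<lambda>x. deriv_at_zero b (P x))"
proof (rule smooth_funI)
  fix V \<psi> assume V: "(V, \<psi>) \<in> A"
  let ?F = "\<lambda>z. P (inv_into V \<psi> (fst z)) (\<theta> (snd z))"
  have o: "open (\<psi> ` V)" by (rule chart_open_image[OF V])
  have "smooth_on (\<lambda>s. frechet_derivative ?F (at (s, e0)) (0, b)) (\<psi> ` V)"
    by (rule smooth_on_compose[OF o _ _ smooth_on_frechet[OF P[OF V]]])
      (auto intro!: open_Times o open_chart smooth_on_Pair smooth_on_ident smooth_on_const zero_in_U)
  then show "smooth_on (\<lambda>y. deriv_at_zero b (P (inv_into V \<psi> y))) (\<psi> ` V)"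
    by (rule smooth_on_cong[OF o, rotated])
      (use partial_derivatives(2)[OF P[OF V] _ e0(1)] in \<open>simp add: deriv_at_zero_def\<close>)
qed

lemma point_derivation_cong:
  assumes "\<And>f. smooth_fun A f \<Longrightarrow> \<delta> f = \<delta>' f" "point_derivation p \<delta>"
  shows "point_derivation p \<delta>'"
  using assms(2) unfolding point_derivation_def
  using smooth_fun_add smooth_fun_mult smooth_fun_const assms(1) by simp

lemma deriv_at_zero_point_derivation: 
  assumes "smooth_param (\<lambda>v. F (\<theta> v)) (\<phi> ` U)"
  shows "point_derivation (F 0) (\<lambda>f. deriv_at_zero b (\<lambda>y. f (F y)))"
  using point_derivation_directional[OF assms open_chart e0(1), of b] e0(2) by (simp add: deriv_at_zero_def)

lemma frame_vector_fields: "left_frame b \<in> vector_fields A" "right_frame b \<in> vector_fields A"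
proof -
  have mul: "smooth_param (\<lambda>z. inv_into V \<psi> (fst z) + \<theta> (snd z)) (\<psi> ` V \<times> \<phi> ` U)"
    "smooth_param (\<lambda>z. \<theta> (snd z) + inv_into V \<psi> (fst z)) (\<psi> ` V \<times> \<phi> ` U)" if V: "(V, \<psi>) \<in> A" for V \<psi>
  proof -
    have o: "open (\<psi> ` V \<times> \<phi> ` U)" by (intro open_Times open_chart chart_open_image[OF V])
    have "smooth_param (\<lambda>z. inv_into V \<psi> (fst z)) (\<psi> ` V \<times> \<phi> ` U)"
      by (rule smooth_param_compose[OF smooth_param_chart[OF V] o chart_open_image[OF V]])
        (auto intro: smooth_on_projections o)
    then show "smooth_param (\<lambda>z. inv_into V \<psi> (fst z) + \<theta> (snd z)) (\<psi> ` V \<times> \<phi> ` U)"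
      "smooth_param (\<lambda>z. \<theta> (snd z) + inv_into V \<psi> (fst z)) (\<psi> ` V \<times> \<phi> ` U)"
      by (auto intro!: smooth_param_add \<theta>_snd o chart_open_image[OF V])
  qed
  have o: "open (\<psi> ` V \<times> \<phi> ` U)" if "(V, \<psi>) \<in> A" for V \<psi>
    by (intro open_Times open_chart chart_open_image[OF that])
  show "left_frame b \<in> vector_fields A"
  proof (rule vector_fieldI)
    show "smooth_fun A (left_frame b f)" if f: "smooth_fun A f" for f
      using smooth_fun_deriv_at_zero[of "\<lambda>x y. f (x + y)", OF smooth_fun_param[OF f mul(1) o]] f by (simp add: left_frame_def)
    show "left_frame b f = 0" if "\<not> smooth_fun A f" for f using that by (simp add: left_frame_def)
    show "point_derivation x (\<lambda>f. left_frame b f x)" for x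
    proof (rule point_derivation_cong)
      show "point_derivation x (\<lambda>f. deriv_at_zero b (\<lambda>y. f (x + y)))"
        using deriv_at_zero_point_derivation[of "\<lambda>y. x + y"] smooth_param_add[OF smooth_param_const \<theta> open_chart, of x] by simp
    qed (simp add: left_frame_def)
  qed
  show "right_frame b \<in> vector_fields A"
  proof (rule vector_fieldI)
    show "smooth_fun A (right_frame b f)" if f: "smooth_fun A f" for f
      using smooth_fun_deriv_at_zero[of "\<lambda>x y. f (y + x)", OF smooth_fun_param[OF f mul(2) o]] f by (simp add: right_frame_def)
    show "right_frame b f = 0" if "\<not> smooth_fun A f" for f using that by (simp add: right_frame_def)
    show "point_derivation x (\<lambda>f. right_frame b f x)" for x
    proof (rule point_derivation_cong)
      show "point_derivation x (\<lambda>f. deriv_at_zero b (\<lambda>y. f (y + x)))"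
        using deriv_at_zero_point_derivation[of "\<lambda>y. y + x"] smooth_param_add[OF \<theta> smooth_param_const open_chart, of x] by simp
    qed (simp add: right_frame_def)
  qed
qed

lemma left_frame_left_invariant: "left_frame b \<in> left_invariant_fields A"
proof -
  have "left_translate a (left_frame b) = left_frame b" for a
    by (auto simp: left_translate_def left_frame_def fun_eq_iff smooth_fun_left_iff add.assoc)
  then show ?thesis using frame_vector_fields by (simp add: left_invariant_fields_def)
qed

text \<open>
  A derivation at \<open>x\<close>, translated to the neutral element, is a combination of the coordinate
  derivatives there. Translating these back gives the left invariant frame at \<open>x\<close>.
\<close>

lemma point_derivation_frame:
  assumes d: "point_derivation x \<delta>" and f: "smooth_fun A f"
  shows "\<delta> f = (\<Sum>b\<in>Basis. \<delta> (\<lambda>y. \<xi> b (- x + y)) * left_frame b f x)"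
proof -
  have "point_derivation 0 (\<lambda>h. \<delta> (\<lambda>y. h (- x + y)))"
    using d smooth_fun_left[of _ "- x"] unfolding point_derivation_def by simp
  from point_derivation_coordinates[OF U zero_in_U this N(1,2) \<xi> smooth_fun_left[OF f, of x]]
  show ?thesis by (simp add: left_frame_def deriv_at_zero_def f flip: add.assoc)
qed

lemma frame_apply:
  assumes "X \<in> vector_fields A" "smooth_fun A f"
  shows "X f = (\<Sum>b\<in>Basis. frame_coeff b X * left_frame b f)"
  using point_derivation_frame[OF vf_point_derivation[OF assms(1)] assms(2)]
  by (simp add: fun_eq_iff frame_coeff_def sum_fun_apply)

lemma frame_expansion:
  assumes "X \<in> vector_fields A"
  shows "X = (\<Sum>b\<in>Basis. fscale (frame_coeff b X) (left_frame b))"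
proof
  fix f
  show "X f = (\<Sum>b\<in>Basis. fscale (frame_coeff b X) (left_frame b)) f"
    using frame_apply[OF assms, of f] vf_nonsmooth[OF assms, of f]
    by (cases "smooth_fun A f") (auto simp: sum_fun_apply fscale_def left_frame_def)
qed

text \<open>
  The function to which \<open>X\<close> is applied in \<open>frame_coeff b X x\<close> varies with \<open>x\<close>, so smoothness is not
  immediate. Near a point, \<open>X\<close> is expanded in the coordinates of a chart there. Its coefficients \<open>X (\<eta> i)\<close>
  do not depend on \<open>x\<close>, and they are multiplied by partial derivatives of the smooth function
  \<open>(s, t) \<mapsto> \<xi> b (- s + t)\<close> on the diagonal \<open>s = t\<close>.
\<close>

lemma frame_coeff_smooth:
  assumes X: "X \<in> vector_fields A"
  shows "smooth_fun A (frame_coeff b X)"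
proof (rule smooth_fun_localI)
  fix p
  obtain V \<psi> where V: "(V, \<psi>) \<in> A" "p \<in> V" by (rule chart_at)
  obtain \<eta> :: "'e \<Rightarrow> 'g \<Rightarrow> real" and M where M: "open M" "p \<in> M" "M \<subseteq> V"
    and \<eta>: "\<And>i. smooth_fun A (\<eta> i)" "\<And>i q. q \<in> M \<Longrightarrow> \<eta> i q = \<psi> q \<bullet> i"
    using chart_coordinates[OF V] by metis
  let ?c = "inv_into V \<psi>"
  note c = smooth_param_chart[OF V(1)] and o = chart_open_image[OF V(1)]
  define F where "F z = \<xi> b (- ?c (fst z) + ?c (snd z))" for z
  have oo: "open (\<psi> ` V \<times> \<psi> ` V)" by (intro open_Times o)
  have "smooth_param (\<lambda>z. ?c (fst z)) (\<psi> ` V \<times> \<psi> ` V)" "smooth_param (\<lambda>z. ?c (snd z)) (\<psi> ` V \<times> \<psi> ` V)"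
    by (rule smooth_param_compose[OF c oo o], auto intro: smooth_on_projections oo)+
  then have F: "smooth_on F (\<psi> ` V \<times> \<psi> ` V)"
    unfolding F_def by (intro smooth_fun_param[OF \<xi>(1)] smooth_param_add smooth_param_uminus oo)
  define W where "W = \<psi> ` V \<inter> ?c -` M"
  have W: "open W" unfolding W_def by (rule smooth_param_open[OF c o M(1)])
  have "smooth_on (\<lambda>y. \<Sum>i\<in>Basis. X (\<eta> i) (?c y) * frechet_derivative F (at (y, y)) (0, i)) W"
  proof (intro smooth_on_sum smooth_on_mult W)
    fix i
    show "smooth_on (\<lambda>y. X (\<eta> i) (?c y)) W"
      by (rule smooth_on_subset[OF smooth_funD[OF vf_smooth[OF X \<eta>(1)] V(1)]]) (simp add: W_def)
    show "smooth_on (\<lambda>y. frechet_derivative F (at (y, y)) (0, i)) W"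
      by (rule smooth_on_compose[OF W oo _ smooth_on_frechet[OF F]])
        (intro smooth_on_Pair smooth_on_ident W, auto simp: W_def)
  qed
  then have "smooth_on (\<lambda>y. frame_coeff b X (?c y)) W"
  proof (rule smooth_on_cong[OF W, rotated])
    fix y assume y: "y \<in> W"
    then have q: "?c y \<in> M" "?c y \<in> V" "y \<in> \<psi> ` V" "\<psi> (?c y) = y"
      using M chart_image_inv[OF V(1)] by (auto simp: W_def)
    have "frame_coeff b X (?c y) = (\<Sum>i\<in>Basis. X (\<eta> i) (?c y) *
        frechet_derivative (\<lambda>t. \<xi> b (- ?c y + ?c t)) (at (\<psi> (?c y))) i)"
      unfolding frame_coeff_def
      by (rule point_derivation_coordinates[OF V(1) q(2) vf_point_derivation[OF X] M(1) q(1) \<eta>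
            smooth_fun_left[OF \<xi>(1)]])
    then show "(\<Sum>i\<in>Basis. X (\<eta> i) (?c y) * frechet_derivative F (at (y, y)) (0, i)) = frame_coeff b X (?c y)"
      using partial_derivatives(2)[OF F q(3) q(3)] by (simp add: q(4) F_def)
  qed
  moreover have "\<psi> p \<in> W" "W \<subseteq> \<psi> ` V" using V M chart_inv[OF V(1)] by (simp_all add: W_def)
  ultimately show "\<exists>V \<psi> W. (V, \<psi>) \<in> A \<and> p \<in> V \<and> open W \<and> \<psi> p \<in> W \<and> W \<subseteq> \<psi> ` V \<and>
      smooth_on (\<lambda>y. frame_coeff b X (inv_into V \<psi> y)) W"
    using V W by (intro exI[of _ V] exI[of _ \<psi>] exI[of _ W] conjI)
qed

lemma deriv_at_zero_coordinate:
  assumes "b \<in> Basis" "c \<in> Basis"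
  shows "deriv_at_zero c (\<xi> b) = (if b = c then 1 else 0)"
proof -
  have o: "open (\<phi> ` U \<inter> \<theta> -` N)" by (rule smooth_param_open[OF \<theta> open_chart N(1)])
  have m: "e0 \<in> \<phi> ` U \<inter> \<theta> -` N" using e0 N by simp
  have "frechet_derivative (\<lambda>v. \<xi> b (\<theta> v)) (at e0) = frechet_derivative (\<lambda>v. v \<bullet> b) (at e0)"
    by (rule frechet_derivative_cong_open[OF o m]) (simp add: \<xi>(2) chart_image_inv[OF U])
  also have "\<dots> = (\<lambda>v. v \<bullet> b)"
    by (rule frechet_derivative_at[symmetric]) (auto intro!: derivative_eq_intros)
  finally show ?thesis using assms by (simp add: deriv_at_zero_def inner_Basis)
qed

lemma left_frame_coordinate:
  assumes "b \<in> Basis" "c \<in> Basis"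
  shows "left_frame c (\<lambda>y. \<xi> b (- x + y)) x = (if b = c then 1 else 0)"
  using deriv_at_zero_coordinate[OF assms] smooth_fun_left[OF \<xi>(1)] by (simp add: left_frame_def flip: add.assoc)

lemma frame_coeff_left_frame:
  assumes "b \<in> Basis" "c \<in> Basis"
  shows "frame_coeff b (left_frame c) = (if b = c then 1 else 0)"
  using left_frame_coordinate[OF assms] by (simp add: frame_coeff_def fun_eq_iff)

lemma frame_coeff_plus: "frame_coeff b (X + Y) = frame_coeff b X + frame_coeff b Y"
  by (simp add: frame_coeff_def fun_eq_iff)

lemma frame_coeff_minus: "frame_coeff b (X - Y) = frame_coeff b X - frame_coeff b Y"
  by (simp add: frame_coeff_def fun_eq_iff)

lemma frame_coeff_fscale: "frame_coeff b (fscale h X) = h * frame_coeff b X"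
  by (simp add: frame_coeff_def fscale_def fun_eq_iff)

lemma frame_coeff_sum: "frame_coeff b (\<Sum>i\<in>I. X i) = (\<Sum>i\<in>I. frame_coeff b (X i))"
  by (simp add: frame_coeff_def fun_eq_iff sum_fun_apply)

text \<open>
  Left and right translations commute: both orders of differentiation yield mixed second derivatives
  of \<open>f (y + x + z)\<close> at \<open>y = z = 0\<close>.
\<close>

lemma right_left_frame_commute: "lie_bracket (right_frame b) (left_frame c) = 0"
proof (rule ext, rule ext)
  fix f x
  show "lie_bracket (right_frame b) (left_frame c) f x = 0 f x"
  proof (cases "smooth_fun A f")
    case f: True
    define F where "F z = f (\<theta> (fst z) + x + \<theta> (snd z))" for z
    have o: "open (\<phi> ` U \<times> \<phi> ` U)" by (intro open_Times open_chart)
    have F: "smooth_on F (\<phi> ` U \<times> \<phi> ` U)"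
      unfolding F_def
      by (intro smooth_fun_param[OF f] smooth_param_add smooth_param_const o \<theta>_fst \<theta>_snd open_chart)
    have "right_frame b (left_frame c f) x = frechet_derivative (\<lambda>s. frechet_derivative (\<lambda>t. F (s, t)) (at e0) c) (at e0) b"
      using f vf_smooth[OF frame_vector_fields(1) f] by (simp add: right_frame_def left_frame_def deriv_at_zero_def F_def)
    also have "\<dots> = frechet_derivative (\<lambda>t. frechet_derivative (\<lambda>s. F (s, t)) (at e0) b) (at e0) c"
      by (rule mixed_partials_commute[OF F open_chart open_chart e0(1) e0(1)])
    also have "\<dots> = left_frame c (right_frame b f) x"
      using f vf_smooth[OF frame_vector_fields(2) f] by (simp add: right_frame_def left_frame_def deriv_at_zero_def F_def add.assoc)
    finally show ?thesis by (simp add: lie_bracket_def)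
  next
    case False
    then show ?thesis by (simp add: lie_bracket_def vf_nonsmooth[OF vf_bracket] vf_nonsmooth frame_vector_fields vf_const zero_fun_def)
  qed
qed

text \<open>
  All directional derivatives of \<open>u\<close> vanish, since they are combinations of the values of the frame.
  So \<open>u\<close> is locally constant.
\<close>

lemma constant_if_left_frame_vanishes:
  assumes u: "smooth_fun A u" and vanish: "\<And>b. b \<in> Basis \<Longrightarrow> left_frame b u = 0" and conn: "connected (UNIV :: 'g set)"
  shows "u x = u y"
proof (rule connected_local_const[OF conn UNIV_I UNIV_I], rule ballI)
  fix p
  obtain V \<psi> where V: "(V, \<psi>) \<in> A" "p \<in> V" by (rule chart_at)
  let ?c = "inv_into V \<psi>"
  obtain R where R: "R > 0" "ball (\<psi> p) R \<subseteq> \<psi> ` V"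
    by (rule openE[OF chart_open_image[OF V(1)] imageI[OF V(2)]])
  have zero: "((\<lambda>t. u (?c t)) has_derivative (\<lambda>h. 0)) (at y)" if y: "y \<in> \<psi> ` V" for y
  proof -
    have "frechet_derivative (\<lambda>t. u (?c t)) (at y) v = 0" for v
      using point_derivation_frame[OF point_derivation_directional[OF smooth_param_chart[OF V(1)]
            chart_open_image[OF V(1)] y] u] vanish by simp
    then have "frechet_derivative (\<lambda>t. u (?c t)) (at y) = (\<lambda>h. 0)" by (rule ext)
    then show ?thesis
      using smooth_on_has_derivative[OF smooth_funD[OF u V(1)] y] by simp
  qed
  obtain k where k: "\<forall>y\<in>ball (\<psi> p) R. u (?c y) = k"
    using has_derivative_zero_constant[OF convex_ball, of "\<psi> p" R "\<lambda>t. u (?c t)"] zero R(2)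
    by (meson has_derivative_at_withinI subsetD)
  have "u q = u p" if "q \<in> {q \<in> V. \<psi> q \<in> ball (\<psi> p) R}" for q
    using that k V R(1) chart_inv[OF V(1)] by (metis (mono_tags, lifting) centre_in_ball mem_Collect_eq)
  moreover have "eventually (\<lambda>q. q \<in> {q \<in> V. \<psi> q \<in> ball (\<psi> p) R}) (at p)"
    by (rule eventually_at_in_open') (use V R(1) chart_preimage_open[OF V(1) open_ball] in auto)
  ultimately show "eventually (\<lambda>q. u p = u q) (at p within UNIV)"
    by (simp add: eventually_mono)
qed

text \<open>
  Let \<open>h c\<close> be the coefficients of \<open>right_frame b\<close>. As the left frame commutes with \<open>right_frame b\<close> and with
  itself, the bracket of \<open>right_frame b\<close> with \<open>left_frame d\<close> is, up to sign, the field with the coefficients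
  \<open>left_frame d (h c)\<close>. Hence these vanish and the \<open>h c\<close> are constant.
\<close>

lemma right_frame_eq_left_frame:
  assumes abelian: "\<And>b c. b \<in> Basis \<Longrightarrow> c \<in> Basis \<Longrightarrow> lie_bracket (left_frame b) (left_frame c) = 0"
    and conn: "connected (UNIV :: 'g set)" and b: "b \<in> Basis"
  shows "right_frame b = left_frame b"
proof -
  note lfv = frame_vector_fields(1)
  define h where "h c = frame_coeff c (right_frame b)" for c
  have h: "smooth_fun A (h c)" for c unfolding h_def by (rule frame_coeff_smooth[OF frame_vector_fields(2)])
  have expand: "right_frame b f = (\<Sum>c\<in>Basis. h c * left_frame c f)" if "smooth_fun A f" for f
    unfolding h_def by (rule frame_apply[OF frame_vector_fields(2) that])
  have swap: "left_frame d (left_frame c f) = left_frame c (left_frame d f)" if "c \<in> Basis" "d \<in> Basis" for c d f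
    using abelian[OF that] by (simp add: lie_bracket_def fun_eq_iff)
  have key: "(\<Sum>c\<in>Basis. left_frame c f x * left_frame d (h c) x) = 0" if f: "smooth_fun A f" and d: "d \<in> Basis" for f d x
  proof -
    have "right_frame b (left_frame d f) x = left_frame d (right_frame b f) x"
      using right_left_frame_commute[of b d] by (simp add: lie_bracket_def fun_eq_iff)
    moreover have "right_frame b (left_frame d f) x = (\<Sum>c\<in>Basis. h c x * left_frame c (left_frame d f) x)"
      by (simp add: expand[OF vf_smooth[OF lfv f]] sum_fun_apply)
    moreover have "left_frame d (right_frame b f) x = (\<Sum>c\<in>Basis. left_frame d (\<lambda>y. h c y * left_frame c f y) x)"
    proof -
      have "right_frame b f = (\<lambda>y. \<Sum>c\<in>Basis. h c y * left_frame c f y)"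
        by (simp add: expand[OF f] sum_fun_apply fun_eq_iff)
      then show ?thesis
        by (simp only:) (rule point_derivation_sum[OF vf_point_derivation[OF lfv] smooth_fun_mult[OF h vf_smooth[OF lfv f]]])
    qed
    moreover have "left_frame d (\<lambda>y. h c y * left_frame c f y) x = h c x * left_frame c (left_frame d f) x + left_frame c f x * left_frame d (h c) x"
      if "c \<in> Basis" for c
      using point_derivationD(3)[OF vf_point_derivation[OF lfv[of d], of x] h[of c] vf_smooth[OF lfv[of c] f]]
        swap[OF that d]
      by simp
    ultimately show ?thesis by (simp add: sum.distrib)
  qed
  have "left_frame d (h e) = 0" if d: "d \<in> Basis" and e: "e \<in> Basis" for d e
  proof
    fix x
    \<comment> \<open>Testing the vanishing field on the translated coordinate \<open>\<xi> e\<close> isolates one coefficient.\<close>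
    have "(\<Sum>c\<in>Basis. left_frame c (\<lambda>y. \<xi> e (- x + y)) x * left_frame d (h c) x) = (\<Sum>c\<in>Basis. (if c = e then left_frame d (h c) x else 0))"
      by (rule sum.cong) (auto simp: left_frame_coordinate[OF e])
    then show "left_frame d (h e) x = 0 x"
      using key[OF smooth_fun_left[OF \<xi>(1)[of e], of "- x"] d] e by simp
  qed
  then have "h c x = h c 0" if "c \<in> Basis" for c x
    using constant_if_left_frame_vanishes[OF h _ conn] that by blast
  moreover have "h c 0 = (if c = b then 1 else 0)" if "c \<in> Basis" for c
    using deriv_at_zero_coordinate[OF that b] \<xi>(1) by (simp add: h_def frame_coeff_def right_frame_def)
  ultimately have hc: "h c x = (if c = b then 1 else 0)" if "c \<in> Basis" for c x
    using that by simp
  show ?thesis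
  proof (rule ext, rule ext)
    fix f x
    show "right_frame b f x = left_frame b f x"
    proof (cases "smooth_fun A f")
      case True
      have "right_frame b f x = (\<Sum>c\<in>Basis. h c x * left_frame c f x)"
        by (simp add: expand[OF True] sum_fun_apply)
      also have "\<dots> = (\<Sum>c\<in>Basis. if c = b then left_frame c f x else 0)"
        by (rule sum.cong) (auto simp: hc)
      finally show ?thesis using b by simp
    qed (simp add: right_frame_def left_frame_def)
  qed
qed

text \<open>
  Differentiating \<open>f (x + a - x)\<close> by \<open>left_frame b\<close> amounts to differentiating \<open>k (y + a - y)\<close> at \<open>y = 0\<close>,
  where \<open>k z = f (x + z - x)\<close>. The first occurrence of \<open>y\<close> contributes \<open>right_frame b k a\<close>, the second one \<open>- left_frame b k a\<close>, so the two cancel.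
\<close>

lemma commutative_if_frames_agree:
  assumes eq: "\<And>b. b \<in> Basis \<Longrightarrow> right_frame b = left_frame b" and conn: "connected (UNIV :: 'g set)"
  shows "x + a = a + (x :: 'g)"
proof -
  have inv: "f (x + a - x) = f a" if f: "smooth_fun A f" for f
  proof -
    define u where "u x = f (x + a - x)" for x
    have u: "smooth_fun A u"
      unfolding u_def
      by (rule smooth_fun_comp[OF f]) (intro smooth_param_add smooth_param_minus smooth_param_const)
    have "left_frame b u = 0" if b: "b \<in> Basis" for b
    proof
      fix x
      define k where "k z = f (x + z - x)" for z
      have k: "smooth_fun A k"
        unfolding k_def
        by (rule smooth_fun_comp[OF f]) (intro smooth_param_add smooth_param_minus smooth_param_const)
      define F where "F z = k (\<theta> (fst z) + a - \<theta> (snd z))" for z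
      \<comment> \<open>As \<open>k (a + y - y)\<close> is constant, the derivative of \<open>k (a - y)\<close> is minus that of \<open>k (a + y)\<close>.\<close>
      define G where "G z = k (a + \<theta> (fst z) - \<theta> (snd z))" for z
      have o: "open (\<phi> ` U \<times> \<phi> ` U)" by (intro open_Times open_chart)
      have F: "smooth_on F (\<phi> ` U \<times> \<phi> ` U)" and G: "smooth_on G (\<phi> ` U \<times> \<phi> ` U)"
        unfolding F_def G_def
        by (intro smooth_fun_param[OF k] smooth_param_add smooth_param_minus smooth_param_const o
            \<theta>_fst \<theta>_snd open_chart)+
      have "left_frame b u x = deriv_at_zero b (\<lambda>y. k (y + a - y))"
        using u by (simp add: left_frame_def u_def k_def add.assoc diff_conv_add_uminus minus_add del: add_uminus_conv_diff)
      also have "\<dots> = deriv_at_zero b (\<lambda>y. k (y + a)) + deriv_at_zero b (\<lambda>y. k (a - y))"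
        using derivative_along_diagonal[OF F e0(1), of b] e0(2) by (simp add: F_def deriv_at_zero_def)
      also have "deriv_at_zero b (\<lambda>y. k (y + a)) = deriv_at_zero b (\<lambda>y. k (a + y))"
        using fun_cong[OF fun_cong[OF eq[OF b]], of k a] k by (simp add: right_frame_def left_frame_def)
      also have "deriv_at_zero b (\<lambda>y. k (a + y)) + deriv_at_zero b (\<lambda>y. k (a - y)) = 0"
        using derivative_along_diagonal[OF G e0(1), of b] e0(2)
        by (simp add: G_def deriv_at_zero_def frechet_derivative_const)
      finally show "left_frame b u x = 0 x" by simp
    qed
    from constant_if_left_frame_vanishes[OF u this conn, of x 0] show ?thesis by (simp add: u_def)
  qed
  have "x + a - x = a"
  proof (rule ccontr)
    assume "x + a - x \<noteq> a"
    then obtain f where f: "smooth_fun A f" "f a = 1" "\<And>q. q \<notin> - {x + a - x} \<Longrightarrow> f q = 0"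
      using bump_function[of "- {x + a - x}" a] by auto
    then show False using inv[OF f(1)] by simp
  qed
  then show ?thesis by (simp add: diff_eq_eq)
qed

end

section \<open>The flat connection of a commutative group\<close>

locale lie_hermitian_chart = lie_group_chart A U \<phi> \<xi> N
  for A :: "('g::{topological_group_add, t2_space, second_countable_topology}, 'e::euclidean_space) atlas"
    and U \<phi> \<xi> N +
  fixes J :: "'g vfield \<Rightarrow> 'g vfield" and g :: "'g vfield \<Rightarrow> 'g vfield \<Rightarrow> 'g \<Rightarrow> real"
  assumes lie_hermitian: "lie_hermitian A J g"
begin

lemma connected_group: "connected (UNIV :: 'g set)"
  and metric: "riemannian_metric A g" and complex: "complex_structure A J"
  and J_isometry: "\<And>X Y. X \<in> vector_fields A \<Longrightarrow> Y \<in> vector_fields A \<Longrightarrow> g (J X) (J Y) = g X Y"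
  and J_left_invariant: "left_invariant_endomorphism A J"
  and g_left_invariant: "left_invariant_metric A g"
  using lie_hermitian unfolding lie_hermitian_def hermitian_def by blast+

lemma g_sym: "X \<in> vector_fields A \<Longrightarrow> Y \<in> vector_fields A \<Longrightarrow> g X Y = g Y X"
  and g_plus_left: "X \<in> vector_fields A \<Longrightarrow> Y \<in> vector_fields A \<Longrightarrow> Z \<in> vector_fields A \<Longrightarrow> g (X + Y) Z = g X Z + g Y Z"
  and g_fscale_left: "smooth_fun A f \<Longrightarrow> X \<in> vector_fields A \<Longrightarrow> Y \<in> vector_fields A \<Longrightarrow> g (fscale f X) Y = f * g X Y"
  and g_pos: "X \<in> vector_fields A \<Longrightarrow> X f p \<noteq> 0 \<Longrightarrow> g X X p > 0"
  using metric unfolding riemannian_metric_def by blast+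

lemma g_zero_left: "Y \<in> vector_fields A \<Longrightarrow> g 0 Y = 0"
  using g_plus_left[OF vf_zero vf_zero, of Y] by simp

lemma g_plus_right: "X \<in> vector_fields A \<Longrightarrow> Y \<in> vector_fields A \<Longrightarrow> Z \<in> vector_fields A \<Longrightarrow> g X (Y + Z) = g X Y + g X Z"
  using g_plus_left[of Y Z X] g_sym[of X] by (simp add: vf_plus)

lemma g_uminus_left: "X \<in> vector_fields A \<Longrightarrow> Y \<in> vector_fields A \<Longrightarrow> g (- X) Y = - g X Y"
  using g_plus_left[of X "- X" Y] g_zero_left[of Y] by (simp add: vf_uminus eq_neg_iff_add_eq_0 add.commute)

lemma g_uminus_right: "X \<in> vector_fields A \<Longrightarrow> Y \<in> vector_fields A \<Longrightarrow> g X (- Y) = - g X Y"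
  using g_uminus_left[of Y X] g_sym[of X] by (simp add: vf_uminus)

lemma g_minus_left: "X \<in> vector_fields A \<Longrightarrow> Y \<in> vector_fields A \<Longrightarrow> Z \<in> vector_fields A \<Longrightarrow> g (X - Y) Z = g X Z - g Y Z"
  using g_plus_left[of X "- Y" Z] by (simp add: vf_uminus g_uminus_left)

lemma g_minus_right: "X \<in> vector_fields A \<Longrightarrow> Y \<in> vector_fields A \<Longrightarrow> Z \<in> vector_fields A \<Longrightarrow> g X (Y - Z) = g X Y - g X Z"
  using g_minus_left[of Y Z X] g_sym[of X] by (simp add: vf_minus)

lemma g_sum_left:
  "(\<And>i. i \<in> I \<Longrightarrow> X i \<in> vector_fields A) \<Longrightarrow> Y \<in> vector_fields A \<Longrightarrow> g (\<Sum>i\<in>I. X i) Y = (\<Sum>i\<in>I. g (X i) Y)"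
  by (induction I rule: infinite_finite_induct) (auto simp: g_zero_left g_plus_left vf_sum)

lemma g_frame_left:
  assumes X: "X \<in> vector_fields A" and Y: "Y \<in> vector_fields A"
  shows "g X Y = (\<Sum>b\<in>Basis. frame_coeff b X * g (left_frame b) Y)"
proof -
  have "g X Y = g (\<Sum>b\<in>Basis. fscale (frame_coeff b X) (left_frame b)) Y"
    using frame_expansion[OF X] by simp
  also have "\<dots> = (\<Sum>b\<in>Basis. g (fscale (frame_coeff b X) (left_frame b)) Y)"
    by (intro g_sum_left vf_fscale frame_coeff_smooth X Y frame_vector_fields)
  finally show ?thesis
    using g_fscale_left[OF frame_coeff_smooth[OF X] frame_vector_fields(1) Y] by simp
qed

lemma g_left_invariant_const:
  assumes "X \<in> left_invariant_fields A" "Y \<in> left_invariant_fields A"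
  shows "g X Y p = g X Y 0"
proof -
  have "g (left_translate p X) (left_translate p Y) (p + 0) = g X Y 0"
    using g_left_invariant left_invariant_fieldsD(1)[OF assms(1)] left_invariant_fieldsD(1)[OF assms(2)]
    unfolding left_invariant_metric_def by blast
  then show ?thesis using left_invariant_fieldsD(2) assms by simp
qed

text \<open>
  The metric coefficients of a left invariant frame are constant, so the metric is a fixed bilinear
  form in the frame coefficients.
\<close>

lemma metric_frame:
  assumes X: "X \<in> vector_fields A" and Y: "Y \<in> vector_fields A"
  shows "g X Y = (\<lambda>p. \<Sum>b\<in>Basis. \<Sum>c\<in>Basis. g (left_frame b) (left_frame c) 0 * (frame_coeff b X p * frame_coeff c Y p))"
proof
  fix p
  note fr = frame_vector_fields(1)
  have const: "g (left_frame c) (left_frame b) p = g (left_frame b) (left_frame c) 0" for b c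
    by (rule trans[OF fun_cong[OF g_sym[OF fr fr]] g_left_invariant_const[OF left_frame_left_invariant left_frame_left_invariant]])
  have "g (left_frame b) Y p = (\<Sum>c\<in>Basis. frame_coeff c Y p * g (left_frame b) (left_frame c) 0)" for b
  proof -
    have "g (left_frame b) Y p = g Y (left_frame b) p" by (rule fun_cong[OF g_sym[OF fr Y]])
    also have "\<dots> = (\<Sum>c\<in>Basis. frame_coeff c Y p * g (left_frame c) (left_frame b) p)"
      by (simp add: g_frame_left[OF Y fr] sum_fun_apply)
    finally show ?thesis by (simp only: const)
  qed
  then show "g X Y p = (\<Sum>b\<in>Basis. \<Sum>c\<in>Basis. g (left_frame b) (left_frame c) 0 * (frame_coeff b X p * frame_coeff c Y p))"
    by (simp add: g_frame_left[OF X Y] sum_fun_apply sum_distrib_left mult_ac)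
qed

lemma field_eqI:
  assumes X: "X \<in> vector_fields A" and Y: "Y \<in> vector_fields A" and "\<And>b. b \<in> Basis \<Longrightarrow> frame_coeff b X = frame_coeff b Y"
  shows "X = Y"
proof -
  have "(\<Sum>b\<in>Basis. fscale (frame_coeff b X) (left_frame b)) = (\<Sum>b\<in>Basis. fscale (frame_coeff b Y) (left_frame b))"
    by (rule sum.cong) (simp_all add: assms(3))
  then show ?thesis using frame_expansion[OF X] frame_expansion[OF Y] by simp
qed

text \<open>
  The connection for which the left invariant frame is parallel.
\<close>

definition flat_connection :: "'g connection" where
  "flat_connection X Y = (\<Sum>b\<in>Basis. fscale (X (frame_coeff b Y)) (left_frame b))"

lemma flat_vf: "X \<in> vector_fields A \<Longrightarrow> Y \<in> vector_fields A \<Longrightarrow> flat_connection X Y \<in> vector_fields A"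
  unfolding flat_connection_def by (rule vf_sum) (rule vf_fscale[OF vf_smooth[OF _ frame_coeff_smooth] frame_vector_fields(1)])

lemma frame_coeff_flat:
  assumes "b \<in> Basis"
  shows "frame_coeff b (flat_connection X Y) = X (frame_coeff b Y)"
proof -
  have "frame_coeff b (flat_connection X Y) = (\<Sum>c\<in>Basis. X (frame_coeff c Y) * frame_coeff b (left_frame c))"
    by (simp add: flat_connection_def frame_coeff_sum frame_coeff_fscale)
  also have "\<dots> = (\<Sum>c\<in>Basis. if b = c then X (frame_coeff c Y) else 0)"
    by (rule sum.cong) (auto simp: frame_coeff_left_frame[OF assms])
  finally show ?thesis using assms by simp
qed

lemma flat_affine_connection: "affine_connection A flat_connection"
  unfolding affine_connection_def
proof (intro conjI ballI allI impI)
  fix X Y assume X: "X \<in> vector_fields A" and Y: "Y \<in> vector_fields A"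
  show "flat_connection X Y \<in> vector_fields A" by (rule flat_vf[OF X Y])
  fix Z assume Z: "Z \<in> vector_fields A"
  show "flat_connection (X + Y) Z = flat_connection X Z + flat_connection Y Z"
    by (rule field_eqI) (simp_all add: flat_vf X Y Z vf_plus frame_coeff_flat frame_coeff_plus fun_eq_iff)
  show "flat_connection X (Y + Z) = flat_connection X Y + flat_connection X Z"
    by (rule field_eqI) (simp_all add: flat_vf X Y Z vf_plus frame_coeff_flat frame_coeff_plus vf_add frame_coeff_smooth fun_eq_iff)
next
  fix f X Y assume f: "smooth_fun A f" and X: "X \<in> vector_fields A" and Y: "Y \<in> vector_fields A"
  show "flat_connection (fscale f X) Y = fscale f (flat_connection X Y)"
    by (rule field_eqI) (simp_all add: flat_vf f X Y vf_fscale frame_coeff_flat frame_coeff_fscale, simp add: fscale_def fun_eq_iff)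
  show "flat_connection X (fscale f Y) = fscale (X f) Y + fscale f (flat_connection X Y)"
    by (rule field_eqI)
      (simp_all add: flat_vf f X Y vf_fscale vf_plus vf_smooth frame_coeff_flat frame_coeff_plus frame_coeff_fscale vf_mult frame_coeff_smooth fun_eq_iff)
qed

lemma flat_metric:
  assumes X: "X \<in> vector_fields A" and Y: "Y \<in> vector_fields A" and Z: "Z \<in> vector_fields A"
  shows "X (g Y Z) = g (flat_connection X Y) Z + g Y (flat_connection X Z)"
proof
  fix p
  note d = vf_point_derivation[OF X, of p]
  have s: "smooth_fun A (\<lambda>p. frame_coeff b Y p * frame_coeff c Z p)" for b c
    by (intro smooth_fun_mult frame_coeff_smooth Y Z)
  have "X (g Y Z) p = (\<Sum>b\<in>Basis. \<Sum>c\<in>Basis. X (\<lambda>p. g (left_frame b) (left_frame c) 0 * (frame_coeff b Y p * frame_coeff c Z p)) p)"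
    unfolding metric_frame[OF Y Z]
    by (simp add: point_derivation_sum[OF d] smooth_fun_sum smooth_fun_mult smooth_fun_const s)
  also have "\<dots> = (\<Sum>b\<in>Basis. \<Sum>c\<in>Basis. g (left_frame b) (left_frame c) 0 * (frame_coeff b Y p * X (frame_coeff c Z) p + frame_coeff c Z p * X (frame_coeff b Y) p))"
    by (simp add: point_derivationD(2)[OF d s s] point_derivationD(3)[OF d frame_coeff_smooth[OF Y] frame_coeff_smooth[OF Z]])
  also have "\<dots> = (g (flat_connection X Y) Z + g Y (flat_connection X Z)) p"
    by (simp add: metric_frame flat_vf X Y Z frame_coeff_flat algebra_simps sum.distrib)
  finally show "X (g Y Z) p = (g (flat_connection X Y) Z + g Y (flat_connection X Z)) p" .
qed

text \<open>
  The first derivatives of the coefficients of \<open>X\<close> and \<open>Y\<close> make up the two covariant derivatives. What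
  remains of \<open>X (Y f) - Y (X f)\<close> are second derivatives along the frame, which are symmetric.
\<close>

lemma flat_torsion_free:
  assumes abelian: "\<And>b c. b \<in> Basis \<Longrightarrow> c \<in> Basis \<Longrightarrow> lie_bracket (left_frame b) (left_frame c) = 0"
    and X: "X \<in> vector_fields A" and Y: "Y \<in> vector_fields A"
  shows "flat_connection X Y - flat_connection Y X = lie_bracket X Y"
proof (rule ext, rule ext)
  fix f p
  note lfv = frame_vector_fields(1)
  show "(flat_connection X Y - flat_connection Y X) f p = lie_bracket X Y f p"
  proof (cases "smooth_fun A f")
    case f: True
    \<comment> \<open>The second sum is symmetric in \<open>V\<close> and \<open>W\<close> when the frame commutes.\<close>
    have exp: "V (W f) p = flat_connection V W f p + (\<Sum>b\<in>Basis. \<Sum>c\<in>Basis. frame_coeff b W p * (frame_coeff c V p * left_frame c (left_frame b f) p))"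
      if V: "V \<in> vector_fields A" and W: "W \<in> vector_fields A" for V W
    proof -
      note d = vf_point_derivation[OF V, of p]
      have "W f = (\<lambda>q. \<Sum>b\<in>Basis. frame_coeff b W q * left_frame b f q)"
        by (simp add: frame_apply[OF W f] fun_eq_iff sum_fun_apply)
      then have "V (W f) p = (\<Sum>b\<in>Basis. V (\<lambda>q. frame_coeff b W q * left_frame b f q) p)"
        by (simp only: point_derivation_sum[OF d smooth_fun_mult[OF frame_coeff_smooth[OF W] vf_smooth[OF lfv f]]])
      also have "\<dots> = (\<Sum>b\<in>Basis. V (frame_coeff b W) p * left_frame b f p) + (\<Sum>b\<in>Basis. frame_coeff b W p * V (left_frame b f) p)"
        by (simp add: point_derivationD(3)[OF d frame_coeff_smooth[OF W] vf_smooth[OF lfv f]] sum.distrib mult.commute add.commute)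
      finally show ?thesis
        by (simp add: flat_connection_def fscale_def sum_fun_apply frame_apply[OF V vf_smooth[OF lfv f]] sum_distrib_left)
    qed
    have "left_frame c (left_frame b f) p = left_frame b (left_frame c f) p" if "b \<in> Basis" "c \<in> Basis" for b c
      using abelian[OF that] by (simp add: lie_bracket_def fun_eq_iff)
    then have "(\<Sum>b\<in>Basis. \<Sum>c\<in>Basis. frame_coeff b Y p * (frame_coeff c X p * left_frame c (left_frame b f) p)) =
        (\<Sum>b\<in>Basis. \<Sum>c\<in>Basis. frame_coeff c X p * (frame_coeff b Y p * left_frame b (left_frame c f) p))"
      by (intro sum.cong refl) (simp add: mult_ac)
    also have "\<dots> = (\<Sum>c\<in>Basis. \<Sum>b\<in>Basis. frame_coeff c X p * (frame_coeff b Y p * left_frame b (left_frame c f) p))"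
      by (rule sum.swap)
    finally show ?thesis
      using exp[OF X Y] exp[OF Y X] by (simp add: lie_bracket_def)
  next
    case False
    then show ?thesis by (simp add: vf_nonsmooth X Y flat_vf vf_bracket vf_minus)
  qed
qed

text \<open>
  On frame coefficients, covariant derivatives are derivatives of functions, so the curvature operator
  acts as \<open>X Y - Y X - [X, Y]\<close>, which is zero by the definition of the bracket.
\<close>

lemma flat_curvature:
  assumes X: "X \<in> vector_fields A" and Y: "Y \<in> vector_fields A" and Z: "Z \<in> vector_fields A" and W: "W \<in> vector_fields A"
  shows "curvature g flat_connection X Y Z W = 0"
proof -
  have "flat_connection X (flat_connection Y Z) - flat_connection Y (flat_connection X Z) - flat_connection (lie_bracket X Y) Z = 0"
    by (rule field_eqI)
      (simp_all add: flat_vf X Y Z vf_minus vf_bracket vf_zero frame_coeff_minus frame_coeff_flat, simp add: lie_bracket_def frame_coeff_def fun_eq_iff)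
  then show ?thesis by (simp only: curvature_def g_zero_left[OF W])
qed

lemma riemannian_kahler_like_if_commutative:
  assumes comm: "\<And>x y :: 'g. x + y = y + x"
  shows "riemannian_kahler_like A J g"
proof -
  have "right_frame b = left_frame b" for b by (simp add: right_frame_def left_frame_def comm fun_eq_iff)
  then have abelian: "lie_bracket (left_frame b) (left_frame c) = 0" for b c
    using right_left_frame_commute[of b c] by simp
  have "metric_connection A g flat_connection"
    unfolding metric_connection_def using flat_affine_connection flat_metric by blast
  moreover have "J X \<in> vector_fields A" if "X \<in> vector_fields A" for X
    using complex that unfolding complex_structure_def endomorphism_field_def by blast
  ultimately show ?thesis
    unfolding riemannian_kahler_like_def levi_civita_def kahler_like_def
    by (intro exI[of _ flat_connection]) (simp add: flat_torsion_free[OF abelian] flat_curvature)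
qed

end

section \<open>Central directions of a Kaehler-like metric\<close>

context lie_hermitian_chart
begin

abbreviation LI :: "'g vfield set" where "LI \<equiv> left_invariant_fields A"

lemma left_invariant_vf: "X \<in> LI \<Longrightarrow> X \<in> vector_fields A"
  by (rule left_invariant_fieldsD(1))

lemma LI_plus: "X \<in> LI \<Longrightarrow> Y \<in> LI \<Longrightarrow> X + Y \<in> LI"
  using vf_plus by (auto simp: left_invariant_fields_def left_translate_def fun_eq_iff)

lemma LI_uminus: "X \<in> LI \<Longrightarrow> - X \<in> LI"
  using vf_uminus by (auto simp: left_invariant_fields_def left_translate_def fun_eq_iff)

lemma LI_minus: "X \<in> LI \<Longrightarrow> Y \<in> LI \<Longrightarrow> X - Y \<in> LI"
  using LI_plus[of X "- Y"] LI_uminus[of Y] by simp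

lemma LI_zero: "0 \<in> LI"
  using vf_zero by (auto simp: left_invariant_fields_def left_translate_def fun_eq_iff)

lemma J_vf: "X \<in> vector_fields A \<Longrightarrow> J X \<in> vector_fields A"
  and J_plus: "X \<in> vector_fields A \<Longrightarrow> Y \<in> vector_fields A \<Longrightarrow> J (X + Y) = J X + J Y"
  and J_J: "X \<in> vector_fields A \<Longrightarrow> J (J X) = - X"
  and J_nijenhuis: "X \<in> vector_fields A \<Longrightarrow> Y \<in> vector_fields A \<Longrightarrow>
    lie_bracket (J X) (J Y) - J (lie_bracket (J X) Y) - J (lie_bracket X (J Y)) - lie_bracket X Y = 0"
  using complex unfolding complex_structure_def endomorphism_field_def nijenhuis_def by blast+

lemma LI_J: "X \<in> LI \<Longrightarrow> J X \<in> LI"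
proof -
  assume X: "X \<in> LI"
  have "left_translate a (J X) = J (left_translate a X)" for a
    using J_left_invariant left_invariant_vf[OF X] by (simp add: left_invariant_endomorphism_def)
  then show "J X \<in> LI"
    using X J_vf by (simp add: left_invariant_fields_def)
qed

lemma J_zero: "J 0 = 0"
  using J_plus[OF vf_zero vf_zero] by simp

lemma J_skew: "X \<in> vector_fields A \<Longrightarrow> Y \<in> vector_fields A \<Longrightarrow> g (J X) Y = - g X (J Y)"
  using J_isometry[of "J X" Y] by (simp add: J_vf J_J g_uminus_left)

lemma g_nonneg: 
  assumes "X \<in> LI"
  shows "0 \<le> g X X 0"
proof (cases "X = 0")
  case True
  then show ?thesis using g_zero_left[OF vf_zero] by simp
next
  case False
  then obtain f p where "X f p \<noteq> 0" by (auto simp: fun_eq_iff)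
  then show ?thesis
    using g_pos[OF left_invariant_vf[OF assms]] g_left_invariant_const[OF assms assms, of p] by fastforce
qed

lemma g_definite:
  assumes "X \<in> LI" "g X X 0 = 0"
  shows "X = 0"
proof (rule ccontr)
  assume "X \<noteq> 0"
  then obtain f p where "X f p \<noteq> 0" by (auto simp: fun_eq_iff)
  then show False
    using g_pos[OF left_invariant_vf[OF assms(1)]] g_left_invariant_const[OF assms(1) assms(1), of p] assms(2) by fastforce
qed

text \<open>
  The difference between \<open>W\<close> and its translate is orthogonal to the left invariant frame, hence to
  itself. This is how left invariance of covariant derivatives follows from Koszul's formula.
\<close>

lemma left_invariantI:
  assumes W: "W \<in> vector_fields A" and const: "\<And>b p. b \<in> Basis \<Longrightarrow> g W (left_frame b) p = g W (left_frame b) 0"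
  shows "W \<in> LI"
proof -
  have "left_translate a W = W" for a
  proof -
    define V where "V = left_translate a W - W"
    have V: "V \<in> vector_fields A" unfolding V_def by (intro vf_minus vf_left_translate W)
    have orth: "g V (left_frame b) = 0" if b: "b \<in> Basis" for b
    proof
      fix p
      have "g (left_translate a W) (left_translate a (left_frame b)) (a + (- a + p)) = g W (left_frame b) (- a + p)"
        using g_left_invariant W frame_vector_fields(1) unfolding left_invariant_metric_def by blast
      moreover have "g W (left_frame b) (- a + p) = g W (left_frame b) p"
        using const[OF b] by metis
      ultimately show "g V (left_frame b) p = 0 p"
        by (simp add: V_def g_minus_left vf_left_translate W frame_vector_fields
            left_invariant_fieldsD(2)[OF left_frame_left_invariant])
    qed
    have "g (left_frame b) V = 0" if "b \<in> Basis" for b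
      using orth[OF that] g_sym[OF V frame_vector_fields(1)[of b]] by simp
    then have "g V V = 0" by (simp add: g_frame_left[OF V V])
    then have "V f p = 0" for f p using g_pos[OF V, of f p] by fastforce
    then have "V = 0" by (simp add: fun_eq_iff)
    then show ?thesis by (simp add: V_def)
  qed
  then show ?thesis using W by (simp add: left_invariant_fields_def)
qed

lemma abelian_group_if_abelian_algebra:
  assumes "\<And>X Y. X \<in> LI \<Longrightarrow> Y \<in> LI \<Longrightarrow> lie_bracket X Y = 0"
  shows "x + a = a + (x :: 'g)"
  using commutative_if_frames_agree[OF right_frame_eq_left_frame connected_group]
    assms left_frame_left_invariant connected_group by blast

end

lemma lie_bracket_swap: "lie_bracket Y X = - lie_bracket X Y"
  by (simp add: lie_bracket_def fun_eq_iff)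

locale riemannian_kahler_like_group = lie_hermitian_chart A U \<phi> \<xi> N J g
  for A :: "('g::{topological_group_add, t2_space, second_countable_topology}, 'e::euclidean_space) atlas"
    and U \<phi> \<xi> N J g +
  fixes D :: "'g connection"
  assumes levi_civita: "levi_civita A g D" and kahler_like: "kahler_like A J g D"
begin

lemma D_vf: "X \<in> vector_fields A \<Longrightarrow> Y \<in> vector_fields A \<Longrightarrow> D X Y \<in> vector_fields A"
  and D_plus: "X \<in> vector_fields A \<Longrightarrow> Y \<in> vector_fields A \<Longrightarrow> Z \<in> vector_fields A \<Longrightarrow>
    D (X + Y) Z = D X Z + D Y Z \<and> D X (Y + Z) = D X Y + D X Z"
  and D_metric: "X \<in> vector_fields A \<Longrightarrow> Y \<in> vector_fields A \<Longrightarrow> Z \<in> vector_fields A \<Longrightarrow>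
    X (g Y Z) = g (D X Y) Z + g Y (D X Z)"
  and D_torsion: "X \<in> vector_fields A \<Longrightarrow> Y \<in> vector_fields A \<Longrightarrow> D X Y - D Y X = lie_bracket X Y"
  using levi_civita unfolding levi_civita_def metric_connection_def affine_connection_def by blast+

lemma bianchi: "X \<in> vector_fields A \<Longrightarrow> Y \<in> vector_fields A \<Longrightarrow> Z \<in> vector_fields A \<Longrightarrow> W \<in> vector_fields A \<Longrightarrow>
    curvature g D X Y Z W + curvature g D Y Z X W + curvature g D Z X Y W = 0"
  and curvature_J: "X \<in> vector_fields A \<Longrightarrow> Y \<in> vector_fields A \<Longrightarrow> Z \<in> vector_fields A \<Longrightarrow> W \<in> vector_fields A \<Longrightarrow>
    curvature g D X Y (J Z) (J W) = curvature g D X Y Z W"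
  using kahler_like unfolding kahler_like_def by blast+

lemma D_zero: "X \<in> vector_fields A \<Longrightarrow> D X 0 = 0" "X \<in> vector_fields A \<Longrightarrow> D 0 X = 0"
  using D_plus[OF _ vf_zero vf_zero, of X] D_plus[OF vf_zero vf_zero, of X] by auto

lemma D_skew:
  assumes "X \<in> vector_fields A" "Y \<in> LI" "Z \<in> LI"
  shows "g (D X Y) Z = - g Y (D X Z)"
proof -
  have "g Y Z = (\<lambda>p. g Y Z 0)" using g_left_invariant_const assms by blast
  then have "X (g Y Z) = 0" using vf_const[OF assms(1)] by metis
  with D_metric[OF assms(1)] show ?thesis
    by (simp add: left_invariant_vf assms eq_neg_iff_add_eq_0)
qed

definition central :: "'g vfield \<Rightarrow> bool" where
  "central Z \<longleftrightarrow> Z \<in> LI \<and> (\<forall>Y\<in>LI. lie_bracket Z Y = 0)"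

lemma centralD:
  assumes "central Z" "Y \<in> LI"
  shows "Z \<in> LI" "lie_bracket Z Y = 0" "lie_bracket Y Z = 0" "D Y Z = D Z Y"
proof -
  show Z: "Z \<in> LI" and 0: "lie_bracket Z Y = 0" using assms by (auto simp: central_def)
  then show "lie_bracket Y Z = 0" using lie_bracket_swap[of Y Z] by simp
  then show "D Y Z = D Z Y" using D_torsion[of Y Z] by (simp add: left_invariant_vf Z assms(2))
qed

text \<open>
  Koszul's formula, in which two of the three brackets vanish because \<open>Z\<close> is central.
\<close>

lemma D_central_koszul:
  assumes Z: "central Z" and X: "X \<in> LI" and Y: "Y \<in> LI"
  shows "2 * g (D X Z) Y p = - g (lie_bracket X Y) Z p"
proof -
  note v = left_invariant_vf[OF X] left_invariant_vf[OF Y] left_invariant_vf[OF centralD(1)[OF Z X]]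
  have "g (D X Z) Y p = - g (D X Y) Z p"
    using D_skew[OF v(1) centralD(1)[OF Z X] Y] g_sym[OF v(3) D_vf[OF v(1,2)]] by simp
  moreover have "g (D X Z) Y p = g (D Y X) Z p"
  proof -
    have "g (D X Z) Y = - g X (D Y Z)"
      using D_skew[OF v(3) X Y] by (simp add: centralD(4)[OF Z] X Y)
    also have "\<dots> = g (D Y X) Z"
      using D_skew[OF v(2) X centralD(1)[OF Z X]] by simp
    finally show ?thesis by simp
  qed
  moreover have "g (lie_bracket X Y) Z p = g (D X Y) Z p - g (D Y X) Z p"
    using g_minus_left[OF D_vf[OF v(1,2)] D_vf[OF v(2,1)] v(3)] D_torsion[OF v(1,2)] by simp
  ultimately show ?thesis by simp
qed

lemma D_central_LI:
  assumes Z: "central Z" and X: "X \<in> LI"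
  shows "D X Z \<in> LI"
proof (rule left_invariantI)
  show "D X Z \<in> vector_fields A" by (rule D_vf[OF left_invariant_vf[OF X] left_invariant_vf[OF centralD(1)[OF Z X]]])
  fix b p assume "b \<in> (Basis :: 'e set)"
  show "g (D X Z) (left_frame b) p = g (D X Z) (left_frame b) 0"
    using D_central_koszul[OF Z X left_frame_left_invariant[of b], of p] D_central_koszul[OF Z X left_frame_left_invariant[of b], of 0]
      g_left_invariant_const[OF left_invariant_bracket[OF X left_frame_left_invariant[of b]] centralD(1)[OF Z X], of p]
    by simp
qed

lemma D_central_skew:
  assumes Z: "central Z" and X: "X \<in> LI" and Y: "Y \<in> LI"
  shows "g (D X Z) Y p = - g X (D Y Z) p"
  using D_skew[OF left_invariant_vf[OF centralD(1)[OF Z X]] X Y] by (simp add: centralD(4)[OF Z] X Y)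

lemma D_central_self:
  assumes Z: "central Z"
  shows "D Z Z = 0"
proof (rule g_definite)
  have Zl: "Z \<in> LI" using Z by (simp add: central_def)
  show DZ: "D Z Z \<in> LI" by (rule D_central_LI[OF Z Zl])
  show "g (D Z Z) (D Z Z) 0 = 0"
    using D_central_koszul[OF Z Zl DZ, of 0] centralD(2)[OF Z DZ] g_zero_left[OF left_invariant_vf[OF Zl]] by simp
qed

text \<open>
  Only the second derivative \<open>D Z (D X Z)\<close> survives in the curvature, and \<open>D Z\<close> is skew, which gives a
  square of a norm.
\<close>

lemma sectional_curvature_central:
  assumes Z: "central Z" and X: "X \<in> LI"
  shows "curvature g D X Z Z X p = g (D X Z) (D X Z) p"
proof -
  note Zl = centralD(1)[OF Z X] and a = D_central_LI[OF Z X]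
  have "curvature g D X Z Z X = g (- D Z (D X Z)) X"
    by (simp add: curvature_def D_central_self[OF Z] D_zero centralD(3)[OF Z X] left_invariant_vf X Zl)
  also have "\<dots> = - g (D Z (D X Z)) X"
    by (intro g_uminus_left D_vf left_invariant_vf a X Zl)
  also have "\<dots> = g (D X Z) (D X Z)"
    using D_skew[OF left_invariant_vf[OF Zl] a X] centralD(4)[OF Z X] by simp
  finally show ?thesis by simp
qed

text \<open>
  Let \<open>a X = D X Z\<close> and \<open>b X = D X (J Z)\<close>. The Bianchi identity for \<open>Z\<close>, \<open>J Z\<close>, \<open>X\<close>, paired with \<open>J X\<close>, expresses the
  commutator of \<open>a\<close> and \<open>b\<close> through two sectional curvatures, which are \<open>|a X|\<^sup>2\<close> and \<open>|b X|\<^sup>2\<close>. Added to the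
  identity for \<open>J X\<close> it becomes a vanishing sum of two squares and yields \<open>b = a J\<close>. Together with
  \<open>b = J a\<close>, a consequence of the integrability of \<open>J\<close>, this makes \<open>b\<close> symmetric as well as skew.
\<close>

lemma central_pair_orthogonal_to_brackets:
  assumes Z: "central Z" and JZ: "central (J Z)" and X: "X \<in> LI" and Y: "Y \<in> LI"
  shows "g (lie_bracket X Y) Z p = 0"
proof -
  have Zl: "Z \<in> LI" "J Z \<in> LI" using Z JZ by (auto simp: central_def)
  define a where "a X = D X Z" for X
  define b where "b X = D X (J Z)" for X
  have a: "a X \<in> LI" and b: "b X \<in> LI" if "X \<in> LI" for X
    unfolding a_def b_def using D_central_LI Z JZ that by auto
  \<comment> \<open>The summands of the Bianchi identity are evaluated in 1, 3 and 2. The sign in 3 comes from \<open>J (J X) = - X\<close>.\<close>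
  have key: "g (a X) (a X) 0 + g (b X) (b X) 0 - g (b X) (a (J X)) 0 + g (a X) (b (J X)) 0 = 0"
    if X: "X \<in> LI" for X
  proof -
    note v = left_invariant_vf[OF X] left_invariant_vf[OF Zl(1)] left_invariant_vf[OF Zl(2)] left_invariant_vf[OF LI_J[OF X]]
    have "curvature g D Z (J Z) X (J X) = g (D Z (b X) - D (J Z) (a X)) (J X)"
      using D_zero(2)[OF v(1)] centralD(2)[OF Z Zl(2)] centralD(4)[OF Z X] centralD(4)[OF JZ X]
      by (simp add: curvature_def a_def b_def)
    also have "\<dots> = g (D Z (b X)) (J X) - g (D (J Z) (a X)) (J X)"
      by (intro g_minus_left D_vf v left_invariant_vf[OF a] left_invariant_vf[OF b] X)
    also have "\<dots> = g (a X) (b (J X)) - g (b X) (a (J X))"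
      using D_skew[OF v(2) b[OF X] LI_J[OF X]] D_skew[OF v(3) a[OF X] LI_J[OF X]]
        centralD(4)[OF Z LI_J[OF X]] centralD(4)[OF JZ LI_J[OF X]] by (simp add: a_def b_def)
    finally have 1: "curvature g D Z (J Z) X (J X) 0 = g (a X) (b (J X)) 0 - g (b X) (a (J X)) 0" by simp
    have 2: "curvature g D X Z (J Z) (J X) 0 = g (a X) (a X) 0"
      using curvature_J[OF v(1,2,2,1)] sectional_curvature_central[OF Z X] by (simp add: a_def)
    have 3: "curvature g D (J Z) X Z (J X) 0 = g (b X) (b X) 0"
    proof -
      have "curvature g D (J Z) X Z (J X) = curvature g D (J Z) X (J Z) (- X)"
        using curvature_J[OF v(3,1,2,4)] J_J[OF v(1)] by simp
      also have "\<dots> = g (D (J Z) (b X)) (- X)"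
        by (simp add: curvature_def D_central_self[OF JZ] D_zero v centralD(2)[OF JZ X] b_def)
      also have "\<dots> = g (b X) (b X)"
        using D_skew[OF v(3) b[OF X] X] centralD(4)[OF JZ X] g_uminus_right[OF D_vf[OF v(3) left_invariant_vf[OF b[OF X]]] v(1)]
        by (simp add: b_def)
      finally show ?thesis by simp
    qed
    show ?thesis using fun_cong[OF bianchi[OF v(2,3,1,4)], of 0] 1 2 3 by simp
  qed
  have g4: "g (P + Q) (P + Q) 0 = g P P 0 + 2 * g P Q 0 + g Q Q 0"
    and g5: "g (P - Q) (P - Q) 0 = g P P 0 - 2 * g P Q 0 + g Q Q 0" if "P \<in> LI" "Q \<in> LI" for P Q
    using left_invariant_vf[OF that(1)] left_invariant_vf[OF that(2)] g_sym[of P Q]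
    by (simp_all add: g_plus_left g_plus_right g_minus_left g_minus_right vf_plus vf_minus)
  have ab: "b X = a (J X)" "b (J X) = - a X" if X: "X \<in> LI" for X
  proof -
    note m = a[OF X] b[OF X] a[OF LI_J[OF X]] b[OF LI_J[OF X]]
    have vf: "a X \<in> vector_fields A" "b X \<in> vector_fields A" "a (J X) \<in> vector_fields A" "b (J X) \<in> vector_fields A"
      using m left_invariant_vf by auto
    have uminus: "a (- X) = - a X" "b (- X) = - b X"
      using D_plus[OF left_invariant_vf[OF X] vf_uminus[OF left_invariant_vf[OF X]] left_invariant_vf[OF Zl(1)]]
        D_plus[OF left_invariant_vf[OF X] vf_uminus[OF left_invariant_vf[OF X]] left_invariant_vf[OF Zl(2)]]
        D_zero(2)[OF left_invariant_vf[OF Zl(1)]] D_zero(2)[OF left_invariant_vf[OF Zl(2)]]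
      by (simp_all add: a_def b_def eq_neg_iff_add_eq_0 add.commute)
    \<comment> \<open>The identity \<open>key\<close> for \<open>J X\<close>. Its sum with \<open>key\<close> for \<open>X\<close> is a sum of two squares.\<close>
    have "g (a (J X)) (a (J X)) 0 + g (b (J X)) (b (J X)) 0 + g (b (J X)) (a X) 0 - g (a (J X)) (b X) 0 = 0"
      using key[OF LI_J[OF X]] J_J[OF left_invariant_vf[OF X]] g_uminus_right[OF vf(4,1)] g_uminus_right[OF vf(3,2)]
      by (simp add: uminus)
    with key[OF X] have "g (b X - a (J X)) (b X - a (J X)) 0 + g (a X + b (J X)) (a X + b (J X)) 0 = 0"
      using g4[OF m(1,4)] g5[OF m(2,3)] g_sym[OF vf(4,1)] g_sym[OF vf(3,2)] by simp
    then have "g (b X - a (J X)) (b X - a (J X)) 0 = 0" "g (a X + b (J X)) (a X + b (J X)) 0 = 0"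
      using g_nonneg[OF LI_minus[OF m(2,3)]] g_nonneg[OF LI_plus[OF m(1,4)]] by linarith+
    then have "b X - a (J X) = 0" "a X + b (J X) = 0"
      using g_definite[OF LI_minus[OF m(2,3)]] g_definite[OF LI_plus[OF m(1,4)]] by blast+
    then show "b X = a (J X)" "b (J X) = - a X"
      by (simp_all add: eq_neg_iff_add_eq_0 add.commute)
  qed
  \<comment> \<open>By Koszul's formula, the Nijenhuis identity paired with \<open>Z\<close> reads \<open>a + J a J = b J - J b\<close>. Inserting
    \<open>a J = b\<close> and \<open>b J = - a\<close> turns it into \<open>a + J b = - (a + J b)\<close>.\<close>
  have a_anti: "a X = - J (b X)" if X: "X \<in> LI" for X
  proof -
    define W where "W = a X + J (b X)"
    have W: "W \<in> LI" unfolding W_def by (intro LI_plus LI_J a b X)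
    note v = left_invariant_vf[OF X] left_invariant_vf[OF LI_J[OF X]] left_invariant_vf[OF Zl(1)] left_invariant_vf[OF Zl(2)]
    have "g W Y 0 = 0" if Y: "Y \<in> LI" for Y
    proof -
      note w = left_invariant_vf[OF Y] left_invariant_vf[OF LI_J[OF Y]]
      let ?B = "lie_bracket"
      have br: "?B X Y \<in> vector_fields A" "?B (J X) Y \<in> vector_fields A" "?B X (J Y) \<in> vector_fields A"
        "?B (J X) (J Y) \<in> vector_fields A"
        by (intro vf_bracket v w)+
      have n: "?B (J X) (J Y) - ?B X Y = J (?B (J X) Y) + J (?B X (J Y))"
        using J_nijenhuis[OF v(1) w(1)] by (simp add: algebra_simps)
      have "g (?B (J X) (J Y)) Z 0 - g (?B X Y) Z 0 = g (?B (J X) (J Y) - ?B X Y) Z 0"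
        using g_minus_left[OF br(4,1) v(3)] by simp
      also have "\<dots> = - g (?B (J X) Y) (J Z) 0 - g (?B X (J Y)) (J Z) 0"
        unfolding n using g_plus_left[OF J_vf[OF br(2)] J_vf[OF br(3)] v(3)] J_skew[OF br(2) v(3)] J_skew[OF br(3) v(3)]
        by simp
      finally have "- g (a (J X)) (J Y) 0 + g (a X) Y 0 = g (b (J X)) Y 0 + g (b X) (J Y) 0"
        using D_central_koszul[OF Z X Y, of 0] D_central_koszul[OF Z LI_J[OF X] LI_J[OF Y], of 0]
          D_central_koszul[OF JZ LI_J[OF X] Y, of 0] D_central_koszul[OF JZ X LI_J[OF Y], of 0]
        by (simp add: a_def b_def)
      then have "- g (b X) (J Y) 0 + g (a X) Y 0 = g (- a X) Y 0 + g (b X) (J Y) 0"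
        using ab[OF X] by simp
      then have "g (a X) Y 0 = g (b X) (J Y) 0"
        using g_uminus_left[OF left_invariant_vf[OF a[OF X]] w(1)] by simp
      then show ?thesis
        using g_plus_left[OF left_invariant_vf[OF a[OF X]] left_invariant_vf[OF LI_J[OF b[OF X]]] w(1)] J_skew[OF left_invariant_vf[OF b[OF X]] w(1)]
        by (simp add: W_def)
    qed
    then have "W = 0" using W g_definite by blast
    then show ?thesis by (simp add: W_def eq_neg_iff_add_eq_0)
  qed
  have "a X = 0"
  proof -
    \<comment> \<open>The operator \<open>b\<close> is skew, and as \<open>b = J a = a J\<close> with skew \<open>a\<close> and \<open>J\<close>, it is also symmetric.\<close>
    have "g (b X) (b X) 0 = - g X (b (b X)) 0"
      using D_central_skew[OF JZ X b[OF X], of 0] by (simp add: b_def)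
    moreover have "g (b X) (b X) 0 = g X (b (b X)) 0"
    proof -
      have "b X = J (a X)"
      proof -
        have "J (a X) + J (J (b X)) = J (a X + J (b X))"
          using J_plus[OF left_invariant_vf[OF a[OF X]] left_invariant_vf[OF LI_J[OF b[OF X]]]] by (rule sym)
        also have "\<dots> = 0" using a_anti[OF X] J_zero by simp
        finally have "J (a X) - b X = 0" using J_J[OF left_invariant_vf[OF b[OF X]]] by simp
        then show ?thesis by simp
      qed
      then have "g (b X) (b X) = - g (a X) (J (b X))"
        using J_skew[OF left_invariant_vf[OF a[OF X]] left_invariant_vf[OF b[OF X]]] by simp
      moreover have "g (a X) (J (b X)) 0 = - g X (a (J (b X))) 0"
        using D_central_skew[OF Z X LI_J[OF b[OF X]]] by (simp add: a_def)
      ultimately show ?thesis using ab(1)[OF b[OF X]] by simp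
    qed
    ultimately have "b X = 0" using g_definite[OF b[OF X]] by simp
    then show ?thesis using a_anti[OF X] J_zero by simp
  qed
  then show ?thesis
    using D_central_koszul[OF Z X Y, of p] g_zero_left[OF left_invariant_vf[OF Y]] by (simp add: a_def)
qed

lemma ascending_series_one:
  "Z \<in> ascending_series A J 1 \<longleftrightarrow> central Z \<and> central (J Z)"
  using LI_J by (auto simp: central_def)

text \<open>
  A bracket that lies in the first ideal is orthogonal to every bracket, in particular to itself. So
  the condition defining the second ideal is the one defining the first.
\<close>

lemma ascending_series_stationary: "ascending_series A J (Suc k) = ascending_series A J 1"
proof (induction k)
  case (Suc k)
  have orth: "W = 0" if "W \<in> ascending_series A J 1" and W: "W = lie_bracket X Y" "X \<in> LI" "Y \<in> LI" for W X Y
  proof -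
    have c: "central W" "central (J W)" using that(1) ascending_series_one by auto
    have "g W W 0 = 0"
      using central_pair_orthogonal_to_brackets[OF c W(2,3), of 0] W(1) by simp
    then show ?thesis using c g_definite by (auto simp: central_def)
  qed
  have zero: "0 \<in> ascending_series A J 1"
  proof -
    have "lie_bracket 0 Y = 0" if "Y \<in> LI" for Y
      using vf_arg_zero[OF left_invariant_vf[OF that]] by (simp add: lie_bracket_def fun_eq_iff zero_fun_def)
    then have "central 0" using LI_zero by (simp add: central_def)
    then show ?thesis using ascending_series_one J_zero by simp
  qed
  have "X \<in> ascending_series A J (Suc (Suc k)) \<longleftrightarrow> X \<in> ascending_series A J 1" for X
  proof -
    have "X \<in> ascending_series A J (Suc (Suc k)) \<longleftrightarrow> X \<in> LI \<and>
        (\<forall>Y\<in>LI. lie_bracket X Y \<in> ascending_series A J 1 \<and> lie_bracket (J X) Y \<in> ascending_series A J 1)"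
      using Suc.IH by (subst ascending_series.simps) simp
    also have "\<dots> \<longleftrightarrow> X \<in> LI \<and> (\<forall>Y\<in>LI. lie_bracket X Y = 0 \<and> lie_bracket (J X) Y = 0)"
      using orth zero LI_J by metis
    finally show ?thesis by simp
  qed
  then show ?case by blast
qed simp

lemma abelian_if_nilpotent:
  assumes "nilpotent_complex_structure A J" and X: "X \<in> LI" and Y: "Y \<in> LI"
  shows "lie_bracket X Y = 0"
proof -
  obtain k where k: "ascending_series A J k = LI"
    using assms(1) unfolding nilpotent_complex_structure_def by blast
  show ?thesis
  proof (cases k)
    case 0
    then have "X = 0" "Y = 0" using k X Y by auto
    then show ?thesis by (simp add: lie_bracket_def fun_eq_iff)
  next
    case (Suc j)
    then have "X \<in> ascending_series A J 1" using ascending_series_stationary[of j] k X by simp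
    then show ?thesis using Y by simp
  qed
qed

end

theorem theorem4:
  fixes A :: "('g::{topological_group_add, t2_space, second_countable_topology},
                'e::euclidean_space) atlas"
    and J :: "'g vfield \<Rightarrow> 'g vfield"
    and g :: "'g vfield \<Rightarrow> 'g vfield \<Rightarrow> 'g \<Rightarrow> real"
  assumes "lie_hermitian A J g"
    and "nilpotent_complex_structure A J"
  shows "riemannian_kahler_like A J g \<longleftrightarrow> (\<forall>x y :: 'g. x + y = y + x)"
proof -
  have "lie_group A" using assms(1) by (simp add: lie_hermitian_def)
  then interpret lie_group_manifold A
    by unfold_locales (simp_all add: lie_group_def)
  obtain U \<phi> where U: "(U, \<phi>) \<in> A" "0 \<in> U" by (rule chart_at)
  obtain \<xi> N where N: "open N" "0 \<in> N" "N \<subseteq> U" "\<And>b. smooth_fun A (\<xi> b)"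
    "\<And>b q. q \<in> N \<Longrightarrow> \<xi> b q = \<phi> q \<bullet> b"
    using chart_coordinates[OF U] by metis
  interpret lie_hermitian_chart A U \<phi> \<xi> N J g
    by unfold_locales (rule U(1) N assms(1) | assumption)+
  show ?thesis
  proof
    assume "riemannian_kahler_like A J g"
    then obtain D where "levi_civita A g D" "kahler_like A J g D"
      unfolding riemannian_kahler_like_def by blast
    then interpret riemannian_kahler_like_group A U \<phi> \<xi> N J g D
      by unfold_locales
    show "\<forall>x y :: 'g. x + y = y + x"
      using abelian_group_if_abelian_algebra abelian_if_nilpotent[OF assms(2)] by blast
  next
    assume "\<forall>x y :: 'g. x + y = y + x"
    then show "riemannian_kahler_like A J g"
      by (intro riemannian_kahler_like_if_commutative) blast
  qed
qed

end
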